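(* Let $R_N=\mathbb C[k_1,\dots,k_N]/I_N$ and let $\mathfrak P_N$ be the set of prime ideals of $R_N$ that are minimal over a principal ideal $(Q_J)$ for some internal $J$. For $N=4$, $|\mathfrak P_4|=8$: they are $\mathfrak p_{++++}$, generated by the maximal minors of the $2\times8$ matrix $(k_1\,k_2\,k_3\,k_4)$, and $\mathfrak p_{----}$, generated by the maximal minors of $(k_1^T\,k_2^T\,k_3^T\,k_4^T)$, each of which is minimal over all three ideals $(Q_{12}),(Q_{13}),(Q_{14})$; and the six ideals $\mathfrak p_{++--}$ and its inequivalent permutations, where $\mathfrak p_{++--}$ is generated by the maximal minors of $(k_1\,k_2)$ and of $(k_3^T\,k_4^T)$ and is minimal over $(Q_{12})=(Q_{34})$. For $N\ge5$, every $\mathfrak p\in\mathfrak P_N$ lies over a unique $(Q_J)$ (up to $J\leftrightarrow J^c$); if $|J|\ge3$ and $|J^c|\ge3$ then $(Q_J)$ is itself prime; and for $i\ne j$ there are exactly two minimal primes over $(Q_{\{i,j\}})$, namely $\mathfrak p^+_{ij}$ and $\mathfrak p^-_{ij}$, generated by the maximal minors of the $2\times4$ matrix $(k_i\,k_j)$ resp. $(k_i^T\,k_j^T)$.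
   Context: $k_i=\begin{pmatrix}a_i&b_i\\c_i&d_i\end{pmatrix}$, $Q_i=a_id_i-b_ic_i$, $I_N$ generated by the entries of $k_1+\dots+k_N$ and $Q_1,\dots,Q_N$. For $N\ge4$ an internal momentum is a subset $J\subset\{1,\dots,N\}$ with $2\le|J|\le N-2$; $k_J=\sum_{i\in J}k_i$, $Q_J=\det k_J\in R_N$ (so $Q_J=Q_{J^c}$); $Q_{ij}=Q_{\{i,j\}}$. *)

theory Defs
  imports Complex_Main "HOL-Algebra.QuotRing" "HOL-Library.Poly_Mapping"
begin

type_synonym mpoly = "(nat \<Rightarrow>\<^sub>0 nat) \<Rightarrow>\<^sub>0 complex"

definition Var :: "nat \<Rightarrow> mpoly" where
  "Var v = Poly_Mapping.single (Poly_Mapping.single v 1) 1"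

definition polyR :: "nat \<Rightarrow> mpoly ring" where
  "polyR N = \<lparr>carrier = {p::mpoly. \<forall>m\<in>Poly_Mapping.keys p. Poly_Mapping.keys m \<subseteq> {..<4*N}},
              mult = (*), one = 1, zero = 0, add = (+)\<rparr>"

text \<open>Entries of k_i (i = 1..N): a_i, b_i, c_i, d_i.\<close>
definition va :: "nat \<Rightarrow> mpoly" where "va i = Var (4*(i-1))"
definition vb :: "nat \<Rightarrow> mpoly" where "vb i = Var (4*(i-1)+1)"
definition vc :: "nat \<Rightarrow> mpoly" where "vc i = Var (4*(i-1)+2)"
definition vd :: "nat \<Rightarrow> mpoly" where "vd i = Var (4*(i-1)+3)"

text \<open>Q_J = det k_J, with k_J = sum of k_i over i in J; Q_i = Q_{i}.\<close>
definition QJ :: "nat set \<Rightarrow> mpoly" where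
  "QJ J = (\<Sum>i\<in>J. va i) * (\<Sum>i\<in>J. vd i) - (\<Sum>i\<in>J. vb i) * (\<Sum>i\<in>J. vc i)"

definition IN :: "nat \<Rightarrow> mpoly set" where
  "IN N = Idl\<^bsub>polyR N\<^esub>
     ({(\<Sum>i\<in>{1..N}. va i), (\<Sum>i\<in>{1..N}. vb i), (\<Sum>i\<in>{1..N}. vc i), (\<Sum>i\<in>{1..N}. vd i)}
      \<union> {QJ {i} | i. i \<in> {1..N}})"

definition RN :: "nat \<Rightarrow> mpoly set ring" where
  "RN N = polyR N Quot IN N"

definition cls :: "nat \<Rightarrow> mpoly \<Rightarrow> mpoly set" where
  "cls N p = IN N +>\<^bsub>polyR N\<^esub> p"

definition internal :: "nat \<Rightarrow> nat set \<Rightarrow> bool" where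
  "internal N J \<longleftrightarrow> J \<subseteq> {1..N} \<and> 2 \<le> card J \<and> card J \<le> N - 2"

definition QI :: "nat \<Rightarrow> nat set \<Rightarrow> mpoly set set" where
  "QI N J = Idl\<^bsub>RN N\<^esub> {cls N (QJ J)}"

definition minprime_over :: "('a, 'b) ring_scheme \<Rightarrow> 'a set \<Rightarrow> 'a set \<Rightarrow> bool" where
  "minprime_over R A P \<longleftrightarrow> primeideal P R \<and> A \<subseteq> P \<and>
     (\<forall>P'. primeideal P' R \<and> A \<subseteq> P' \<and> P' \<subseteq> P \<longrightarrow> P' = P)"

definition PrimesN :: "nat \<Rightarrow> mpoly set set set" where
  "PrimesN N = {P. \<exists>J. internal N J \<and> minprime_over (RN N) (QI N J) P}"

text \<open>Columns of the 2 x 2|S| matrix (k_i)_{i in S}, resp. of (k_i^T)_{i in S}.\<close>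
definition colsP :: "nat set \<Rightarrow> (mpoly \<times> mpoly) set" where
  "colsP S = {(va i, vc i) | i. i \<in> S} \<union> {(vb i, vd i) | i. i \<in> S}"
definition colsM :: "nat set \<Rightarrow> (mpoly \<times> mpoly) set" where
  "colsM S = {(va i, vb i) | i. i \<in> S} \<union> {(vc i, vd i) | i. i \<in> S}"

definition minors :: "(mpoly \<times> mpoly) set \<Rightarrow> mpoly set" where
  "minors C = {x1 * y2 - x2 * y1 | x1 y1 x2 y2. (x1, y1) \<in> C \<and> (x2, y2) \<in> C}"

definition pmix :: "nat \<Rightarrow> nat set \<Rightarrow> nat set \<Rightarrow> mpoly set set" where
  "pmix N S T = Idl\<^bsub>RN N\<^esub> (cls N ` (minors (colsP S) \<union> minors (colsM T)))"

abbreviation pPlus :: "nat \<Rightarrow> nat set \<Rightarrow> mpoly set set" where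
  "pPlus N S \<equiv> pmix N S {}"
abbreviation pMinus :: "nat \<Rightarrow> nat set \<Rightarrow> mpoly set set" where
  "pMinus N S \<equiv> pmix N {} S"

end

theory Submission
  imports Defs "HOL-Computational_Algebra.Polynomial"
begin

text \<open>Momentum spinors \<open>k\<^sub>i = \<lambda>\<^sub>i \<mu>\<^sub>i\<^sup>T\<close> identify \<open>\<complex>[k]/(Q\<^sub>i)\<close> with the torus invariants of \<open>\<complex>[\<lambda>, \<mu>]\<close>,
  and a linear
  projection onto the invariants shows that ideals generated by invariants contract to themselves.  After one
  momentum is eliminated the remaining conservation law is a single equation \<open>Q\<^sub>K = 0\<close>, which is linear in one
  spinor coordinate with a coefficient that is again linear in another one, and so on.  Hence, for \<open>N \<ge> 5\<close>,
  \<open>(\<langle>i j\<rangle>, Q\<^sub>K)\<close> and \<open>(Q\<^sub>J, Q\<^sub>K)\<close> are prime by repeated use of: \<open>a x + b\<close> is prime over a domain if \<open>a\<close> is a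
  nonzero prime element not dividing \<open>b\<close>.  Since \<open>Q\<^sub>i\<^sub>j = \<langle>i j\<rangle>[i j]\<close>, the products of minors of \<open>(k\<^sub>i k\<^sub>j)\<close>
    and
  \<open>(k\<^sub>i\<^sup>T k\<^sub>j\<^sup>T)\<close> lie in \<open>(Q\<^sub>i\<^sub>j)\<close>, which leaves only the two stated minimal primes.  For \<open>N
    = 4\<close> the eight ideals are
  toric in suitable coordinates, and \<open>\<langle>i k\<rangle>[i j] = \<langle>k l\<rangle>[l j]\<close>
    forces one of four of them into any prime containing
  \<open>Q\<^sub>i\<^sub>j\<close>.  Inclusions are excluded by evaluating at explicit configurations.\<close>

section \<open>Ideals and evaluation homomorphisms\<close>

text \<open>\<open>idl.span G\<close> is the ideal generated by \<open>G\<close>. Primality is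
  established in the ring \<open>mpoly\<close> with its infinitely many variables and carried to
  \<open>polyR N\<close> and \<open>RN N\<close> by setting the surplus variables to 0, which keeps
  carriers out of the algebra. Solving conservation for one momentum turns its determinant into the
  determinant of a sum of the others. In spinor coordinates all other determinants vanish
  identically and this last one has degree at most one in every single variable, which is what makes
  linear extension applicable. The price is that brackets are not torus invariant, so the
  contraction of an ideal they generate has to be computed: a bracket times a monomial is either
  killed by the projection or is a multiple of the image of a minor. The bound
  \<open>N \<ge> 5\<close> reflects that a pair must leave three other particles: one to eliminate
  and two to carry the chain of linear steps. Minimal primes are never found by decomposing an
  ideal. It suffices to list primes over it that are pairwise incomparable and such that every prime
  over it contains one of them.\<close>

interpretation idl: module "(*) :: 'a::comm_ring_1 \<Rightarrow> 'a \<Rightarrow> 'a"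
  by unfold_locales (simp_all add: algebra_simps)

text \<open>This is associativity, oriented against \<open>algebra_simps\<close>.\<close>
declare idl.scale_scale [simp del]

lemma idl_span_mult_right: "a \<in> idl.span G \<Longrightarrow> a * b \<in> idl.span G"
  for a :: "'a::comm_ring_1"
  using idl.span_scale[of a G b] by (simp add: mult.commute)

lemma idl_span_trans: "x \<in> idl.span A \<Longrightarrow> A \<subseteq> idl.span B \<Longrightarrow> x \<in> idl.span B"
  for x :: "'a::comm_ring_1"
  using idl.span_minimal[of A "idl.span B"] by auto

lemma idl_span_diff_trans:
  "a - b \<in> idl.span G \<Longrightarrow> b - c \<in> idl.span G \<Longrightarrow> a - c \<in> idl.span G"
  for a :: "'a::comm_ring_1"
  using idl.span_add[of "a - b" G "b - c"] by simp

lemma idl_span_diff_cong: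
  "a - b \<in> idl.span G \<Longrightarrow> a \<in> idl.span G \<longleftrightarrow> b \<in> idl.span G"
  for a :: "'a::comm_ring_1"
  using idl.span_add_eq[of "a - b" G b] by simp

text \<open>Counterpart of \<open>primeideal\<close> for ideals of a whole type; the two notions
  meet in \<open>primeideal_genI\<close>.\<close>

definition is_prime :: "'a::comm_ring_1 set \<Rightarrow> bool" where
  "is_prime Q \<longleftrightarrow> idl.subspace Q \<and> 1 \<notin> Q \<and> (\<forall>a b. a * b \<in> Q \<longrightarrow> a \<in> Q \<or> b \<in> Q)"

lemma is_primeD: "is_prime Q \<Longrightarrow> a * b \<in> Q \<Longrightarrow> a \<in> Q \<or> b \<in> Q"
  unfolding is_prime_def by blast

locale rhom =
  fixes h :: "'a::comm_ring_1 \<Rightarrow> 'b::comm_ring_1"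
  assumes hom_add: "h (x + y) = h x + h y"
    and hom_mult: "h (x * y) = h x * h y"
    and hom_one: "h 1 = 1"
begin

lemma hom_zero: "h 0 = 0"
  using hom_add[of 0 0] by simp

lemma hom_diff: "h (x - y) = h x - h y"
  using hom_add[of "x - y" y] by (simp add: algebra_simps)

lemma hom_uminus: "h (- x) = - h x"
  using hom_diff[of 0 x] by (simp add: hom_zero)

lemma hom_sum: "h (sum f A) = (\<Sum>x\<in>A. h (f x))"
  by (induction A rule: infinite_finite_induct) (auto simp: hom_zero hom_add)

lemmas hom_simps = hom_add hom_mult hom_one hom_zero hom_diff hom_uminus hom_sum

lemma span_image_subset: "x \<in> idl.span G \<Longrightarrow> h x \<in> idl.span (h ` G)"
proof (induction rule: idl.span_induct_alt)
  case base
  then show ?case by (simp add: hom_zero idl.span_zero)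
next
  case (step c x y)
  then show ?case by (simp add: hom_add hom_mult idl.span_add idl.span_scale idl.span_base)
qed

text \<open>Besides linear extension this is the source of primes below: an ideal is recognised as
  the preimage of a known prime, often of 0 in a domain.\<close>

lemma is_prime_vimage: assumes "is_prime Q" shows "is_prime (h -` Q)"
  using assms unfolding is_prime_def idl.subspace_def vimage_eq hom_simps by blast

lemma span_vanish: "x \<in> idl.span G \<Longrightarrow> (\<And>g. g \<in> G \<Longrightarrow> h g = 0) \<Longrightarrow> h x = 0"
  by (induction rule: idl.span_induct_alt) (auto simp: hom_simps)

end

lemma rhom_comp: "rhom f \<Longrightarrow> rhom g \<Longrightarrow> rhom (\<lambda>x. f (g x))"
  by (simp add: rhom_def)

lemma rhom_ident: "rhom (\<lambda>x. x)"
  by (simp add: rhom_def)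

lemma is_prime_zero: "is_prime {0 :: 'a::idom}"
  unfolding is_prime_def idl.subspace_def by simp

section \<open>Polynomials\<close>

definition mon :: "(nat \<Rightarrow>\<^sub>0 nat) \<Rightarrow> mpoly" where
  "mon m = Poly_Mapping.single m 1"

definition Const :: "complex \<Rightarrow> mpoly" where
  "Const c = Poly_Mapping.single 0 c"

lemma mon_0: "mon 0 = 1"
  by (simp add: mon_def)

lemma mon_add: "mon (a + b) = mon a * mon b"
  by (simp add: mon_def mult_single)

lemma Var_mon: "Var v = mon (Poly_Mapping.single v 1)"
  by (simp add: Var_def mon_def)

lemma Const_mon: "Const c * mon m = Poly_Mapping.single m c"
  by (simp add: mon_def Const_def mult_single)

lemma rhom_Const: "rhom Const"
  by (simp add: rhom_def Const_def single_add mult_single)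

lemma mpoly_sum_mon: "p = (\<Sum>m\<in>Poly_Mapping.keys p. Const (Poly_Mapping.lookup p m) * mon m)"
proof (rule poly_mapping_eqI)
  fix k
  show "Poly_Mapping.lookup p k = Poly_Mapping.lookup (\<Sum>m\<in>Poly_Mapping.keys p. Const (Poly_Mapping.lookup p
    m) * mon m) k"
  proof (cases "k \<in> Poly_Mapping.keys p")
    case True
    then show ?thesis
      by (simp add: Const_mon lookup_sum lookup_single when_def sum.delta)
  next
    case False
    then show ?thesis
      by (simp add: Const_mon lookup_sum lookup_single when_def in_keys_iff)
  qed
qed

lemma mpoly_linear_induct [case_names mon add]:
  assumes "\<And>c m. P (Const c * mon m)" "\<And>p q. P p \<Longrightarrow> P q \<Longrightarrow> P (p + q)"
  shows "P p"
proof -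
  have "P 0" using assms(1)[of 0 0] by (simp add: Const_def)
  then have "P (\<Sum>m\<in>A. Const (Poly_Mapping.lookup p m) * mon m)" for A
    by (induction A rule: infinite_finite_induct) (auto intro: assms)
  then show ?thesis using mpoly_sum_mon[of p] by metis
qed

lemma exponent_induct [case_names zero add]:
  fixes m :: "nat \<Rightarrow>\<^sub>0 nat"
  assumes "P 0" and "\<And>v m. P m \<Longrightarrow> P (Poly_Mapping.single v 1 + m)"
  shows "P m"
proof (induction "sum (Poly_Mapping.lookup m) (Poly_Mapping.keys m)" arbitrary: m rule: less_induct)
  case less
  show ?case
  proof (cases "m = 0")
    case True
    then show ?thesis using assms(1) by simp
  next
    case False
    then obtain v where v: "v \<in> Poly_Mapping.keys m"
      by (metis in_keys_iff lookup_zero poly_mapping_eqI)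
    define m' where "m' = m - Poly_Mapping.single v 1"
    have m: "m = Poly_Mapping.single v 1 + m'"
    proof (rule poly_mapping_eqI)
      fix k show "Poly_Mapping.lookup m k = Poly_Mapping.lookup (Poly_Mapping.single v 1 + m') k"
        using v by (auto simp: m'_def lookup_add lookup_minus lookup_single when_def in_keys_iff)
    qed
    have le: "Poly_Mapping.lookup m' k \<le> Poly_Mapping.lookup m k" for k
      by (simp add: m'_def lookup_minus)
    have sub: "Poly_Mapping.keys m' \<subseteq> Poly_Mapping.keys m"
    proof
      fix k assume "k \<in> Poly_Mapping.keys m'"
      then show "k \<in> Poly_Mapping.keys m" using le[of k] by (simp add: in_keys_iff)
    qed
    have "sum (Poly_Mapping.lookup m') (Poly_Mapping.keys m') \<le> sum (Poly_Mapping.lookup m')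
      (Poly_Mapping.keys m)"
      using sub by (intro sum_mono2) auto
    also have "\<dots> < sum (Poly_Mapping.lookup m) (Poly_Mapping.keys m)"
    proof (rule sum_strict_mono_ex1)
      show "\<exists>k\<in>Poly_Mapping.keys m. Poly_Mapping.lookup m' k < Poly_Mapping.lookup m k"
        using v by (intro bexI[of _ v]) (auto simp: m'_def lookup_minus in_keys_iff)
    qed (use le in auto)
    finally have "P m'" by (rule less)
    then show ?thesis using assms(2)[of m' v] m by simp
  qed
qed

lemma mpoly_induct [case_names Const Var add mult]:
  assumes c: "\<And>c. P (Const c)" and v: "\<And>v. P (Var v)"
    and a: "\<And>p q. P p \<Longrightarrow> P q \<Longrightarrow> P (p + q)" and m: "\<And>p q. P p \<Longrightarrow> P q \<Longrightarrow> P (p * q)"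
  shows "P p"
proof (induction p rule: mpoly_linear_induct)
  case (mon d e)
  have "P (mon e)"
  proof (induction e rule: exponent_induct)
    case zero
    then show ?case using c[of 1] by (simp add: mon_0 Const_def)
  next
    case (add w e)
    then show ?case using m[OF v[of w]] by (simp add: mon_add Var_mon)
  qed
  then show ?case using c m by blast
qed (rule a)

text \<open>\<open>F\<close> is an arbitrary function on monomials. A multiplicative
  \<open>F\<close> yields the evaluation homomorphisms, a non-multiplicative one the merely linear
  section \<open>sec\<close> of a toric map.\<close>

definition lin_ext :: "(complex \<Rightarrow> 'b::comm_ring_1) \<Rightarrow> ((nat \<Rightarrow>\<^sub>0 nat) \<Rightarrow> 'b) \<Rightarrow> mpoly \<Rightarrow> 'b" where
  "lin_ext h F p = (\<Sum>m\<in>Poly_Mapping.keys p. h (Poly_Mapping.lookup p m) * F m)"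

lemma lin_ext_superset:
  assumes "rhom h" "finite A" "Poly_Mapping.keys p \<subseteq> A"
  shows "lin_ext h F p = (\<Sum>m\<in>A. h (Poly_Mapping.lookup p m) * F m)"
  unfolding lin_ext_def using assms
  by (intro sum.mono_neutral_left) (auto simp: in_keys_iff rhom.hom_zero)

lemma lin_ext_add: "rhom h \<Longrightarrow> lin_ext h F (p + q) = lin_ext h F p + lin_ext h F q"
  using keys_add[of p q]
  by (simp add: lin_ext_superset[of h "Poly_Mapping.keys p \<union> Poly_Mapping.keys q"]
      lookup_add rhom.hom_add algebra_simps sum.distrib)

lemma lin_ext_mon: "rhom h \<Longrightarrow> lin_ext h F (Const c * mon m) = h c * F m"
  by (subst lin_ext_superset[of h "{m}"]) (auto simp: Const_mon lookup_single split: if_splits)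

definition expmon :: "(nat \<Rightarrow> 'b::comm_ring_1) \<Rightarrow> (nat \<Rightarrow>\<^sub>0 nat) \<Rightarrow> 'b" where
  "expmon f m = (\<Prod>v\<in>Poly_Mapping.keys m. f v ^ Poly_Mapping.lookup m v)"

lemma expmon_superset: "finite A \<Longrightarrow> Poly_Mapping.keys m \<subseteq> A \<Longrightarrow> expmon f m
  = (\<Prod>v\<in>A. f v ^ Poly_Mapping.lookup m v)"
  unfolding expmon_def by (intro prod.mono_neutral_left) (auto simp: in_keys_iff)

lemma expmon_add: "expmon f (m + n) = expmon f m * expmon f n"
  using keys_add[of m n]
  by (simp add: expmon_superset[of "Poly_Mapping.keys m \<union> Poly_Mapping.keys n"]
      lookup_add power_add prod.distrib)

lemma expmon_0: "expmon f 0 = 1"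
  by (simp add: expmon_def)

lemma expmon_single: "expmon f (Poly_Mapping.single v 1) = f v"
  by (simp add: expmon_def)

definition meval :: "(complex \<Rightarrow> 'b::comm_ring_1) \<Rightarrow> (nat \<Rightarrow> 'b) \<Rightarrow> mpoly \<Rightarrow> 'b" where
  "meval h f = lin_ext h (expmon f)"

lemma meval_mon: "rhom h \<Longrightarrow> meval h f (Const c * mon m) = h c * expmon f m"
  by (simp add: meval_def lin_ext_mon)

lemma rhom_meval: assumes "rhom h" shows "rhom (meval h f)"
proof
  interpret h: rhom h by fact
  show add: "meval h f (p + q) = meval h f p + meval h f q" for p q
    by (simp add: meval_def lin_ext_add assms)
  show "meval h f 1 = 1"
    using meval_mon[OF assms, of f 1 0] by (simp add: mon_0 Const_def expmon_0 h.hom_one)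
  show "meval h f (p * q) = meval h f p * meval h f q" for p q
  proof (induction p rule: mpoly_linear_induct)
    case (mon c m)
    show ?case
    proof (induction q rule: mpoly_linear_induct)
      case (mon d n)
      have "Const c * mon m * (Const d * mon n) = Const (c * d) * mon (m + n)"
        by (simp add: Const_mon mult_single)
      then show ?case
        by (simp add: meval_mon assms expmon_add h.hom_mult)
    qed (simp add: add distrib_left)
  qed (simp add: add distrib_right)
qed

lemma meval_Var: "rhom h \<Longrightarrow> meval h f (Var v) = f v"
  using meval_mon[of h f 1 "Poly_Mapping.single v 1"]
  by (simp add: Var_mon Const_def expmon_single[simplified] rhom.hom_one)

lemma meval_Const: "rhom h \<Longrightarrow> meval h f (Const c) = h c"
  using meval_mon[of h f c 0] by (simp add: mon_0 expmon_0)

definition subst :: "(nat \<Rightarrow> mpoly) \<Rightarrow> mpoly \<Rightarrow> mpoly" where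
  "subst = meval Const"

definition ev :: "(nat \<Rightarrow> complex) \<Rightarrow> mpoly \<Rightarrow> complex" where
  "ev = meval (\<lambda>c. c)"

interpretation subst: rhom "subst f"
  unfolding subst_def by (intro rhom_meval rhom_Const)

interpretation ev: rhom "ev z"
  unfolding ev_def by (intro rhom_meval rhom_ident)

lemma subst_Var [simp]: "subst f (Var v) = f v"
  by (simp add: subst_def meval_Var rhom_Const)

lemma subst_Const [simp]: "subst f (Const v) = Const v"
  by (simp add: subst_def meval_Const rhom_Const)

lemma ev_Var [simp]: "ev z (Var v) = z v"
  by (simp add: ev_def meval_Var rhom_ident)

lemma ev_Const [simp]: "ev z (Const v) = v"
  by (simp add: ev_def meval_Const rhom_ident)

text \<open>The polynomials fixed modulo the ideal are closed under sums and products, so the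
  variables decide. This is how eliminating a momentum, or changing coordinates and returning, is
  seen to be the identity modulo the ideal at hand.\<close>

lemma subst_cong_mod:
  assumes "\<And>v. Var v - f v \<in> idl.span G"
  shows "p - subst f p \<in> idl.span G"
proof (induction p rule: mpoly_induct)
  case (add p q)
  then show ?case using idl.span_add[OF add] by (simp add: subst.hom_add algebra_simps)
next
  case (mult p q)
  have "p * q - subst f (p * q) = q * (p - subst f p) + subst f p * (q - subst f q)"
    by (simp add: subst.hom_mult algebra_simps)
  then show ?case using mult by (simp add: idl.span_add idl.span_scale)
qed (auto simp: assms idl.span_zero)

lemma subst_subst: "subst f (subst g p) = subst (\<lambda>v. subst f (g v)) p"
  by (induction p rule: mpoly_induct) (auto simp: subst.hom_simps)

lemma ev_subst: "ev z (subst g p) = ev (\<lambda>v. ev z (g v)) p"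
  by (induction p rule: mpoly_induct) (auto simp: subst.hom_simps ev.hom_simps)

lemma subst_ident: "subst Var p = p"
  by (induction p rule: mpoly_induct) (auto simp: subst.hom_simps)

definition vars :: "mpoly \<Rightarrow> nat set" where
  "vars p = (\<Union>m\<in>Poly_Mapping.keys p. Poly_Mapping.keys m)"

lemma vars_add: "vars (p + q) \<subseteq> vars p \<union> vars q"
  using keys_add[of p q] by (auto simp: vars_def)

lemma vars_mult: "vars (p * q) \<subseteq> vars p \<union> vars q"
proof
  fix v assume "v \<in> vars (p * q)"
  then obtain m where "m \<in> Poly_Mapping.keys (p * q)" "v \<in> Poly_Mapping.keys m"
    by (auto simp: vars_def)
  then obtain a b where "m = a + b" "a \<in> Poly_Mapping.keys p" "b \<in> Poly_Mapping.keys q"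
    using keys_mult[of p q] by blast
  then show "v \<in> vars p \<union> vars q"
    using \<open>v \<in> Poly_Mapping.keys m\<close> keys_add[of a b] by (auto simp: vars_def)
qed

lemma vars_uminus [simp]: "vars (- p) = vars p"
  by (auto simp: vars_def in_keys_iff)

lemma vars_diff: "vars (p - q) \<subseteq> vars p \<union> vars q"
  using vars_add[of p "- q"] by simp

lemma vars_0 [simp]: "vars 0 = {}"
  by (simp add: vars_def)

lemma vars_1 [simp]: "vars 1 = {}"
  by (simp add: vars_def)

lemma vars_Var [simp]: "vars (Var v) = {v}"
  by (simp add: vars_def Var_def)

lemma vars_Const [simp]: "vars (Const v) = {}"
  by (simp add: vars_def Const_def)

lemma vars_sum: "vars (sum f A) \<subseteq> (\<Union>x\<in>A. vars (f x))"
proof (induction A rule: infinite_finite_induct)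
  case (insert x F)
  then show ?case using vars_add[of "f x" "sum f F"] by auto
qed auto

lemma expmon_cong: "(\<And>v. v \<in> Poly_Mapping.keys m \<Longrightarrow> f v = g v) \<Longrightarrow> expmon f m = expmon g m"
  by (simp add: expmon_def)

lemma meval_cong: "(\<And>v. v \<in> vars p \<Longrightarrow> f v = g v) \<Longrightarrow> meval h f p = meval h g p"
  unfolding meval_def lin_ext_def
  by (intro sum.cong refl arg_cong2[of _ _ _ _ "(*)"] expmon_cong) (auto simp: vars_def)

lemma subst_cong: "(\<And>v. v \<in> vars p \<Longrightarrow> f v = g v) \<Longrightarrow> subst f p = subst g p"
  unfolding subst_def by (rule meval_cong)

lemma ev_cong: "(\<And>v. v \<in> vars p \<Longrightarrow> f v = g v) \<Longrightarrow> ev f p = ev g p"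
  unfolding ev_def by (rule meval_cong)

lemma subst_vars_ident: "(\<And>v. v \<in> vars p \<Longrightarrow> f v = Var v) \<Longrightarrow> subst f p = p"
  using subst_cong[of p f Var] subst_ident by simp

lemma vars_subst: assumes "\<And>v. vars (f v) \<subseteq> V" shows "vars (subst f p) \<subseteq> V"
proof (induction p rule: mpoly_induct)
  case (add p q) then show ?case using vars_add[of "subst f p" "subst f q"] by
    (simp add: subst.hom_simps subset_iff) blast
next
  case (mult p q) then show ?case using vars_mult[of "subst f p" "subst f q"] by
    (simp add: subst.hom_simps subset_iff) blast
qed (use assms in auto)

section \<open>Primality of linear polynomials\<close>

text \<open>Separates the powers of \<open>x\<close>. The coefficients keep the type
  \<open>mpoly\<close> although they no longer involve \<open>x\<close>.\<close>

definition upoly :: "nat \<Rightarrow> mpoly \<Rightarrow> mpoly poly" where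
  "upoly x = meval (\<lambda>c. [:Const c:]) (\<lambda>v. if v = x then [:0, 1:] else [:Var v:])"

lemma rhom_const_poly: "rhom (\<lambda>c. [:Const c:])"
  using rhom_Const by (simp add: rhom_def one_pCons)

interpretation upoly: rhom "upoly x"
  unfolding upoly_def by (intro rhom_meval rhom_const_poly)

lemma upoly_free: assumes "x \<notin> vars p" shows "upoly x p = [:p:]"
proof -
  define g where "g = meval (\<lambda>c. [:Const c:]) (\<lambda>v. [:Var v:])"
  interpret g: rhom g
    unfolding g_def by (intro rhom_meval rhom_const_poly)
  have "g p = [:p:]" for p
    by (induction p rule: mpoly_induct)
      (simp_all add: g.hom_add g.hom_mult, simp_all add: g_def meval_Const meval_Var rhom_const_poly)
  moreover have "upoly x p = g p"
    unfolding g_def upoly_def using assms by (intro meval_cong) auto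
  ultimately show ?thesis by simp
qed

lemma upoly_Var: "upoly x (Var x) = [:0, 1:]"
  by (simp add: upoly_def meval_Var rhom_const_poly)

text \<open>Generators free of \<open>x\<close> act as constants on polynomials in \<open>x\<close>,
  so membership passes to each coefficient.\<close>

lemma coeff_upoly_span:
  assumes "u \<in> idl.span G" "\<And>g. g \<in> G \<Longrightarrow> x \<notin> vars g"
  shows "coeff (upoly x u) k \<in> idl.span G"
  using assms(1)
proof (induction rule: idl.span_induct_alt)
  case (step c g y)
  then show ?case using assms(2)
    by (simp add: upoly.hom_add upoly.hom_mult upoly_free mult.commute[of _ "[:g:]"]
        idl.span_add idl_span_mult_right idl.span_base)
qed (simp add: upoly.hom_zero idl.span_zero)

text \<open>Modulo \<open>G\<close>, the ring of polynomials in \<open>x\<close> embeds after inverting \<open>a\<close> into one where \<open>x\<close> is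
  replaced by \<open>-b/a\<close>; the condition on \<open>b\<close> makes \<open>a\<close> regular modulo \<open>a x + b\<close>.\<close>
lemma linear_prime:
  fixes a b :: mpoly
  assumes prime: "is_prime (idl.span G)"
    and free: "\<And>g. g \<in> G \<Longrightarrow> x \<notin> vars g" "x \<notin> vars a" "x \<notin> vars b"
    and a: "a \<notin> idl.span G"
    and reg: "\<And>v. b * v \<in> idl.span (insert a G) \<Longrightarrow> v \<in> idl.span (insert a G)"
  shows "is_prime (idl.span (insert (a * Var x + b) G))"
proof -
  define Q where "Q = idl.span G"
  define l where "l = a * Var x + b"
  define P where "P = idl.span (insert l G)"
  have QP: "Q \<subseteq> P" unfolding Q_def P_def by (intro idl.span_mono) auto
  have P_iff: "p \<in> P \<longleftrightarrow> (\<exists>k. p - k * l \<in> Q)" for p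
    unfolding P_def Q_def by (rule idl.span_breakdown_eq)
  have contract: "r \<in> Q" if r: "r \<in> P" "x \<notin> vars r" for r
  proof -
    obtain k where k: "r - k * l \<in> Q" using r P_iff by auto
    define w where "w = upoly x k"
    have up: "upoly x (r - k * l) = [:r:] - w * [:b, a:]"
      using r(2) free
      by (simp add: upoly.hom_simps upoly_free l_def upoly_Var w_def)
    have cf: "coeff ([:r:] - w * [:b, a:]) n \<in> Q" for n
      using coeff_upoly_span[OF k[unfolded Q_def] free(1), of n] up by (simp add: Q_def)
    have w: "coeff w n \<in> Q" for n
    proof (rule ccontr)
      assume n: "coeff w n \<notin> Q"
      define A where "A = {n. coeff w n \<notin> Q}"
      have "A \<subseteq> {..degree w}"
        using idl.span_zero[of G] by (auto simp: A_def Q_def intro: le_degree)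
      then have fin: "finite A" by (rule finite_subset) simp
      \<comment> \<open>The highest coefficient of \<open>w\<close> outside \<open>Q\<close>. In
        degree \<open>Suc M\<close> the product of \<open>w\<close> with \<open>a x + b\<close>
        equals \<open>a * coeff w M\<close> modulo \<open>Q\<close>, while \<open>r\<close> has
        degree 0; primality of \<open>Q\<close> then contradicts the choice of
        \<open>M\<close>.\<close>
      define M where "M = Max A"
      have M: "coeff w M \<notin> Q" "coeff w (Suc M) \<in> Q"
        using Max_in[OF fin] n Max_ge[OF fin, of "Suc M"] by (auto simp: A_def M_def)
      have "coeff ([:r:] - w * [:b, a:]) (Suc M) = - (b * coeff w (Suc M) + a * coeff w M)"
        by (simp add: mult.commute[of w])
      then have "b * coeff w (Suc M) + a * coeff w M \<in> Q"
        using idl.span_neg[OF cf[of "Suc M", unfolded Q_def]] by (simp add: Q_def add.commute)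
      then have "a * coeff w M \<in> Q"
        using M(2) idl.span_add_eq[of "b * coeff w (Suc M)" G] by (simp add: Q_def idl.span_scale)
      from is_primeD[OF prime this[unfolded Q_def]] show False using M a unfolding Q_def by blast
    qed
    have "r - b * coeff w 0 \<in> Q" using cf[of 0] by (simp add: mult.commute[of w])
    then show ?thesis using w[of 0] idl_span_diff_cong[of r _ G] by (simp add: Q_def idl.span_scale)
  qed
  \<comment> \<open>Multiplication by \<open>a\<close> is injective modulo \<open>P\<close>: a
    relation \<open>a p = k l\<close> makes \<open>b k\<close> divisible by \<open>a\<close>, hence
    \<open>k = c a\<close> by \<open>reg\<close>, and \<open>a\<close> cancels from
    \<open>a (p - c l)\<close> because \<open>Q\<close> is prime.\<close>
  have regular: "p \<in> P" if ap: "a * p \<in> P" for p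
  proof -
    obtain k where k: "a * p - k * l \<in> Q" using ap P_iff by auto
    have "k * l - a * p \<in> Q" using idl.span_neg[OF k[unfolded Q_def]] unfolding Q_def minus_diff_eq .
    moreover have "k * l - a * p = b * k - a * (p - k * Var x)"
      by (simp only: l_def algebra_simps)
    ultimately have "b * k - a * (p - k * Var x) \<in> Q" by (simp only:)
    then have "b * k \<in> idl.span (insert a G)"
      unfolding Q_def idl.span_breakdown_eq by (intro exI[of _ "p - k * Var x"])
        (simp only: mult.commute[of a])
    then have "k \<in> idl.span (insert a G)" by (rule reg)
    then obtain c where c: "k - c * a \<in> Q"
      unfolding Q_def idl.span_breakdown_eq by blast
    have "a * (p - c * l) = (a * p - k * l) + l * (k - c * a)"
      by (simp add: algebra_simps)
    then have "a * (p - c * l) \<in> Q"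
      using k c unfolding Q_def by (simp add: idl.span_add idl.span_scale)
    from is_primeD[OF prime this[unfolded Q_def]] have "p - c * l \<in> Q" using a unfolding Q_def by blast
    then show ?thesis using P_iff by auto
  qed
  have regular_power: "a ^ n * p \<in> P \<Longrightarrow> p \<in> P" for n p
  proof (induction n)
    case (Suc n)
    then have "a * (a ^ n * p) \<in> P" by (simp only: power_Suc mult.assoc)
    then have "a ^ n * p \<in> P" by (rule regular)
    then show ?case by (rule Suc.IH)
  qed simp
  \<comment> \<open>Since \<open>a x\<close> is congruent to \<open>- b\<close> modulo
    \<open>l\<close>, a power of \<open>a\<close> clears the variable \<open>x\<close>. With
    \<open>regular\<close> and \<open>contract\<close> primality is thereby reduced to that of
    \<open>Q\<close>.\<close>
  have reduce: "\<exists>n r. a ^ n * p - r \<in> P \<and> x \<notin> vars r" for p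
  proof (induction p rule: mpoly_induct)
    case (Const c)
    then show ?case by (intro exI[of _ 0] exI[of _ "Const c"]) (simp add: P_def idl.span_zero)
  next
    case (Var v)
    show ?case
    proof (cases "v = x")
      case True
      have "a ^ 1 * Var v - (- b) = l" using True by (simp add: l_def)
      then show ?thesis using free by (intro exI[of _ 1] exI[of _ "- b"])
          (simp add: P_def idl.span_base)
    next
      case False
      then show ?thesis by (intro exI[of _ 0] exI[of _ "Var v"]) (simp add: P_def idl.span_zero)
    qed
  next
    case (add p q)
    then obtain n r m s where h: "a ^ n * p - r \<in> P" "x \<notin> vars r" "a ^ m * q - s \<in> P" "x \<notin> vars s"
      by auto
    have "a ^ (n + m) * (p + q) - (a ^ m * r + a ^ n * s)
        = a ^ m * (a ^ n * p - r) + a ^ n * (a ^ m * q - s)"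
      by (simp add: algebra_simps power_add)
    moreover have "x \<notin> vars (a ^ k)" for k
    proof (induction k)
      case (Suc k)
      then show ?case using free vars_mult[of a "a ^ k"] by auto
    qed simp
    moreover have "x \<notin> vars (a ^ m * r + a ^ n * s)" if "\<And>k. x \<notin> vars (a ^ k)"
      using h that vars_add[of "a ^ m * r" "a ^ n * s"] vars_mult[of "a ^ m" r] vars_mult[of "a ^ n" s]
      by blast
    ultimately show ?case using h
      by (intro exI[of _ "n + m"] exI[of _ "a ^ m * r + a ^ n * s"])
        (simp add: P_def idl.span_add idl.span_scale)
  next
    case (mult p q)
    then obtain n r m s where h: "a ^ n * p - r \<in> P" "x \<notin> vars r" "a ^ m * q - s \<in> P" "x \<notin> vars s"
      by auto
    have "a ^ (n + m) * (p * q) - r * s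
        = (a ^ m * q) * (a ^ n * p - r) + r * (a ^ m * q - s)"
      by (simp add: algebra_simps power_add)
    moreover have "x \<notin> vars (r * s)" using h vars_mult[of r s] by blast
    ultimately show ?case using h
      by (intro exI[of _ "n + m"] exI[of _ "r * s"])
        (simp add: P_def idl.span_add idl.span_scale)
  qed
  show ?thesis
    unfolding is_prime_def l_def[symmetric] P_def[symmetric]
  proof (intro conjI allI impI)
    show "idl.subspace P" by (simp add: P_def)
    show "1 \<notin> P" using contract[of 1] prime unfolding is_prime_def Q_def by auto
    fix p q assume pq: "p * q \<in> P"
    obtain n r m s where h: "a ^ n * p - r \<in> P" "x \<notin> vars r" "a ^ m * q - s \<in> P" "x \<notin> vars s"
      using reduce by metis
    have "a ^ (n + m) * (p * q) - r * s
        = (a ^ m * q) * (a ^ n * p - r) + r * (a ^ m * q - s)"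
      by (simp add: algebra_simps power_add)
    then have "a ^ (n + m) * (p * q) - r * s \<in> P"
      using h by (simp add: P_def idl.span_add idl.span_scale)
    then have "r * s \<in> P"
      using idl.span_scale[OF pq[unfolded P_def], of "a ^ (n + m)"]
        idl_span_diff_cong[of "a ^ (n + m) * (p * q)" "r * s"] unfolding P_def by blast
    moreover have "x \<notin> vars (r * s)" using h vars_mult by blast
    ultimately have "r * s \<in> Q" by (rule contract)
    then have "r \<in> Q \<or> s \<in> Q" using is_primeD[OF prime, of r s] unfolding Q_def by blast
    then have "a ^ n * p \<in> P \<or> a ^ m * q \<in> P"
      using h QP idl_span_diff_cong[of _ r] idl_span_diff_cong[of _ s] unfolding P_def by blast
    then show "p \<in> P \<or> q \<in> P" using regular_power by blast
  qed
qed

section \<open>Spinor coordinates\<close>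

text \<open>Inverse to the numbering of the entries: variable \<open>v\<close> is entry
  \<open>v mod 4\<close> of particle \<open>v div 4 + 1\<close>. Substitutions and evaluation points
  can thus be given by four functions of the particle.\<close>

definition blk :: "(nat \<Rightarrow> 'a) \<Rightarrow> (nat \<Rightarrow> 'a) \<Rightarrow> (nat \<Rightarrow> 'a) \<Rightarrow> (nat \<Rightarrow> 'a) \<Rightarrow> nat \<Rightarrow> 'a" where
  "blk A B C D v = (let i = v div 4 + 1 in
     if v mod 4 = 0 then A i else if v mod 4 = 1 then B i else if v mod 4 = 2 then C i else D i)"

lemma blk_index:
  assumes "i \<ge> 1"
  shows "blk A B C D (4 * (i - 1)) = A i" "blk A B C D (4 * (i - 1) + 1) = B i"
    "blk A B C D (4 * (i - 1) + 2) = C i" "blk A B C D (4 * (i - 1) + 3) = D i"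
proof -
  obtain j where i: "i = Suc j" using assms by (cases i) auto
  have "(4 * j + 1) div 4 = j" "(4 * j + 2) div 4 = j" "(4 * j + 3) div 4 = j"
    "(4 * j + 1) mod 4 = 1" "(4 * j + 2) mod 4 = 2" "(4 * j + 3) mod 4 = 3"
    by presburger+
  then show "blk A B C D (4 * (i - 1)) = A i" "blk A B C D (4 * (i - 1) + 1) = B i"
    "blk A B C D (4 * (i - 1) + 2) = C i" "blk A B C D (4 * (i - 1) + 3) = D i"
    unfolding i diff_Suc_1 blk_def Let_def by (simp_all only:) simp_all
qed

lemma subst_blk:
  assumes "i \<ge> 1"
  shows "subst (blk A B C D) (va i) = A i" "subst (blk A B C D) (vb i) = B i"
    "subst (blk A B C D) (vc i) = C i" "subst (blk A B C D) (vd i) = D i"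
  unfolding va_def vb_def vc_def vd_def using assms by (simp_all only: subst_Var blk_index)

lemma ev_blk:
  assumes "i \<ge> 1"
  shows "ev (blk A B C D) (va i) = A i" "ev (blk A B C D) (vb i) = B i"
    "ev (blk A B C D) (vc i) = C i" "ev (blk A B C D) (vd i) = D i"
  unfolding va_def vb_def vc_def vd_def using assms by (simp_all only: ev_Var blk_index)

lemma Var_blk: "Var v = blk va vb vc vd v"
proof -
  have "v mod 4 = 0 \<or> v mod 4 = 1 \<or> v mod 4 = 2 \<or> v mod 4 = 3" by presburger
  moreover have "Var (4 * (v div 4 + 1 - 1) + r) = Var v" if "v mod 4 = r" for r
    using that by (intro arg_cong[of _ _ Var]) presburger
  from this[of 0] this[of 1] this[of 2] this[of 3]
  have "v mod 4 = 0 \<Longrightarrow> va (v div 4 + 1) = Var v" "v mod 4 = 1 \<Longrightarrow> vb (v div 4 + 1) = Var v"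
    "v mod 4 = 2 \<Longrightarrow> vc (v div 4 + 1) = Var v" "v mod 4 = 3 \<Longrightarrow> vd (v div 4 + 1) = Var v"
    unfolding va_def vb_def vc_def vd_def by simp_all
  ultimately show ?thesis
    unfolding blk_def Let_def by auto
qed

lemma blk_cases:
  assumes "\<And>i. i \<ge> 1 \<Longrightarrow> P (va i) (A i)" "\<And>i. i \<ge> 1 \<Longrightarrow> P (vb i) (B i)"
    "\<And>i. i \<ge> 1 \<Longrightarrow> P (vc i) (C i)" "\<And>i. i \<ge> 1 \<Longrightarrow> P (vd i) (D i)"
  shows "P (Var v) (blk A B C D v)"
  using assms by (simp add: Var_blk blk_def Let_def)

lemma vars_entries [simp]:
  "vars (va i) = {4 * (i - 1)}" "vars (vb i) = {4 * (i - 1) + 1}"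
  "vars (vc i) = {4 * (i - 1) + 2}" "vars (vd i) = {4 * (i - 1) + 3}"
  by (simp_all add: va_def vb_def vc_def vd_def)

definition spinor :: "mpoly \<Rightarrow> mpoly" where
  "spinor = subst (blk (\<lambda>i. va i * vc i) (\<lambda>i. va i * vd i) (\<lambda>i. vb i * vc i) (\<lambda>i. vb i * vd i))"

text \<open>The variables serve a second time as spinor coordinates: \<open>\<lambda>\<^sub>i = (va i, vb i)\<close>,
  \<open>\<mu>\<^sub>i = (vc i, vd i)\<close> and \<open>spinor\<close> is \<open>k\<^sub>i \<mapsto> \<lambda>\<^sub>i \<mu>\<^sub>i\<^sup>T\<close>.\<close>

interpretation spinor: rhom spinor
  unfolding spinor_def by unfold_locales (simp_all add: subst.hom_simps)

lemma spinor_entries: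
  assumes "i \<ge> 1"
  shows "spinor (va i) = va i * vc i" "spinor (vb i) = va i * vd i"
    "spinor (vc i) = vb i * vc i" "spinor (vd i) = vb i * vd i"
  using assms by (simp_all add: spinor_def subst_blk)

definition spinor_QJ :: "nat set \<Rightarrow> mpoly" where
  "spinor_QJ L = (\<Sum>i\<in>L. va i * vc i) * (\<Sum>i\<in>L. vb i * vd i)
     - (\<Sum>i\<in>L. va i * vd i) * (\<Sum>i\<in>L. vb i * vc i)"

lemma spinor_of_QJ: "(\<And>i. i \<in> L \<Longrightarrow> i \<ge> 1) \<Longrightarrow> spinor (QJ L) = spinor_QJ L"
  by (simp add: QJ_def spinor_QJ_def spinor.hom_simps spinor_entries cong: sum.cong)

section \<open>Particles occurring in a polynomial, and test points\<close>

definition blocks :: "mpoly \<Rightarrow> nat set" where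
  "blocks p = (\<lambda>v. v div 4 + 1) ` vars p"

lemma notin_vars:
  "x \<notin> vars p \<Longrightarrow> x \<notin> vars q \<Longrightarrow> x \<notin> vars (p + q)"
  "x \<notin> vars p \<Longrightarrow> x \<notin> vars q \<Longrightarrow> x \<notin> vars (p - q)"
  "x \<notin> vars p \<Longrightarrow> x \<notin> vars q \<Longrightarrow> x \<notin> vars (p * q)"
  "x \<notin> vars p \<Longrightarrow> x \<notin> vars (- p)"
  "(\<And>i. i \<in> L \<Longrightarrow> x \<notin> vars (f i)) \<Longrightarrow> x \<notin> vars (sum f L)"
  using vars_add[of p q] vars_diff[of p q] vars_mult[of p q] vars_sum[of f L] by auto

lemma notin_vars_entries:
  assumes "x div 4 \<noteq> i - 1"
  shows "x \<notin> vars (va i)" "x \<notin> vars (vb i)" "x \<notin> vars (vc i)" "x \<notin> vars (vd i)"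
  using assms by auto

lemma notin_vars_blocks:
  assumes "p \<notin> blocks g" "p \<ge> 1"
  shows "4 * (p - 1) \<notin> vars g" "4 * (p - 1) + 1 \<notin> vars g" "4 * (p - 1) + 2 \<notin> vars g"
    "4 * (p - 1) + 3 \<notin> vars g"
proof -
  have *: "v \<notin> vars g" if "v div 4 = p - 1" for v
    using assms that by (auto simp: blocks_def image_iff)
  show "4 * (p - 1) \<notin> vars g" "4 * (p - 1) + 1 \<notin> vars g" "4 * (p - 1) + 2 \<notin> vars g"
    "4 * (p - 1) + 3 \<notin> vars g"
    by (rule *, presburger)+
qed

lemma ev_notin_span: "ev z b \<noteq> 0 \<Longrightarrow> (\<And>g. g \<in> G \<Longrightarrow> ev z g = 0) \<Longrightarrow> b \<notin> idl.span G"
  using ev.span_vanish by blast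

lemma ev_blk_cong:
  assumes "\<And>i. i \<in> blocks g \<Longrightarrow> A i = A' i \<and> B i = B' i \<and> C i = C' i \<and> D i = D' i"
  shows "ev (blk A B C D) g = ev (blk A' B' C' D') g"
proof (rule ev_cong)
  fix v assume "v \<in> vars g"
  then have "v div 4 + 1 \<in> blocks g" by (auto simp: blocks_def)
  then show "blk A B C D v = blk A' B' C' D' v" using assms by (auto simp: blk_def Let_def)
qed

text \<open>The linear polynomial with coefficient 1 and constant term 0; the regularity condition
  then lives in the unit ideal.\<close>

lemma variable_prime:
  assumes "is_prime (idl.span G)" "\<And>g. g \<in> G \<Longrightarrow> x \<notin> vars g"
  shows "is_prime (idl.span (insert (Var x) G))"
proof -
  have "is_prime (idl.span (insert (1 * Var x + 0) G))"
  proof (rule linear_prime)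
    fix v :: mpoly
    show "v \<in> idl.span (insert 1 G)"
      using idl.span_scale[OF idl.span_base[of 1 "insert 1 G"], of v] by simp
  qed (use assms in \<open>auto simp: is_prime_def\<close>)
  then show ?thesis by simp
qed

text \<open>An element outside a prime ideal is a nonzerodivisor modulo it, which is the regularity
  that \<open>linear_prime\<close> asks for.\<close>

lemma linear_prime_of_prime:
  assumes "is_prime (idl.span G)"
    and "\<And>g. g \<in> G \<Longrightarrow> x \<notin> vars g" "x \<notin> vars a" "x \<notin> vars b"
    and "a \<notin> idl.span G" "is_prime (idl.span (insert a G))" "b \<notin> idl.span (insert a G)"
  shows "is_prime (idl.span (insert (a * Var x + b) G))"
  using assms(1-5)
proof (rule linear_prime)
  fix v assume "b * v \<in> idl.span (insert a G)"
  from is_primeD[OF assms(6) this] show "v \<in> idl.span (insert a G)" using assms(7) by blast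
qed

text \<open>\<open>spinor_QJ\<close> is linear in \<open>va p\<close>, its leading coefficient is linear in \<open>vb q\<close>, and that leading
  coefficient is the bracket \<open>[p q]\<close>; the preceding lemma is applied along this chain.\<close>
lemma spinor_QJ_prime:
  assumes prime: "is_prime (idl.span G)"
    and pq: "p \<ge> 1" "q \<ge> 1" "p \<noteq> q" "finite L" "p \<notin> L" "q \<notin> L" "\<And>i. i \<in> L \<Longrightarrow> i \<ge> 1" "s \<in> L"
    and free: "\<And>g. g \<in> G \<Longrightarrow> p \<notin> blocks g \<and> q \<notin> blocks g"
    and van: "\<And>g. g \<in> G \<Longrightarrow> ev (blk (\<lambda>i. 0) (\<lambda>i. if i = s then 1 else 0)
      (\<lambda>i. if i = s then 1 else 0) (\<lambda>i. 0)) g = 0"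
  shows "is_prime (idl.span (insert (spinor_QJ (insert p (insert q L))) G))"
proof -
  have neq: "p - 1 \<noteq> q - 1" "q - 1 \<noteq> p - 1" "\<And>i. i \<in> L \<Longrightarrow> p - 1 \<noteq> i - 1" "\<And>i. i \<in> L \<Longrightarrow> q - 1 \<noteq> i - 1"
    "\<And>i. i \<in> L \<Longrightarrow> i \<noteq> p" "\<And>i. i \<in> L \<Longrightarrow> i \<noteq> q" "s \<noteq> p" "s \<noteq> q" "s \<ge> 1"
    using pq by (auto simp: eq_diff_iff)
  \<comment> \<open>Test points with free spinors for \<open>p\<close> and \<open>q\<close>. Among
    the particles of \<open>L\<close> only \<open>s\<close> is nonzero, with \<lambda> = (0, 1) and
    \<mu> = (1, 0), so that of the four sums \<open>A, B, C, D\<close> below only \<open>C\<close>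
    is nonzero. Elements of \<open>G\<close> do not involve \<open>p\<close> or \<open>q\<close>,
    hence vanish at all these points.\<close>
  define z where "z = (\<lambda>(A, B, C, D) (A', B', C', D').
    blk (\<lambda>i. if i = p then A else if i = q then A' else 0)
        (\<lambda>i. if i = p then B else if i = q then B' else if i = s then 1 else 0)
        (\<lambda>i. if i = p then C else if i = q then C' else if i = s then 1 else 0)
        (\<lambda>i. if i = p then D else if i = q then D' else (0::complex)))"
  have zG: "ev (z P Q) g = 0" if "g \<in> G" for P Q g
  proof -
    have "ev (z P Q) g = ev (blk (\<lambda>i. 0) (\<lambda>i. if i = s then 1 else 0)
      (\<lambda>i. if i = s then 1 else 0) (\<lambda>i. 0)) g"
      unfolding z_def split_def using free[OF that] by (intro ev_blk_cong) auto
    then show ?thesis using van that by simp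
  qed
  have zp: "ev (z (A, B, C, D) (A', B', C', D')) (va p) = A" "ev (z (A, B, C, D) (A', B', C', D')) (vb p) = B"
    "ev (z (A, B, C, D) (A', B', C', D')) (vc p) = C" "ev (z (A, B, C, D) (A', B', C', D')) (vd p) = D"
    "ev (z (A, B, C, D) (A', B', C', D')) (va q) = A'" "ev (z (A, B, C, D) (A', B', C', D')) (vb q) = B'"
    "ev (z (A, B, C, D) (A', B', C', D')) (vc q) = C'" "ev (z (A, B, C, D) (A', B', C', D')) (vd q) = D'"
    for A B C D A' B' C' D'
    using pq(1-3) by (simp_all add: z_def ev_blk)
  have zi: "ev (z P Q) (va i) = 0" "ev (z P Q) (vb i) = (if i = s then 1 else 0)"
    "ev (z P Q) (vc i) = (if i = s then 1 else 0)" "ev (z P Q) (vd i) = 0" if "i \<in> L" for i P Q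
    using that neq(5)[OF that] neq(6)[OF that] pq(7)[OF that] by (simp_all add: z_def ev_blk split_def)
  define A where "A = (\<Sum>i\<in>L. va i * vc i)"
  define B where "B = (\<Sum>i\<in>L. va i * vd i)"
  define C where "C = (\<Sum>i\<in>L. vb i * vc i)"
  define D where "D = (\<Sum>i\<in>L. vb i * vd i)"
  have zs: "ev (z P Q) A = 0" "ev (z P Q) B = 0" "ev (z P Q) C = 1" "ev (z P Q) D = 0" for P Q
  proof -
    have "ev (z P Q) C = (\<Sum>i\<in>L. if i = s then 1 else 0)"
      unfolding C_def ev.hom_sum by (intro sum.cong refl) (simp add: ev.hom_mult zi)
    then show "ev (z P Q) A = 0" "ev (z P Q) B = 0" "ev (z P Q) C = 1" "ev (z P Q) D = 0"
      using pq(4,8) by (simp_all add: A_def B_def D_def ev.hom_simps zi cong: sum.cong)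
  qed
  have nL: "x \<notin> vars A" "x \<notin> vars B" "x \<notin> vars C" "x \<notin> vars D"
    if "x \<in> {4 * (r - 1), 4 * (r - 1) + 1, 4 * (r - 1) + 2, 4 * (r - 1) + 3}" "r \<in> {p, q}" for x r
  proof -
    have "x div 4 = r - 1" using that(1) by auto
    then have "x \<notin> vars (va i)" "x \<notin> vars (vb i)" "x \<notin> vars (vc i)" "x \<notin> vars (vd i)" if "i \<in> L" for i
      using that neq(3,4) \<open>r \<in> {p, q}\<close> by (intro notin_vars_entries; auto)+
    then show "x \<notin> vars A" "x \<notin> vars B" "x \<notin> vars C" "x \<notin> vars D"
      unfolding A_def B_def C_def D_def by (intro notin_vars; blast)+
  qed
  \<comment> \<open>\<open>a3\<close> is the coefficient of \<open>va p\<close> in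
    \<open>spinor_QJ\<close>; the terms with \<open>vb p\<close> cancel in it. \<open>a2\<close> is
    the coefficient of \<open>vb q\<close> in \<open>a3\<close>, and \<open>vc p\<close> that of
    \<open>vd q\<close> in \<open>a2\<close>. \<open>b4\<close> is the part without
    \<open>va p\<close>.\<close>
  define a2 where "a2 = vc p * vd q + (- (vd p * vc q))"
  define a3 where "a3 = a2 * vb q + (vc p * D - vd p * C)"
  define b4 where "b4 = (A + va q * vc q) * (D + vb q * vd q) - (B + va q * vd q) * (C + vb q * vc q)
    + vb p * (vd p * (A + va q * vc q) - vc p * (B + va q * vd q))"
  have P1: "is_prime (idl.span (insert (vc p) G))"
    unfolding vc_def using prime free pq notin_vars_blocks by (intro variable_prime) auto
  have P2: "is_prime (idl.span (insert a2 G))"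
    unfolding a2_def vd_def[of q]
  proof (rule linear_prime_of_prime[OF prime _ _ _ _ P1])
    show "vc p \<notin> idl.span G"
      by (rule ev_notin_span[where z = "z (0,0,1,0) (0,0,0,0)"]) (simp_all add: zp zG)
    show "- (vd p * vc q) \<notin> idl.span (insert (vc p) G)"
      by (rule ev_notin_span[where z = "z (0,0,0,1) (0,0,1,0)"]) (auto simp add: zp zG ev.hom_simps)
    show "4 * (q - 1) + 3 \<notin> vars (vc p)" "4 * (q - 1) + 3 \<notin> vars (- (vd p * vc q))"
      by ((intro notin_vars)?; ((rule nL[of _ q], simp, simp) | (insert neq(1), unfold vars_entries
        singleton_iff, presburger)))+
  qed (use free notin_vars_blocks pq in blast)
  have P3: "is_prime (idl.span (insert a3 G))"
    unfolding a3_def vb_def[of q]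
  proof (rule linear_prime_of_prime[OF prime _ _ _ _ P2])
    show "a2 \<notin> idl.span G"
      by (rule ev_notin_span[where z = "z (0,0,1,0) (0,0,0,1)"]) (simp_all add: a2_def zp zG ev.hom_simps)
    show "vc p * D - vd p * C \<notin> idl.span (insert a2 G)"
      by (rule ev_notin_span[where z = "z (0,0,0,1) (0,0,0,0)"])
        (auto simp add: a2_def zp zs zG ev.hom_simps)
    show "4 * (q - 1) + 1 \<notin> vars a2" "4 * (q - 1) + 1 \<notin> vars (vc p * D - vd p * C)"
      unfolding a2_def
      by ((intro notin_vars)?; ((rule nL[of _ q], simp, simp) | (insert neq(1), unfold vars_entries
        singleton_iff, presburger)))+
  qed (use free notin_vars_blocks pq in blast)
  have P4: "is_prime (idl.span (insert (a3 * Var (4 * (p - 1)) + b4) G))"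
  proof (rule linear_prime_of_prime[OF prime _ _ _ _ P3])
    show "a3 \<notin> idl.span G"
      by (rule ev_notin_span[where z = "z (0,0,0,1) (0,0,0,0)"])
        (simp_all add: a2_def a3_def zp zs zG ev.hom_simps)
    show "b4 \<notin> idl.span (insert a3 G)"
      by (rule ev_notin_span[where z = "z (0,0,0,0) (1,0,0,1)"])
        (auto simp add: a2_def a3_def b4_def zp zs zG ev.hom_simps)
    show "4 * (p - 1) \<notin> vars a3" "4 * (p - 1) \<notin> vars b4"
      unfolding a2_def a3_def b4_def
      by ((intro notin_vars)?; ((rule nL[of _ p], simp, simp) | (insert neq(1), unfold vars_entries
        singleton_iff, presburger)))+
  qed (use free notin_vars_blocks pq in blast)
  have "spinor_QJ (insert p (insert q L)) = a3 * va p + b4"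
    unfolding spinor_QJ_def a3_def a2_def b4_def using pq(3-6)
    by (simp add: A_def[symmetric] B_def[symmetric] C_def[symmetric] D_def[symmetric])
       (simp add: algebra_simps)
  then show ?thesis using P4 by (simp add: va_def)
qed

text \<open>The bracket is linear in \<open>vb j\<close>, and its coefficient \<open>va i\<close> is
  a variable that does not divide the other term.\<close>

lemma bracket_prime:
  assumes "i \<ge> 1" "j \<ge> 1" "i \<noteq> j"
  shows "is_prime (idl.span {va i * vb j - vb i * va j})"
proof -
  have neq: "i - 1 \<noteq> j - 1" using assms by simp
  have 0: "is_prime (idl.span ({} :: mpoly set))"
    by (simp add: is_prime_zero)
  have 1: "is_prime (idl.span {va i})"
    unfolding va_def using 0 by (intro variable_prime) auto
  have "is_prime (idl.span {va i * Var (4 * (j - 1) + 1) + (- (vb i * va j))})"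
  proof (rule linear_prime_of_prime[OF 0 _ _ _ _ 1])
    show "va i \<notin> idl.span {}"
      by (rule ev_notin_span[where z = "blk (\<lambda>k. 1) (\<lambda>k. 0) (\<lambda>k. 0) (\<lambda>k. 0)"])
        (use assms in \<open>auto simp: ev_blk\<close>)
    show "- (vb i * va j) \<notin> idl.span {va i}"
      by (rule ev_notin_span[where z = "blk (\<lambda>k. if k = j then 1 else 0) (\<lambda>k. 1) (\<lambda>k. 0) (\<lambda>k. 0)"])
        (use assms in \<open>auto simp: ev_blk ev.hom_simps\<close>)
    show "4 * (j - 1) + 1 \<notin> vars (va i)"
      unfolding vars_entries singleton_iff by presburger
    show "4 * (j - 1) + 1 \<notin> vars (- (vb i * va j))"
      unfolding singleton_iff using neq by (intro notin_vars; unfold vars_entries singleton_iff; presburger)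
  qed auto
  then show ?thesis by (simp add: vb_def)
qed

section \<open>Toric ideals of bipartite graphs\<close>

lemma exponent_split:
  fixes m :: "nat \<Rightarrow>\<^sub>0 nat"
  assumes "v \<in> Poly_Mapping.keys m"
  obtains n where "m = Poly_Mapping.single v 1 + n"
proof
  show "m = Poly_Mapping.single v 1 + (m - Poly_Mapping.single v 1)"
    using assms by (intro poly_mapping_eqI)
      (auto simp: lookup_add lookup_minus lookup_single when_def in_keys_iff)
qed

definition esize :: "(nat \<Rightarrow>\<^sub>0 nat) \<Rightarrow> nat" where
  "esize m = (\<Sum>v\<in>Poly_Mapping.keys m. Poly_Mapping.lookup m v)"

lemma esize_superset: "finite A \<Longrightarrow> Poly_Mapping.keys m \<subseteq> A \<Longrightarrow> esize m = (\<Sum>v\<in>A. Poly_Mapping.lookup m v)"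
  unfolding esize_def by (intro sum.mono_neutral_left) (auto simp: in_keys_iff)

lemma esize_add: "esize (m + n) = esize m + esize n"
  using keys_add[of m n]
  by (simp add: esize_superset[of "Poly_Mapping.keys m \<union> Poly_Mapping.keys n"] lookup_add sum.distrib)

lemma esize_single: "esize (Poly_Mapping.single v 1) = 1"
  by (simp add: esize_def)

text \<open>A monomial is a multiset of edges; its image under the toric map records the degree of
  every vertex.\<close>

definition edge_exp :: "(nat \<Rightarrow> nat) \<Rightarrow> (nat \<Rightarrow> nat) \<Rightarrow> (nat \<Rightarrow>\<^sub>0 nat) \<Rightarrow> (nat \<Rightarrow>\<^sub>0 nat)" where
  "edge_exp r c m = (\<Sum>v\<in>Poly_Mapping.keys m.
     Poly_Mapping.single (r v) (Poly_Mapping.lookup m v) + Poly_Mapping.single (c v) (Poly_Mapping.lookup m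
       v))"

lemma edge_exp_superset:
  "finite A \<Longrightarrow> Poly_Mapping.keys m \<subseteq> A \<Longrightarrow> edge_exp r c m = (\<Sum>v\<in>A.
     Poly_Mapping.single (r v) (Poly_Mapping.lookup m v) + Poly_Mapping.single (c v) (Poly_Mapping.lookup m
       v))"
  unfolding edge_exp_def by (intro sum.mono_neutral_left) (auto simp: in_keys_iff)

lemma edge_exp_add: "edge_exp r c (m + n) = edge_exp r c m + edge_exp r c n"
  using keys_add[of m n]
  by (simp add: edge_exp_superset[of "Poly_Mapping.keys m \<union> Poly_Mapping.keys n"]
      lookup_add sum.distrib single_add ac_simps)

lemma edge_exp_single:
  "edge_exp r c (Poly_Mapping.single v 1) = Poly_Mapping.single (r v) 1 + Poly_Mapping.single (c v) 1"
  by (simp add: edge_exp_def)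

lemma edge_exp_0: "edge_exp r c 0 = 0"
  by (simp add: edge_exp_def)

lemma subst_edge_mon: "subst (\<lambda>v. Var (r v) * Var (c v)) (mon m) = mon (edge_exp r c m)"
proof (induction m rule: exponent_induct)
  case zero
  then show ?case by (simp only: mon_0 edge_exp_0 subst.hom_one)
next
  case (add v m)
  have "subst (\<lambda>v. Var (r v) * Var (c v)) (mon (Poly_Mapping.single v 1))
      = mon (Poly_Mapping.single (r v) 1) * mon (Poly_Mapping.single (c v) 1)"
    by (simp only: Var_mon[symmetric] subst_Var)
  then show ?case
    by (simp only: mon_add subst.hom_mult add.IH edge_exp_add edge_exp_single)
qed

lemma lookup_edge_exp_ge:
  assumes "v \<in> Poly_Mapping.keys m"
  shows "r v \<in> Poly_Mapping.keys (edge_exp r c m)" "c v \<in> Poly_Mapping.keys (edge_exp r c m)"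
proof -
  obtain n where "m = Poly_Mapping.single v 1 + n" using exponent_split assms by blast
  then show "r v \<in> Poly_Mapping.keys (edge_exp r c m)" "c v \<in> Poly_Mapping.keys (edge_exp r c m)"
    by (simp_all add: edge_exp_add edge_exp_single[simplified] in_keys_iff lookup_add)
qed

lemma keys_edge_exp:
  assumes "x \<in> Poly_Mapping.keys (edge_exp r c m)"
  shows "\<exists>v\<in>Poly_Mapping.keys m. x = r v \<or> x = c v"
proof (rule ccontr)
  assume "\<not> ?thesis"
  then have "Poly_Mapping.lookup (edge_exp r c m) x = 0"
    by (auto simp: edge_exp_def lookup_sum lookup_add lookup_single when_def)
  then show False using assms by (simp add: in_keys_iff)
qed

text \<open>A variable \<open>v\<close> is an edge joining row \<open>r v\<close> and column \<open>c v\<close>.  The rank condition says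
  that edges at a row of least rank can be moved to the other end of any incident column.\<close>
locale toric =
  fixes r c :: "nat \<Rightarrow> nat" and G :: "mpoly set" and rk :: "nat \<Rightarrow> nat"
  assumes disj: "r v \<noteq> c w"
    and inj: "r v = r w \<Longrightarrow> c v = c w \<Longrightarrow> v = w"
    and swap: "r v' = r v \<Longrightarrow> c v' = c u \<Longrightarrow> r w = r u \<Longrightarrow> c w = c v \<Longrightarrow>
      Var v * Var u - Var v' * Var w \<in> idl.span G"
    and rank: "rk (r v) \<le> rk (r u) \<Longrightarrow> r v' = r v \<Longrightarrow> c v' = c u \<Longrightarrow> \<exists>w. r w = r u \<and> c w = c v"
begin

abbreviation E :: "(nat \<Rightarrow>\<^sub>0 nat) \<Rightarrow> (nat \<Rightarrow>\<^sub>0 nat)" where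
  "E \<equiv> edge_exp r c"

abbreviation psi :: "mpoly \<Rightarrow> mpoly" where
  "psi \<equiv> subst (\<lambda>v. Var (r v) * Var (c v))"

text \<open>Induction on the degree. Let \<open>v\<close> in \<open>m\<close> and \<open>v'\<close>
  in \<open>m'\<close> be edges at the same row; equal vertex degrees give an edge \<open>u\<close>
  of \<open>m\<close> at the column of \<open>v'\<close>. Trading \<open>v, u\<close> for
  \<open>v', w\<close> costs one binomial of \<open>swap\<close>, and afterwards \<open>v'\<close>
  is a common factor.\<close>

lemma mon_diff_in_span: "E m = E m' \<Longrightarrow> mon m - mon m' \<in> idl.span G"
proof (induction "esize m" arbitrary: m m' rule: less_induct)
  case less
  show ?case
  proof (cases "m = 0")
    case True
    have "m' = 0"
    proof (rule ccontr)
      assume "m' \<noteq> 0"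
      then obtain v where "v \<in> Poly_Mapping.keys m'"
        by (metis in_keys_iff lookup_zero poly_mapping_eqI)
      then show False using lookup_edge_exp_ge(1)[of v m' r c] less.prems True by (simp add: edge_exp_0)
    qed
    then show ?thesis using True by (simp add: idl.span_zero)
  next
    case False
    then obtain v0 where "v0 \<in> Poly_Mapping.keys m"
      by (metis in_keys_iff lookup_zero poly_mapping_eqI)
    \<comment> \<open>The least rank is what entitles \<open>rank\<close> to supply the fourth
      corner \<open>w\<close>.\<close>
    then obtain v where v: "v \<in> Poly_Mapping.keys m"
      and least: "\<And>u. u \<in> Poly_Mapping.keys m \<Longrightarrow> rk (r v) \<le> rk (r u)"
      using ex_has_least_nat[of "\<lambda>v. v \<in> Poly_Mapping.keys m" v0 "\<lambda>v. rk (r v)"] by auto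
    obtain v' where v': "v' \<in> Poly_Mapping.keys m'" "r v' = r v"
      using keys_edge_exp[of "r v" r c m'] lookup_edge_exp_ge(1)[OF v, of r c] less.prems disj by metis
    obtain n' where n': "m' = Poly_Mapping.single v' 1 + n'" using exponent_split v'(1) by blast
    \<comment> \<open>Cancels the edge \<open>v'\<close> shared with \<open>m'\<close> and applies
      the induction hypothesis to the cofactors.\<close>
    have common: "mon m1 - mon m' \<in> idl.span G"
      if m1: "m1 = Poly_Mapping.single v' 1 + n" "E m1 = E m'" "esize n < esize m" for m1 n
    proof -
      have "E n = E n'" using m1 n' by (simp add: edge_exp_add)
      then have "Var v' * (mon n - mon n') \<in> idl.span G"
        using less.hyps[OF m1(3)] by (intro idl.span_scale)
      then show ?thesis by (simp add: m1(1) n' mon_add Var_mon right_diff_distrib)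
    qed
    obtain u where u: "u \<in> Poly_Mapping.keys m" "c u = c v'"
      using keys_edge_exp[of "c v'" r c m] lookup_edge_exp_ge(2)[OF v'(1), of c r] less.prems disj by metis
    obtain n where n: "m = Poly_Mapping.single v 1 + n" using exponent_split v by blast
    show ?thesis
    proof (cases "u = v")
      case True
      then have "v = v'" using inj u v' by metis
      moreover have "esize n < esize m" by (simp only: n esize_add esize_single)
      ultimately show ?thesis using common[of m n] n less.prems by simp
    next
      case False
      then have "u \<in> Poly_Mapping.keys n" using u(1) n
        by (auto simp: in_keys_iff lookup_add lookup_single when_def)
      then obtain k where k: "n = Poly_Mapping.single u 1 + k" using exponent_split by blast
      obtain w where w: "r w = r u" "c w = c v"
        using rank[OF least[OF u(1)] v'(2) u(2)[symmetric]] by blast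
      define m1 where "m1 = Poly_Mapping.single v' 1 + (Poly_Mapping.single w 1 + k)"
      have "E m1 = E m"
        by (simp only: m1_def n k edge_exp_add edge_exp_single w v'(2) u(2) ac_simps)
      moreover have "esize (Poly_Mapping.single w 1 + k) < esize m"
        by (simp only: n k esize_add esize_single)
      ultimately have "mon m1 - mon m' \<in> idl.span G" using common[OF m1_def] less.prems by simp
      moreover have "mon m - mon m1 \<in> idl.span G"
      proof -
        have "mon k * (Var v * Var u - Var v' * Var w) \<in> idl.span G"
          by (intro idl.span_scale swap) (use v' u w in auto)
        moreover have "mon k * (Var v * Var u - Var v' * Var w) = mon m - mon m1"
          by (simp only: m1_def n k mon_add Var_mon right_diff_distrib ac_simps)
        ultimately show ?thesis by simp
      qed
      ultimately show ?thesis using idl_span_diff_trans by blast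
    qed
  qed
qed

text \<open>A linear section of \<open>psi\<close>, modulo the ideal generated by \<open>G\<close>, that kills the monomials outside the
  image of \<open>psi\<close>.\<close>
definition sec :: "mpoly \<Rightarrow> mpoly" where
  "sec = lin_ext Const (\<lambda>e. if \<exists>m. E m = e then mon (SOME m. E m = e) else 0)"

lemma sec_add: "sec (p + q) = sec p + sec q"
  by (simp add: sec_def lin_ext_add rhom_Const)

lemma sec_0: "sec 0 = 0"
  by (simp add: sec_def lin_ext_def)

lemma sec_mon_notin: "(\<And>m. E m \<noteq> e) \<Longrightarrow> sec (Const a * mon e) = 0"
  by (simp add: sec_def lin_ext_mon rhom_Const)

lemma sec_mon_E: "\<exists>m'. E m' = E m \<and> sec (Const a * mon (E m)) = Const a * mon m'"
proof -
  have "E (SOME m'. E m' = E m) = E m" by (rule someI) simp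
  then show ?thesis
    by (intro exI[of _ "SOME m'. E m' = E m"]) (auto simp: sec_def lin_ext_mon rhom_Const)
qed

lemma psi_mon: "psi (Const a * mon m) = Const a * mon (E m)"
  by (simp add: subst.hom_mult subst_edge_mon)

lemma sec_psi: "sec (psi p) - p \<in> idl.span G"
proof (induction p rule: mpoly_linear_induct)
  case (mon a m)
  obtain m' where m': "E m' = E m" "sec (Const a * mon (E m)) = Const a * mon m'"
    using sec_mon_E by blast
  have "Const a * (mon m' - mon m) \<in> idl.span G"
    using mon_diff_in_span[OF m'(1)] by (rule idl.span_scale)
  then show ?case by (simp add: psi_mon m'(2) right_diff_distrib)
next
  case (add p q)
  have "sec (psi (p + q)) - (p + q) = (sec (psi p) - p) + (sec (psi q) - q)"
    by (simp add: subst.hom_add sec_add)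
  then show ?case using idl.span_add[OF add] by (simp only:)
qed

text \<open>If \<open>psi p\<close> is 0, the congruence \<open>sec_psi\<close> compares
  \<open>p\<close> with \<open>sec 0 = 0\<close>. So the toric ideal is covered by the swap
  binomials.\<close>

lemma kernel: "psi p = 0 \<Longrightarrow> p \<in> idl.span G"
  using sec_psi[of p] idl.span_neg[of "- p" G] by (simp add: sec_0)

text \<open>The property of a Reynolds operator: modulo the ideal, \<open>sec\<close> is linear over
  the image of \<open>psi\<close>. Saturation ensures that a monomial outside the image stays
  outside when multiplied by one inside.\<close>

lemma sec_psi_mult:
  assumes sat: "\<And>m e n. E n = E m + e \<Longrightarrow> \<exists>k. E k = e"
  shows "sec (psi q * w) - q * sec w \<in> idl.span G"
proof (induction q rule: mpoly_linear_induct)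
  case (mon a m)
  show ?case
  proof (induction w rule: mpoly_linear_induct)
    case (mon b e)
    have eq: "psi (Const a * mon m) * (Const b * mon e) = Const (a * b) * mon (E m + e)"
      by (simp only: psi_mon) (simp add: Const_mon mult_single)
    show ?case
    proof (cases "\<exists>k. E k = e")
      case True
      then obtain k where k: "E k = e" by blast
      obtain m1 where m1: "E m1 = E (m + k)" "sec (Const (a * b) * mon (E (m + k))) = Const (a * b) * mon m1"
        using sec_mon_E by blast
      obtain m2 where m2: "E m2 = E k" "sec (Const b * mon (E k)) = Const b * mon m2"
        using sec_mon_E by blast
      have "Const (a * b) * (mon m1 - mon (m + m2)) \<in> idl.span G"
        using m1(1) m2(1) by (intro idl.span_scale mon_diff_in_span) (simp add: edge_exp_add)
      moreover have "Const (a * b) * (mon m1 - mon (m + m2))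
          = sec (psi (Const a * mon m) * (Const b * mon e)) - Const a * mon m * sec (Const b * mon e)"
        unfolding eq using m1(2) m2(2)
        by (simp add: edge_exp_add k right_diff_distrib) (simp add: Const_mon mult_single)
      ultimately show ?thesis by simp
    next
      case False
      then have "E n \<noteq> e" "E n \<noteq> E m + e" for n using sat by blast+
      then show ?thesis unfolding eq by (simp add: sec_mon_notin idl.span_zero)
    qed
  next
    case (add p q)
    have "sec (psi (Const a * mon m) * (p + q)) - Const a * mon m * sec (p + q)
       = (sec (psi (Const a * mon m) * p) - Const a * mon m * sec p)
         + (sec (psi (Const a * mon m) * q) - Const a * mon m * sec q)"
      by (simp add: distrib_left sec_add)
    then show ?case using idl.span_add[OF add] by (simp only:)
  qed
next
  case (add p q)
  have "sec (psi (p + q) * w) - (p + q) * sec w = (sec (psi p * w) - p * sec w) + (sec (psi q * w) - q * sec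
    w)"
    by (simp add: subst.hom_add distrib_right sec_add)
  then show ?case using idl.span_add[OF add] by (simp only:)
qed

end

text \<open>The edges of the spinor graph are the entries of the \<open>k\<^sub>i\<close>.\<close>
definition spinor_row :: "nat \<Rightarrow> nat" where
  "spinor_row v = 4 * (v div 4) + (v mod 4) div 2"

definition spinor_col :: "nat \<Rightarrow> nat" where
  "spinor_col v = 4 * (v div 4) + 2 + v mod 2"

lemma spinor_eq: "spinor = subst (\<lambda>v. Var (spinor_row v) * Var (spinor_col v))"
proof -
  have "blk (\<lambda>i. va i * vc i) (\<lambda>i. va i * vd i) (\<lambda>i. vb i * vc i) (\<lambda>i. vb i * vd i) v
      = Var (spinor_row v) * Var (spinor_col v)" for v
  proof -
    have "v mod 4 = 0 \<and> v mod 2 = 0 \<or> v mod 4 = 1 \<and> v mod 2 = 1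
        \<or> v mod 4 = 2 \<and> v mod 2 = 0 \<or> v mod 4 = 3 \<and> v mod 2 = 1"
      by presburger
    then show ?thesis
      unfolding blk_def Let_def va_def vb_def vc_def vd_def spinor_row_def spinor_col_def
      by (elim disjE conjE) (simp_all add: numeral_3_eq_3)
  qed
  then show ?thesis unfolding spinor_def by (intro arg_cong[of _ _ subst] ext)
qed

text \<open>The determinants of all blocks, also beyond \<open>N\<close>, because the spinor map
  parametrises all of the infinitely many blocks at once.\<close>

definition dets :: "mpoly set" where
  "dets = {QJ {i} | i. i \<ge> 1}"

lemma det_in_dets: "Var (4 * b) * Var (4 * b + 3) - Var (4 * b + 1) * Var (4 * b + 2) \<in> dets"
  unfolding dets_def by (rule CollectI, rule exI[of _ "b + 1"])
    (simp add: QJ_def va_def vb_def vc_def vd_def)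

lemma spinor_row_col_div: "spinor_row v div 4 = v div 4" "spinor_col v div 4 = v div 4"
  unfolding spinor_row_def spinor_col_def by presburger+

lemma spinor_inj: "spinor_row v = spinor_row w \<Longrightarrow> spinor_col v = spinor_col w \<Longrightarrow> v = w"
proof -
  assume 1: "spinor_row v = spinor_row w" "spinor_col v = spinor_col w"
  have d: "v div 4 = w div 4" using arg_cong[OF 1(1), of "\<lambda>x. x div 4"] unfolding spinor_row_col_div .
  have "(v mod 4) div 2 = (w mod 4) div 2" "v mod 2 = w mod 2"
    using 1 d by (simp_all add: spinor_row_def spinor_col_def)
  then have "4 * (v div 4) + 2 * ((v mod 4) div 2) + v mod 2
      = 4 * (w div 4) + 2 * ((w mod 4) div 2) + w mod 2" using d by simp
  moreover have "4 * (u div 4) + 2 * ((u mod 4) div 2) + u mod 2 = u" for u :: nat by presburger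
  ultimately show "v = w" by simp
qed

lemma spinor_row_col_at:
  assumes "x < 4"
  shows "spinor_row (4 * b + x) = 4 * b + x div 2" "spinor_col (4 * b + x) = 4 * b + 2 + x mod 2"
proof -
  have "(4 * b + x) div 4 = b" "(4 * b + x) mod 4 = x" using assms by simp_all
  moreover have "(4 * b + x) mod 2 = x mod 2" by presburger
  ultimately show "spinor_row (4 * b + x) = 4 * b + x div 2" "spinor_col (4 * b + x) = 4 * b + 2 + x mod 2"
    by (simp_all only: spinor_row_def spinor_col_def)
qed

text \<open>Each momentum is a separate complete bipartite graph on two rows and two columns. Fourth
  corners therefore always exist and a constant rank will do.\<close>

interpretation spinor: toric spinor_row spinor_col dets "\<lambda>_. 0"
proof
  show "spinor_row v \<noteq> spinor_col w" for v w
  proof -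
    have "4 * a + y \<noteq> 4 * b + 2 + z" if "y < 2" "z < 2" for a b y z :: nat
      using that by presburger
    then show ?thesis unfolding spinor_row_def spinor_col_def
      by (simp add: less_mult_imp_div_less)
  qed
  show "spinor_row v = spinor_row w \<Longrightarrow> spinor_col v = spinor_col w \<Longrightarrow> v = w" for v w
    by (rule spinor_inj)
  fix v' v u
  assume 1: "spinor_row v' = spinor_row v" "spinor_col v' = spinor_col u"
  have "v' div 4 = v div 4" "v' div 4 = u div 4"
    using 1[THEN arg_cong, of "\<lambda>x. x div 4"] unfolding spinor_row_col_div by blast+
  then have b: "u div 4 = v div 4" by simp
  define b where "b = v div 4"
  define x where "x = v mod 4"
  define y where "y = u mod 4"
  have xy: "x < 4" "y < 4" unfolding x_def y_def by simp_all
  have v: "v = 4 * b + x" "u = 4 * b + y" using mult_div_mod_eq[of 4 v] mult_div_mod_eq[of 4 u]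
    unfolding b b_def x_def y_def by (simp_all only:)
  define z where "z = 2 * (y div 2) + x mod 2"
  define z' where "z' = 2 * (x div 2) + y mod 2"
  have z: "z < 4" "z div 2 = y div 2" "z mod 2 = x mod 2" "z' < 4" "z' div 2 = x div 2" "z' mod 2 = y mod 2"
    using xy unfolding z_def z'_def by presburger+
  have w0: "spinor_row (4 * b + z) = spinor_row u" "spinor_col (4 * b + z) = spinor_col v"
    unfolding v by (simp_all only: spinor_row_col_at z xy)
  then show "\<exists>w. spinor_row w = spinor_row u \<and> spinor_col w = spinor_col v" by blast
  fix w
  assume 2: "spinor_row w = spinor_row u" "spinor_col w = spinor_col v"
  have det: "Var (4 * b) * Var (4 * b + 3) - Var (4 * b + 1) * Var (4 * b + 2) \<in> idl.span dets"
    by (intro idl.span_base det_in_dets)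
  have w': "w = 4 * b + z" by (rule spinor_inj) (simp_all only: 2 w0)
  have v': "v' = 4 * b + z'" by (rule spinor_inj) (simp_all only: 1 v spinor_row_col_at z xy)
  \<comment> \<open>Two edges of a block share a row or a column, and the swap is trivial, or they
    are opposite corners, and the swap is the determinant up to sign.\<close>
  have "(x div 2 = y div 2 \<or> x mod 2 = y mod 2) \<or> (x = 0 \<and> y = 3) \<or> (x = 3 \<and> y = 0)
      \<or> (x = 1 \<and> y = 2) \<or> (x = 2 \<and> y = 1)"
    using xy by presburger
  then consider "x div 2 = y div 2 \<or> x mod 2 = y mod 2" | "x = 0" "y = 3" | "x = 3" "y = 0"
    | "x = 1" "y = 2" | "x = 2" "y = 1" by blast
  then show "Var v * Var u - Var v' * Var w \<in> idl.span dets"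
  proof cases
    case 1
    then have "(z' = x \<and> z = y) \<or> (z' = y \<and> z = x)"
      unfolding z_def z'_def by (metis mult_div_mod_eq)
    then have "(v' = v \<and> w = u) \<or> (v' = u \<and> w = v)"
      unfolding v v' w' by blast
    then show ?thesis by (auto simp: idl.span_zero mult.commute)
  qed (use det idl.span_neg[OF det] in \<open>simp_all add: v v' w' z_def z'_def mult.commute\<close>)
qed

section \<open>Descent from spinor coordinates\<close>

text \<open>Weight zero for the torus that scales each \<lambda>_i by t_i and \<mu>_i by its
  inverse.\<close>

definition balanced :: "(nat \<Rightarrow>\<^sub>0 nat) \<Rightarrow> bool" where
  "balanced e \<longleftrightarrow> (\<forall>b. Poly_Mapping.lookup e (4 * b) + Poly_Mapping.lookup e (4 * b + 1)
     = Poly_Mapping.lookup e (4 * b + 2) + Poly_Mapping.lookup e (4 * b + 3))"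

lemma balanced_add_iff: "balanced a \<Longrightarrow> balanced (a + e) \<longleftrightarrow> balanced e"
proof -
  have "w + w' + (x + x') = y + y' + (z + z') \<longleftrightarrow> w' + x' = y' + z'" if "w + x = y + z"
    for w w' x x' y y' z z' :: nat
    using that by linarith
  then show "balanced a \<Longrightarrow> balanced (a + e) \<longleftrightarrow> balanced e"
    unfolding balanced_def lookup_add by blast
qed

lemma balanced_edge:
  assumes "s < 2" "t < 2"
  shows "balanced (Poly_Mapping.single (4 * b + s) 1 + Poly_Mapping.single (4 * b + 2 + t) 1)"
proof -
  have "s = 0 \<or> s = 1" "t = 0 \<or> t = 1" using assms by auto
  moreover have "4 * b \<noteq> 4 * b' + 1" "4 * b \<noteq> 4 * b' + 2" "4 * b \<noteq> 4 * b' + 3"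
    "4 * b + 1 \<noteq> 4 * b' + 2" "4 * b + 1 \<noteq> 4 * b' + 3" "4 * b + 2 \<noteq> 4 * b' + 3"
    "4 * b + 1 \<noteq> 4 * b'" "4 * b + 2 \<noteq> 4 * b'" "4 * b + 3 \<noteq> 4 * b'"
    "4 * b + 2 \<noteq> 4 * b' + 1" "4 * b + 3 \<noteq> 4 * b' + 1" "4 * b + 3 \<noteq> 4 * b' + 2" for b'
    by presburger+
  ultimately show ?thesis
    unfolding balanced_def lookup_add lookup_single when_def
    by (elim disjE) (simp_all add: numeral_3_eq_3)
qed

lemma spinor_row_col_form:
  "\<exists>b s t. s < 2 \<and> t < 2 \<and> spinor_row v = 4 * b + s \<and> spinor_col v = 4 * b + 2 + t"
proof (intro exI conjI)
  show "v mod 4 div 2 < 2" "v mod 2 < 2" by (simp_all add: less_mult_imp_div_less)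
qed (rule spinor_row_def spinor_col_def)+

lemma balanced_edge_exp: "balanced (edge_exp spinor_row spinor_col m)"
proof (induction m rule: exponent_induct)
  case zero
  then show ?case by (simp add: edge_exp_0 balanced_def)
next
  case (add v m)
  obtain b s t where "s < 2" "t < 2" "spinor_row v = 4 * b + s" "spinor_col v = 4 * b + 2 + t"
    using spinor_row_col_form by blast
  then have "balanced (edge_exp spinor_row spinor_col (Poly_Mapping.single v 1))"
    unfolding edge_exp_single by (simp only: balanced_edge)
  then show ?case using add balanced_add_iff by (simp only: edge_exp_add)
qed

lemma key_cases:
  fixes e :: "nat \<Rightarrow>\<^sub>0 nat"
  assumes "Poly_Mapping.lookup e x + Poly_Mapping.lookup e y > 0"
  shows "x \<in> Poly_Mapping.keys e \<or> y \<in> Poly_Mapping.keys e"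
  using assms by (auto simp: in_keys_iff)

text \<open>In a balanced monomial a block that contributes a \<lambda> coordinate also contributes
  a \<mu> coordinate, and conversely. Splitting off one of each, with indices \<open>s\<close> and
  \<open>t\<close>, removes the image of the matrix entry numbered \<open>2 * s + t\<close>.\<close>

lemma balanced_imp_edge_exp: "balanced e \<Longrightarrow> \<exists>m. edge_exp spinor_row spinor_col m = e"
proof (induction "esize e" arbitrary: e rule: less_induct)
  case less
  show ?case
  proof (cases "e = 0")
    case True
    then show ?thesis using edge_exp_0 by blast
  next
    case False
    then obtain v where v: "v \<in> Poly_Mapping.keys e"
      by (metis in_keys_iff lookup_zero poly_mapping_eqI)
    define b where "b = v div 4"
    have "v = 4 * b \<or> v = 4 * b + 1 \<or> v = 4 * b + 2 \<or> v = 4 * b + 3"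
      unfolding b_def by presburger
    moreover have "Poly_Mapping.lookup e v > 0" using v by (simp add: in_keys_iff)
    moreover have "Poly_Mapping.lookup e (4 * b) + Poly_Mapping.lookup e (4 * b + 1)
      = Poly_Mapping.lookup e (4 * b + 2) + Poly_Mapping.lookup e (4 * b + 3)"
      using less.prems by (simp only: balanced_def)
    ultimately have "Poly_Mapping.lookup e (4 * b) + Poly_Mapping.lookup e (4 * b + 1) > 0"
      "Poly_Mapping.lookup e (4 * b + 2) + Poly_Mapping.lookup e (4 * b + 3) > 0"
      by (elim disjE; simp only:; linarith)+
    from this[THEN key_cases]
    obtain s t where st: "s < 2" "t < 2" "4 * b + s \<in> Poly_Mapping.keys e"
      "4 * b + 2 + t \<in> Poly_Mapping.keys e"
    proof -
      assume *: "\<And>s t. s < 2 \<Longrightarrow> t < 2 \<Longrightarrow> 4 * b + s \<in> Poly_Mapping.keys e \<Longrightarrow>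
        4 * b + 2 + t \<in> Poly_Mapping.keys e \<Longrightarrow> thesis"
      assume "4 * b \<in> Poly_Mapping.keys e \<or> 4 * b + 1 \<in> Poly_Mapping.keys e"
        "4 * b + 2 \<in> Poly_Mapping.keys e \<or> 4 * b + 3 \<in> Poly_Mapping.keys e"
      then show thesis
        using *[of 0 0] *[of 0 1] *[of 1 0] *[of 1 1] by (auto simp: numeral_3_eq_3)
    qed
    obtain f where f: "e = Poly_Mapping.single (4 * b + s) 1 + f" using exponent_split st(3) by blast
    have "4 * b + s \<noteq> 4 * b + 2 + t" using st(1,2) by linarith
    then have "4 * b + 2 + t \<in> Poly_Mapping.keys f"
      using st(4) by (simp add: f in_keys_iff lookup_add lookup_single when_def)
    then obtain g where g: "f = Poly_Mapping.single (4 * b + 2 + t) 1 + g" using exponent_split by blast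
    define E1 where "E1 = Poly_Mapping.single (4 * b + s) 1 + Poly_Mapping.single (4 * b + 2 + t) (1 :: nat)"
    have eg: "e = E1 + g" by (simp only: E1_def f g add.assoc)
    have "balanced E1" unfolding E1_def using st by (intro balanced_edge)
    then have "balanced g" using less.prems balanced_add_iff unfolding eg by blast
    moreover have "esize g < esize e" unfolding f g esize_add esize_single by simp
    ultimately obtain m where m: "edge_exp spinor_row spinor_col m = g" using less.hyps by blast
    have "2 * s + t < 4" "(2 * s + t) div 2 = s" "(2 * s + t) mod 2 = t" using st(1,2) by auto
    then have "edge_exp spinor_row spinor_col (Poly_Mapping.single (4 * b + (2 * s + t)) 1) = E1"
      unfolding edge_exp_single E1_def by (simp only: spinor_row_col_at)
    then show ?thesis unfolding eg m[symmetric] edge_exp_add[symmetric] by (metis edge_exp_add)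
  qed
qed

lemma spinor_saturated:
  "edge_exp spinor_row spinor_col n = edge_exp spinor_row spinor_col m + e \<Longrightarrow>
     \<exists>k. edge_exp spinor_row spinor_col k = e"
  using balanced_edge_exp balanced_add_iff balanced_imp_edge_exp by metis

lemma sec_spinor_mult: "spinor.sec (spinor q * w) - q * spinor.sec w \<in> idl.span dets"
  unfolding spinor_eq by (rule spinor.sec_psi_mult) (rule spinor_saturated)

section \<open>Elimination of one momentum and contraction of ideals\<close>

definition msums :: "nat \<Rightarrow> mpoly set" where
  "msums N = {(\<Sum>i\<in>{1..N}. va i), (\<Sum>i\<in>{1..N}. vb i), (\<Sum>i\<in>{1..N}. vc i), (\<Sum>i\<in>{1..N}. vd i)}"

definition gens :: "nat \<Rightarrow> mpoly set" where
  "gens N = msums N \<union> dets"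

text \<open>Conservation says that complementary sums of momenta are opposite, and a 2 x 2
  determinant is even.\<close>

lemma QJ_compl_mod:
  assumes "J \<subseteq> {1..N}"
  shows "QJ J - QJ ({1..N} - J) \<in> idl.span (msums N)"
proof -
  have split: "(\<Sum>i\<in>J. f i) = (\<Sum>i\<in>{1..N}. f i) - (\<Sum>i\<in>{1..N} - J. f i)" for f :: "nat \<Rightarrow> mpoly"
    using sum.subset_diff[OF assms, of f] by simp
  define A B C D A' B' C' D' where
    "A = (\<Sum>i\<in>{1..N}. va i)" "B = (\<Sum>i\<in>{1..N}. vb i)" "C = (\<Sum>i\<in>{1..N}. vc i)" "D = (\<Sum>i\<in>{1..N}. vd i)"
    "A' = (\<Sum>i\<in>{1..N} - J. va i)" "B' = (\<Sum>i\<in>{1..N} - J. vb i)"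
    "C' = (\<Sum>i\<in>{1..N} - J. vc i)" "D' = (\<Sum>i\<in>{1..N} - J. vd i)"
  note defs = this
  have "QJ J - QJ ({1..N} - J) = (D - D') * A + (- A') * D - ((C - C') * B + (- B') * C)"
    unfolding QJ_def split[of va] split[of vb] split[of vc] split[of vd] defs[symmetric]
    by (simp add: algebra_simps)
  moreover have "A \<in> idl.span (msums N)" "B \<in> idl.span (msums N)" "C \<in> idl.span (msums N)"
    "D \<in> idl.span (msums N)"
    unfolding defs by (auto simp: msums_def intro: idl.span_base)
  ultimately show ?thesis
    by (simp only:) (intro idl.span_diff idl.span_add idl.span_scale)
qed

text \<open>Restriction to the linear space of momenta with total zero, in the coordinates of the
  particles other than \<open>e\<close>. For \<open>e\<close> in \<open>{1..N}\<close> its kernel is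
  the ideal of \<open>msums N\<close>.\<close>

definition elim :: "nat \<Rightarrow> nat \<Rightarrow> mpoly \<Rightarrow> mpoly" where
  "elim N e = (let f = (\<lambda>v i. if i = e then - (\<Sum>i\<in>{1..N} - {e}. v i) else v i)
     in subst (blk (f va) (f vb) (f vc) (f vd)))"

interpretation elim: rhom "elim N e"
  unfolding elim_def Let_def by unfold_locales (simp_all add: subst.hom_simps)

lemma elim_entries:
  assumes "i \<ge> 1"
  shows "elim N e (va i) = (if i = e then - (\<Sum>i\<in>{1..N} - {e}. va i) else va i)"
    "elim N e (vb i) = (if i = e then - (\<Sum>i\<in>{1..N} - {e}. vb i) else vb i)"
    "elim N e (vc i) = (if i = e then - (\<Sum>i\<in>{1..N} - {e}. vc i) else vc i)"
    "elim N e (vd i) = (if i = e then - (\<Sum>i\<in>{1..N} - {e}. vd i) else vd i)"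
  using assms by (simp_all add: elim_def Let_def subst_blk)

lemma elim_mod:
  assumes "e \<in> {1..N}"
  shows "p - elim N e p \<in> idl.span (msums N)"
  unfolding elim_def Let_def
proof (rule subst_cong_mod)
  fix v
  have *: "f i - (if i = e then - (\<Sum>i\<in>{1..N} - {e}. f i) else f i) \<in> idl.span (msums N)"
    if "f \<in> {va, vb, vc, vd}" for f i
  proof (cases "i = e")
    case True
    have "f e + (\<Sum>i\<in>{1..N} - {e}. f i) = (\<Sum>i\<in>{1..N}. f i)"
      using sum.remove[of "{1..N}" e f] assms by simp
    moreover have "(\<Sum>i\<in>{1..N}. f i) \<in> idl.span (msums N)"
      using that by (intro idl.span_base) (auto simp: msums_def)
    ultimately show ?thesis using True by simp
  next
    case False
    then show ?thesis by (simp add: idl.span_zero)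
  qed
  show "Var v - blk (\<lambda>i. if i = e then - (\<Sum>i\<in>{1..N} - {e}. va i) else va i)
     (\<lambda>i. if i = e then - (\<Sum>i\<in>{1..N} - {e}. vb i) else vb i)
     (\<lambda>i. if i = e then - (\<Sum>i\<in>{1..N} - {e}. vc i) else vc i)
     (\<lambda>i. if i = e then - (\<Sum>i\<in>{1..N} - {e}. vd i) else vd i) v \<in> idl.span (msums N)"
    by (rule blk_cases[where P = "\<lambda>x y. x - y \<in> idl.span (msums N)"]) (rule *, simp)+
qed

lemma elim_QJ:
  assumes "J \<subseteq> {1..} - {e}"
  shows "elim N e (QJ J) = QJ J"
proof -
  have "elim N e (sum f J) = sum f J" if "f \<in> {va, vb, vc, vd}" for f
    unfolding elim.hom_sum using assms that
  proof (intro sum.cong refl)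
    fix i assume "i \<in> J"
    then have "i \<ge> 1" "i \<noteq> e" using assms by auto
    then show "elim N e (f i) = f i" using that by (auto simp: elim_entries simp del: One_nat_def)
  qed
  then show ?thesis by (simp add: QJ_def elim.hom_diff elim.hom_mult)
qed

lemma elim_msums: "e \<in> {1..N} \<Longrightarrow> s \<in> msums N \<Longrightarrow> elim N e s = 0"
proof -
  assume e: "e \<in> {1..N}" and s: "s \<in> msums N"
  have "elim N e (\<Sum>i\<in>{1..N}. f i) = 0" if "f \<in> {va, vb, vc, vd}" for f
  proof -
    have "elim N e (\<Sum>i\<in>{1..N}. f i) = elim N e (f e) + (\<Sum>i\<in>{1..N} - {e}. elim N e (f i))"
      unfolding elim.hom_sum using e by (intro sum.remove) auto
    also have "(\<Sum>i\<in>{1..N} - {e}. elim N e (f i)) = (\<Sum>i\<in>{1..N} - {e}. f i)"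
      using that by (intro sum.cong refl) (auto simp: elim_entries)
    also have "elim N e (f e) = - (\<Sum>i\<in>{1..N} - {e}. f i)"
      using e that by (auto simp: elim_entries)
    finally show ?thesis by simp
  qed
  then show ?thesis using s by (auto simp: msums_def)
qed

text \<open>Here the rank condition of the eliminated momentum becomes the one remaining equation;
  the sign disappears because the determinant is even.\<close>

lemma elim_QJ_self:
  assumes "e \<in> {1..N}"
  shows "elim N e (QJ {e}) = QJ ({1..N} - {e})"
  using assms by (simp add: QJ_def elim.hom_simps elim_entries)

lemma spinor_det: "i \<ge> 1 \<Longrightarrow> spinor (QJ {i}) = 0"
  by (simp add: QJ_def spinor.hom_simps spinor_entries algebra_simps)

definition total :: "nat \<Rightarrow> nat \<Rightarrow> mpoly" where
  "total N e = spinor_QJ ({1..N} - {e})"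

text \<open>The ideal of \<open>R\<^sub>N\<close> generated by \<open>F\<close> pulls back to the contraction of the ideal generated by \<open>H\<close> and
  the remaining momentum conservation equation.\<close>
lemma descent:
  assumes e: "e \<in> {1..N}"
    and FH: "\<And>f. f \<in> F \<Longrightarrow> spinor (elim N e f) \<in> idl.span (insert (total N e) H)"
    and HF: "\<And>h w. h \<in> H \<Longrightarrow> spinor.sec (h * w) \<in> idl.span (dets \<union> F)"
  shows "p \<in> idl.span (gens N \<union> F) \<longleftrightarrow> spinor (elim N e p) \<in> idl.span (insert (total N e) H)"
proof
  have tot: "total N e = spinor (QJ ({1..N} - {e}))"
    unfolding total_def by (intro spinor_of_QJ[symmetric]) auto
  have g: "spinor (elim N e g) \<in> idl.span (insert (total N e) H)" if "g \<in> gens N \<union> F" for g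
  proof -
    consider "g \<in> msums N" | i where "g = QJ {i}" "i \<ge> 1" "i \<noteq> e" | "g = QJ {e}" | "g \<in> F"
      using \<open>g \<in> gens N \<union> F\<close> by (auto simp: gens_def dets_def)
    then show ?thesis
    proof cases
      case 1
      then show ?thesis using e by (simp add: elim_msums spinor.hom_zero idl.span_zero)
    next
      case 2
      then show ?thesis by (simp add: elim_QJ spinor_det idl.span_zero)
    next
      case 3
      then have "spinor (elim N e g) = total N e" using e by (simp only: elim_QJ_self tot)
      then show ?thesis by (simp add: idl.span_base)
    qed (rule FH)
  qed
  interpret h: rhom "\<lambda>p. spinor (elim N e p)"
    by (intro rhom_comp[of spinor "elim N e"] spinor.rhom_axioms elim.rhom_axioms)
  assume "p \<in> idl.span (gens N \<union> F)"
  from h.span_image_subset[OF this] show "spinor (elim N e p) \<in> idl.span (insert (total N e) H)"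
    by (rule idl_span_trans) (use g in auto)
next
  define Q where "Q = QJ ({1..N} - {e})"
  have tot: "total N e = spinor Q"
    unfolding total_def Q_def by (intro spinor_of_QJ[symmetric]) auto
  define q where "q = elim N e p"
  define T where "T = idl.span (gens N \<union> F)"
  have dT: "x \<in> T" if "x \<in> idl.span dets" for x
    using that idl.span_mono[of dets "gens N \<union> F"] by (auto simp: T_def gens_def)
  have sT: "x \<in> T" if "x \<in> idl.span (msums N)" for x
    using that idl.span_mono[of "msums N" "gens N \<union> F"] by (auto simp: T_def gens_def)
  have fT: "x \<in> T" if "x \<in> idl.span (dets \<union> F)" for x
    using that idl.span_mono[of "dets \<union> F" "gens N \<union> F"] by (auto simp: T_def gens_def)
  have congT: "x \<in> T" if "x - y \<in> T" "y \<in> T" for x y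
    using idl.span_add[of "x - y" _ y] that by (simp add: T_def)
  assume "spinor (elim N e p) \<in> idl.span (insert (total N e) H)"
  then obtain k where k: "spinor q - k * total N e \<in> idl.span H"
    unfolding q_def idl.span_breakdown_eq by blast
  have secH: "spinor.sec x \<in> T" if "x \<in> idl.span H" for x
    using that
  proof (induction rule: idl.span_induct_alt)
    case base
    then show ?case by (simp add: spinor.sec_0 T_def idl.span_zero)
  next
    case (step c h y)
    have "spinor.sec (h * c) \<in> T" using HF step(1) fT by blast
    then show ?case using step(2)
      by (simp add: spinor.sec_add T_def mult.commute[of c] idl.span_add)
  qed
  \<comment> \<open>\<open>Q\<close> is congruent to the determinant of the eliminated momentum
    modulo conservation, so the remaining equation already belongs to \<open>T\<close>.\<close>
  have QT: "Q \<in> T"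
  proof -
    have "QJ {e} - Q \<in> T" unfolding Q_def using e by (intro sT QJ_compl_mod) simp
    moreover have "QJ {e} \<in> T"
      using e by (intro dT idl.span_base) (auto simp: dets_def)
    ultimately show ?thesis using idl_span_diff_cong unfolding T_def by blast
  qed
  have 1: "spinor.sec (spinor Q * k) \<in> T"
  proof (rule congT)
    show "spinor.sec (spinor Q * k) - Q * spinor.sec k \<in> T"
      by (intro dT sec_spinor_mult)
    show "Q * spinor.sec k \<in> T" using QT by (simp add: T_def idl_span_mult_right)
  qed
  \<comment> \<open>The \<open>H\<close> part goes to \<open>T\<close> by \<open>HF\<close>. The
    other part has the invariant factor \<open>spinor Q\<close>, which comes out of
    \<open>sec\<close> as \<open>Q\<close>.\<close>
  have "spinor.sec (spinor q) = spinor.sec (spinor q - k * total N e) + spinor.sec (spinor Q * k)"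
    by (simp add: spinor.sec_add[symmetric] tot mult.commute)
  then have 2: "spinor.sec (spinor q) \<in> T" using secH[OF k] 1 by (simp add: T_def idl.span_add)
  have "spinor.sec (spinor q) - q \<in> T"
    using spinor.sec_psi[of q] unfolding spinor_eq[symmetric] by (rule dT)
  then have "q \<in> T" using 2 idl_span_diff_cong unfolding T_def by blast
  moreover have "p - q \<in> T" unfolding q_def by (intro sT elim_mod e)
  ultimately show "p \<in> idl.span (gens N \<union> F)" using congT unfolding T_def by blast
qed

lemma prime_descent:
  assumes "e \<in> {1..N}"
    and "\<And>f. f \<in> F \<Longrightarrow> spinor (elim N e f) \<in> idl.span (insert (total N e) H)"
    and "\<And>h w. h \<in> H \<Longrightarrow> spinor.sec (h * w) \<in> idl.span (dets \<union> F)"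
    and "is_prime (idl.span (insert (total N e) H))"
  shows "is_prime (idl.span (gens N \<union> F))"
proof -
  interpret h: rhom "\<lambda>p. spinor (elim N e p)"
    by (intro rhom_comp[of spinor "elim N e"] spinor.rhom_axioms elim.rhom_axioms)
  have "idl.span (gens N \<union> F) = (\<lambda>p. spinor (elim N e p)) -` idl.span (insert (total N e) H)"
    using descent[OF assms(1-3)] by auto
  then show ?thesis using h.is_prime_vimage[OF assms(4)] by simp
qed

section \<open>Primality of \<open>(Q_J)\<close> and of the plus ideals of pairs\<close>

lemma three_elements:
  assumes "3 \<le> card A"
  obtains x y z where "x \<in> A" "y \<in> A" "z \<in> A" "x \<noteq> y" "x \<noteq> z" "y \<noteq> z"
proof -
  obtain B where "B \<subseteq> A" "card B = 3" by (rule obtain_subset_with_card_n[OF assms])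
  then obtain x y z where "B = {x, y, z}" "x \<noteq> y" "x \<noteq> z" "y \<noteq> z" unfolding card_3_iff by blast
  then show thesis using that[of x y z] \<open>B \<subseteq> A\<close> by blast
qed

lemma blocks_simps:
  "i \<ge> 1 \<Longrightarrow> blocks (va i) = {i}" "i \<ge> 1 \<Longrightarrow> blocks (vb i) = {i}"
  "i \<ge> 1 \<Longrightarrow> blocks (vc i) = {i}" "i \<ge> 1 \<Longrightarrow> blocks (vd i) = {i}"
  by (auto simp: blocks_def)

lemma blocks_subset:
  "blocks p \<subseteq> J \<Longrightarrow> blocks q \<subseteq> J \<Longrightarrow> blocks (p + q) \<subseteq> J"
  "blocks p \<subseteq> J \<Longrightarrow> blocks q \<subseteq> J \<Longrightarrow> blocks (p - q) \<subseteq> J"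
  "blocks p \<subseteq> J \<Longrightarrow> blocks q \<subseteq> J \<Longrightarrow> blocks (p * q) \<subseteq> J"
  "(\<And>i. i \<in> L \<Longrightarrow> blocks (f i) \<subseteq> J) \<Longrightarrow> blocks (sum f L) \<subseteq> J"
proof -
  have *: "blocks p \<subseteq> J \<longleftrightarrow> (\<forall>v\<in>vars p. v div 4 + 1 \<in> J)" for p
    by (auto simp: blocks_def)
  show "blocks p \<subseteq> J \<Longrightarrow> blocks q \<subseteq> J \<Longrightarrow> blocks (p + q) \<subseteq> J"
    unfolding * using vars_add[of p q] by blast
  show "blocks p \<subseteq> J \<Longrightarrow> blocks q \<subseteq> J \<Longrightarrow> blocks (p - q) \<subseteq> J"
    unfolding * using vars_diff[of p q] by blast
  show "blocks p \<subseteq> J \<Longrightarrow> blocks q \<subseteq> J \<Longrightarrow> blocks (p * q) \<subseteq> J"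
    unfolding * using vars_mult[of p q] by blast
  show "(\<And>i. i \<in> L \<Longrightarrow> blocks (f i) \<subseteq> J) \<Longrightarrow> blocks (sum f L) \<subseteq> J"
    unfolding * using vars_sum[of f L] by blast
qed

text \<open>Two runs of the linear chain. Inside \<open>J\<close>, \<open>s\<close> and
  \<open>t\<close> carry the chain for \<open>Q_J\<close> and \<open>u\<close> is the test particle.
  Outside \<open>J\<close>, \<open>e\<close> is eliminated and \<open>p, q\<close> carry the chain
  for the remaining equation. This consumes three particles on either side.\<close>

lemma QJ_prime:
  assumes J: "J \<subseteq> {1..N}" "3 \<le> card J" "3 \<le> card ({1..N} - J)"
  shows "is_prime (idl.span (gens N \<union> {QJ J}))"
proof -
  have finJ: "finite J" using J(1) finite_subset by blast
  obtain e p q where epq: "e \<in> {1..N} - J" "p \<in> {1..N} - J" "q \<in> {1..N} - J" "e \<noteq> p" "e \<noteq> q" "p \<noteq> q"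
    using three_elements[OF J(3)] by blast
  obtain s t u where stu: "s \<in> J" "t \<in> J" "u \<in> J" "s \<noteq> t" "s \<noteq> u" "t \<noteq> u"
    using three_elements[OF J(2)] by blast
  have epq1: "p \<ge> 1" "q \<ge> 1" "p \<noteq> q" "p \<in> {1..N} - {e}" "q \<in> {1..N} - {e}" using epq by simp_all
  have J1: "i \<ge> 1" if "i \<in> J" for i using J(1) that by auto
  have blocksJ: "blocks (spinor_QJ J) \<subseteq> J"
    unfolding spinor_QJ_def using J1 by (intro blocks_subset) (auto simp: blocks_simps)
  have "is_prime (idl.span (insert (spinor_QJ (insert s (insert t (J - {s, t})))) {}))"
    using stu finJ J1 by (intro spinor_QJ_prime[where s = u]) (auto simp: is_prime_zero)
  moreover have "insert s (insert t (J - {s, t})) = J" using stu by auto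
  ultimately have 1: "is_prime (idl.span {spinor_QJ J})" by simp
  show ?thesis
  proof (rule prime_descent)
    show "e \<in> {1..N}" using epq by simp
    show "spinor (elim N e f) \<in> idl.span (insert (total N e) {spinor_QJ J})" if "f \<in> {QJ J}" for f
    proof -
      have "spinor (elim N e (QJ J)) = spinor_QJ J"
        using J1 epq by (subst elim_QJ) (auto intro!: spinor_of_QJ)
      then show ?thesis using that by (simp add: idl.span_base)
    qed
    show "spinor.sec (h * w) \<in> idl.span (dets \<union> {QJ J})" if "h \<in> {spinor_QJ J}" for h w
    proof -
      have h: "h = spinor (QJ J)" using that spinor_of_QJ[OF J1] by simp
      have "spinor.sec (h * w) - QJ J * spinor.sec w \<in> idl.span dets"
        unfolding h by (rule sec_spinor_mult)
      then have "spinor.sec (h * w) - QJ J * spinor.sec w \<in> idl.span (dets \<union> {QJ J})"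
        using idl.span_mono[of dets "dets \<union> {QJ J}"] by auto
      moreover have "QJ J * spinor.sec w \<in> idl.span (dets \<union> {QJ J})"
        by (intro idl_span_mult_right idl.span_base) simp
      ultimately show ?thesis using idl_span_diff_cong by blast
    qed
    have "is_prime (idl.span (insert (spinor_QJ (insert p (insert q ({1..N} - {e, p, q})))) {spinor_QJ J}))"
    proof (rule spinor_QJ_prime[where s = s])
      let ?z = "blk (\<lambda>i. 0) (\<lambda>i. if i = s then 1 else 0) (\<lambda>i. if i = s then 1 else 0) (\<lambda>i. 0 :: complex)"
      have "(\<Sum>i\<in>J. ev ?z (va i) * ev ?z (vc i)) = 0" "(\<Sum>i\<in>J. ev ?z (va i) * ev ?z (vd i)) = 0"
        using J1 by (auto intro!: sum.neutral simp: ev_blk)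
      then show "ev ?z g = 0" if "g \<in> {spinor_QJ J}" for g
        using that by (simp add: spinor_QJ_def ev.hom_simps)
      show "is_prime (idl.span {spinor_QJ J})" by (rule 1)
      show "p \<notin> blocks g \<and> q \<notin> blocks g" if "g \<in> {spinor_QJ J}" for g
        using that blocksJ epq by blast
      show "s \<in> {1..N} - {e, p, q}" using stu(1) J(1) epq by blast
    qed (use epq1(1-3) in simp_all)
    moreover have "insert p (insert q ({1..N} - {e, p, q})) = {1..N} - {e}"
      using epq1(3-5) by blast
    ultimately show "is_prime (idl.span (insert (total N e) {spinor_QJ J}))" by (simp add: total_def)
  qed
qed

text \<open>The two terms of the bracket have the same weight, so for a monomial \<open>w\<close>
  both products are invariant or neither is. If they are, \<open>w\<close> must contain a coordinate
  of \<mu>_i and one of \<mu>_j, and the bracket times these two is the image of a minor.\<close>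

lemma sec_bracket:
  assumes ij: "i \<ge> 1" "j \<ge> 1" "i \<noteq> j"
  shows "spinor.sec ((va i * vb j - vb i * va j) * w) \<in> idl.span (dets \<union> minors (colsP {i, j}))"
proof (induction w rule: mpoly_linear_induct)
  case (add p q)
  then show ?case by (simp add: distrib_left spinor.sec_add idl.span_add)
next
  case (mon a e)
  let ?s = "\<lambda>v. Poly_Mapping.single v (1 :: nat)"
  define x where "x = i - 1"
  define y where "y = j - 1"
  have xy: "x \<noteq> y" using ij by (simp add: x_def y_def eq_diff_iff)
  define u1 where "u1 = ?s (4 * x + 0) + ?s (4 * y + 1)"
  define u2 where "u2 = ?s (4 * x + 1) + ?s (4 * y + 0)"
  have u1: "va i * vb j * (Const a * mon e) = Const a * mon (u1 + e)"
    unfolding va_def vb_def x_def[symmetric] y_def[symmetric] Var_mon u1_def mon_add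
    by (simp only: mult.assoc mult.commute mult.left_commute add_0_right)
  have u2: "vb i * va j * (Const a * mon e) = Const a * mon (u2 + e)"
    unfolding va_def vb_def x_def[symmetric] y_def[symmetric] Var_mon u2_def mon_add
    by (simp only: mult.assoc mult.commute mult.left_commute add_0_right)
  show ?case
  proof (cases "balanced (u1 + e)")
    case False
    \<comment> \<open>The monomial \<open>vc i * vc j\<close>: it makes both terms of the bracket
      balanced, which shows that their weights agree.\<close>
    define z where "z = ?s (4 * x + 2 + 0) + ?s (4 * y + 2 + 0)"
    have "u1 + z = (?s (4 * x + 0) + ?s (4 * x + 2 + 0)) + (?s (4 * y + 1) + ?s (4 * y + 2 + 0))"
      "u2 + z = (?s (4 * x + 1) + ?s (4 * x + 2 + 0)) + (?s (4 * y + 0) + ?s (4 * y + 2 + 0))"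
      unfolding u1_def u2_def z_def by (simp_all only: ac_simps)
    moreover have "balanced (?s (4 * b + s) + ?s (4 * b + 2 + 0))" if "s < 2" for b s
      using that by (intro balanced_edge) auto
    ultimately have "balanced (u1 + z)" "balanced (u2 + z)"
      by (simp_all only: balanced_add_iff)
    moreover have "(u1 + z) + (u2 + e) = (u2 + z) + (u1 + e)" by (simp only: ac_simps)
    ultimately have "\<not> balanced (u2 + e)" using False balanced_add_iff by metis
    then have "edge_exp spinor_row spinor_col m \<noteq> u1 + e" "edge_exp spinor_row spinor_col m \<noteq> u2 + e" for m
      using False balanced_edge_exp by metis+
    then have "spinor.sec (Const a * mon (u1 + e)) = 0" "spinor.sec (Const a * mon (u2 + e)) = 0"
      by (auto intro: spinor.sec_mon_notin)
    moreover have "spinor.sec (p - q) = spinor.sec p - spinor.sec q" for p q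
      using spinor.sec_add[of "p - q" q] by (simp add: algebra_simps)
    ultimately show ?thesis by (simp add: left_diff_distrib u1 u2 idl.span_zero)
  next
    case True
    have "Poly_Mapping.lookup (u1 + e) (4 * b) + Poly_Mapping.lookup (u1 + e) (4 * b + 1)
      = Poly_Mapping.lookup (u1 + e) (4 * b + 2) + Poly_Mapping.lookup (u1 + e) (4 * b + 3)" for b
      using True unfolding balanced_def by blast
    moreover have "Poly_Mapping.lookup u1 (4 * b + 2) = 0" "Poly_Mapping.lookup u1 (4 * b + 3) = 0" for b
    proof -
      have "4 * x + 0 \<noteq> 4 * b + 2" "4 * x + 0 \<noteq> 4 * b + 3" "4 * y + 1 \<noteq> 4 * b + 2" "4 * y + 1 \<noteq> 4 * b + 3"
        by presburger+
      then show "Poly_Mapping.lookup u1 (4 * b + 2) = 0" "Poly_Mapping.lookup u1 (4 * b + 3) = 0"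
        unfolding u1_def lookup_add lookup_single by simp_all
    qed
    moreover have "Poly_Mapping.lookup u1 (4 * x) > 0" "Poly_Mapping.lookup u1 (4 * y + 1) > 0"
      by (simp_all add: u1_def lookup_add)
    \<comment> \<open>\<open>u1\<close> has \<lambda> degree in the blocks \<open>x\<close> and
      \<open>y\<close> but no \<mu> degree anywhere, so balance must be restored by \<mu> factors of
      \<open>e\<close>.\<close>
    ultimately have "Poly_Mapping.lookup e (4 * b + 2) + Poly_Mapping.lookup e (4 * b + 3) > 0"
      if "b = x \<or> b = y" for b
      using that unfolding lookup_add by (metis add_gr_0 add_cancel_left_left)
    from key_cases[OF this]
    have keys: "\<exists>s<2. 4 * b + 2 + s \<in> Poly_Mapping.keys e" if "b = x \<or> b = y" for b
      using that by (metis add.assoc add_0_right less_2_cases_iff numeral_plus_one semiring_norm(3)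
        one_add_one numeral_3_eq_3 Suc_eq_plus1 numeral_2_eq_2)
    obtain s where s: "s < 2" "4 * x + 2 + s \<in> Poly_Mapping.keys e" using keys by blast
    obtain t where t: "t < 2" "4 * y + 2 + t \<in> Poly_Mapping.keys e" using keys by blast
    obtain f where f: "e = ?s (4 * x + 2 + s) + f" using exponent_split s(2) by blast
    have "4 * x + 2 + s \<noteq> 4 * y + 2 + t" using s(1) t(1) xy by presburger
    then have "4 * y + 2 + t \<in> Poly_Mapping.keys f"
      using t(2) by (simp add: f in_keys_iff lookup_add lookup_single when_def)
    then obtain g where g: "f = ?s (4 * y + 2 + t) + g" using exponent_split by blast
    have "u1 + e = (?s (4 * x + 0) + ?s (4 * x + 2 + s)) + ((?s (4 * y + 1) + ?s (4 * y + 2 + t)) + g)"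
      unfolding u1_def f g by (simp only: ac_simps)
    moreover have "balanced (?s (4 * x + 0) + ?s (4 * x + 2 + s))"
      "balanced (?s (4 * y + 1) + ?s (4 * y + 2 + t))"
      using s t by (intro balanced_edge; simp)+
    ultimately have "balanced g" using True balanced_add_iff by metis
    then obtain k where k: "edge_exp spinor_row spinor_col k = g" using balanced_imp_edge_exp by blast
    \<comment> \<open>Minor of column \<open>s\<close> of k_i and column \<open>t\<close> of
      k_j.\<close>
    define m where "m = (if s = 0 then va i else vb i) * (if t = 0 then vc j else vd j)
      - (if t = 0 then va j else vb j) * (if s = 0 then vc i else vd i)"
    have m: "m \<in> minors (colsP {i, j})"
      unfolding m_def minors_def colsP_def by (cases "s = 0"; cases "t = 0") (auto, blast+)
    have ms: "Var (4 * x + 2 + s) = (if s = 0 then vc i else vd i)"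
      "Var (4 * y + 2 + t) = (if t = 0 then vc j else vd j)"
      using s(1) t(1) by (auto simp: vc_def vd_def x_def y_def less_2_cases_iff numeral_3_eq_3)
    have "spinor m = (va i * vb j - vb i * va j) * (Var (4 * x + 2 + s) * Var (4 * y + 2 + t))"
      unfolding ms m_def using ij by (simp add: spinor.hom_simps spinor_entries algebra_simps)
    moreover have "spinor (Const a * mon k) = Const a * mon g"
      using spinor.psi_mon[of a k] unfolding spinor_eq[symmetric] k .
    ultimately have "spinor (m * (Const a * mon k)) = (va i * vb j - vb i * va j) * (Const a * mon e)"
      unfolding f g mon_add Var_mon spinor.hom_mult by (simp only: ac_simps)
    moreover have "spinor.sec (spinor (m * (Const a * mon k))) - m * (Const a * mon k) \<in> idl.span dets"
      using spinor.sec_psi[of "m * (Const a * mon k)"] unfolding spinor_eq[symmetric] .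
    then have "spinor.sec (spinor (m * (Const a * mon k))) - m * (Const a * mon k)
        \<in> idl.span (dets \<union> minors (colsP {i, j}))"
      using idl.span_mono[of dets "dets \<union> minors (colsP {i, j})"] by auto
    moreover have "m * (Const a * mon k) \<in> idl.span (dets \<union> minors (colsP {i, j}))"
      using m by (intro idl_span_mult_right idl.span_base) simp
    ultimately show ?thesis using idl_span_diff_cong by metis
  qed
qed

lemma colsP_iff: "(x, y) \<in> colsP S \<longleftrightarrow> (\<exists>a\<in>S. x = va a \<and> y = vc a \<or> x = vb a \<and> y = vd a)"
  unfolding colsP_def Un_iff mem_Collect_eq prod.inject by metis

lemma colsM_iff: "(x, y) \<in> colsM S \<longleftrightarrow> (\<exists>a\<in>S. x = va a \<and> y = vb a \<or> x = vc a \<and> y = vd a)"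
  unfolding colsM_def Un_iff mem_Collect_eq prod.inject by metis

text \<open>In spinor coordinates the ideal becomes one bracket together with the remaining
  equation. The bracket is prime, and the equation is adjoined by the chain along
  \<open>p, q\<close>. Finding \<open>e, p, q\<close> outside the pair is where
  \<open>N \<ge> 5\<close> enters.\<close>

lemma colsP_prime:
  assumes N: "N \<ge> 5" and ij: "i \<in> {1..N}" "j \<in> {1..N}" "i \<noteq> j"
  shows "is_prime (idl.span (gens N \<union> minors (colsP {i, j})))"
proof -
  have "card ({1..N} - {i, j}) = N - 2" using ij by (subst card_Diff_subset) auto
  then have "3 \<le> card ({1..N} - {i, j})" using N by simp
  from three_elements[OF this] obtain e p q where epq: "e \<in> {1..N} - {i, j}" "p \<in> {1..N} - {i, j}"
    "q \<in> {1..N} - {i, j}"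
    "e \<noteq> p" "e \<noteq> q" "p \<noteq> q"
    by blast
  have epq1: "p \<ge> 1" "q \<ge> 1" "p \<noteq> q" "p \<in> {1..N} - {e}" "q \<in> {1..N} - {e}" using epq by simp_all
  define br where "br = va i * vb j - vb i * va j"
  have ij1: "i \<ge> 1" "j \<ge> 1" using ij by auto
  have brP: "is_prime (idl.span {br})" unfolding br_def using ij by (intro bracket_prime) auto
  have br_blocks: "blocks br \<subseteq> {i, j}"
    unfolding br_def using ij1 by (intro blocks_subset) (auto simp: blocks_simps)
  show ?thesis
  proof (rule prime_descent)
    show "e \<in> {1..N}" using epq by simp
    show "spinor.sec (h * w) \<in> idl.span (dets \<union> minors (colsP {i, j}))" if "h \<in> {br}" for h w
      using that sec_bracket[OF ij1 ij(3)] by (simp add: br_def)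
    show "spinor (elim N e f) \<in> idl.span (insert (total N e) {br})" if f: "f \<in> minors (colsP {i, j})" for f
    proof -
      \<comment> \<open>Both columns of k_a are multiples of \<lambda>_a; the multiplier is a
        coordinate of \<mu>_a.\<close>
      have col: "\<exists>a m. a \<in> {i, j} \<and> spinor (elim N e x) = va a * m \<and> spinor (elim N e y) = vb a * m"
        if xy: "(x, y) \<in> colsP {i, j}" for x y
      proof -
        obtain a where a: "a \<in> {i, j}" "(x = va a \<and> y = vc a) \<or> (x = vb a \<and> y = vd a)"
          using xy unfolding colsP_iff by blast
        from a(1) have "a \<ge> 1" "a \<noteq> e" using ij1 epq(1) by blast+
        from a(2) show ?thesis
        proof
          assume "x = va a \<and> y = vc a"
          then show ?thesis using a(1) \<open>a \<ge> 1\<close> \<open>a \<noteq> e\<close>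
            by (intro exI[of _ a] exI[of _ "vc a"]) (simp add: elim_entries spinor_entries)
        next
          assume "x = vb a \<and> y = vd a"
          then show ?thesis using a(1) \<open>a \<ge> 1\<close> \<open>a \<noteq> e\<close>
            by (intro exI[of _ a] exI[of _ "vd a"]) (simp add: elim_entries spinor_entries)
        qed
      qed
      obtain x1 y1 x2 y2 where f': "f = x1 * y2 - x2 * y1" "(x1, y1) \<in> colsP {i, j}" "(x2, y2) \<in> colsP {i, j}"
        using f unfolding minors_def by blast
      obtain a m where am: "a \<in> {i, j}" "spinor (elim N e x1) = va a * m" "spinor (elim N e y1) = vb a * m"
        using col f' by blast
      obtain b n where bn: "b \<in> {i, j}" "spinor (elim N e x2) = va b * n" "spinor (elim N e y2) = vb b * n"
        using col f' by blast
      have "spinor (elim N e f) = m * n * (va a * vb b - vb a * va b)"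
        unfolding f' by (simp add: elim.hom_simps spinor.hom_simps am bn algebra_simps)
      moreover have "va a * vb b - vb a * va b \<in> idl.span {br}"
      proof -
        have "va a * vb b - vb a * va b \<in> {0, br, - br}"
          using am(1) bn(1) unfolding br_def by (auto simp: mult.commute)
        then show ?thesis using idl.span_base[of br "{br}"] idl.span_neg idl.span_zero by auto
      qed
      ultimately have "spinor (elim N e f) \<in> idl.span {br}" by (simp only: idl.span_scale)
      then show ?thesis using idl.span_mono[of "{br}" "{total N e, br}"] by blast
    qed
    have "is_prime (idl.span (insert (spinor_QJ (insert p (insert q ({1..N} - {e, p, q})))) {br}))"
    proof (rule spinor_QJ_prime[where s = i])
      show "ev (blk (\<lambda>k. 0) (\<lambda>k. if k = i then 1 else 0) (\<lambda>k. if k = i then 1 else 0) (\<lambda>k. 0)) g = 0"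
        if "g \<in> {br}" for g
        using that ij1 by (simp add: br_def ev.hom_simps ev_blk)
      show "is_prime (idl.span {br})" by (rule brP)
      show "p \<notin> blocks g \<and> q \<notin> blocks g" if "g \<in> {br}" for g
        using that br_blocks epq(2,3) by blast
      show "i \<in> {1..N} - {e, p, q}" using ij(1) epq(1-3) by blast
    qed (use epq1(1-3) in simp_all)
    moreover have "insert p (insert q ({1..N} - {e, p, q})) = {1..N} - {e}"
      using epq1(3-5) by blast
    ultimately show "is_prime (idl.span (insert (total N e) {br}))" by (simp add: total_def)
  qed
qed

section \<open>Transposition\<close>

definition trans_k :: "mpoly \<Rightarrow> mpoly" where
  "trans_k = subst (blk va vc vb vd)"

interpretation trans_k: rhom trans_k
  unfolding trans_k_def by unfold_locales (simp_all add: subst.hom_simps)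

lemma trans_k_entries:
  "i \<ge> 1 \<Longrightarrow> trans_k (va i) = va i" "i \<ge> 1 \<Longrightarrow> trans_k (vb i) = vc i"
  "i \<ge> 1 \<Longrightarrow> trans_k (vc i) = vb i" "i \<ge> 1 \<Longrightarrow> trans_k (vd i) = vd i"
  by (simp_all add: trans_k_def subst_blk)

lemma trans_k_invol: "trans_k (trans_k p) = p"
proof -
  have "subst (blk va vc vb vd) (blk va vc vb vd v) = Var v" for v
    by (rule blk_cases[where P = "\<lambda>x y. subst (blk va vc vb vd) y = x"]) (simp_all add: subst_blk)
  then show ?thesis by (simp add: trans_k_def subst_subst subst_ident)
qed

lemma trans_k_QJ: "J \<subseteq> {1..} \<Longrightarrow> trans_k (QJ J) = QJ J"
proof -
  assume "J \<subseteq> {1..}"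
  then have "i \<ge> 1" if "i \<in> J" for i using that by auto
  then show ?thesis
    by (simp add: QJ_def trans_k.hom_simps trans_k_entries mult.commute cong: sum.cong)
qed

lemma trans_k_gens: "g \<in> gens N \<Longrightarrow> trans_k g \<in> gens N"
proof -
  assume g: "g \<in> gens N"
  have "trans_k (sum va {1..N}) = sum va {1..N}" "trans_k (sum vb {1..N}) = sum vc {1..N}"
    "trans_k (sum vc {1..N}) = sum vb {1..N}" "trans_k (sum vd {1..N}) = sum vd {1..N}"
    unfolding trans_k.hom_sum by (intro sum.cong refl; simp add: trans_k_entries)+
  moreover have "trans_k (QJ {i}) = QJ {i}" if "i \<ge> 1" for i using that by (intro trans_k_QJ) auto
  ultimately show ?thesis using g unfolding gens_def msums_def dets_def by auto
qed

lemma span_trans_k: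
  "p \<in> idl.span (gens N \<union> F) \<Longrightarrow> trans_k p \<in> idl.span (gens N \<union> trans_k ` F)"
  using trans_k.span_image_subset[of p "gens N \<union> F"]
    idl.span_mono[of "trans_k ` (gens N \<union> F)" "gens N \<union> trans_k ` F"] trans_k_gens by blast

lemma span_trans_k_iff:
  "trans_k p \<in> idl.span (gens N \<union> trans_k ` F) \<longleftrightarrow> p \<in> idl.span (gens N \<union> F)"
proof
  have "trans_k ` trans_k ` F = F" by (simp add: image_image trans_k_invol)
  then show "trans_k p \<in> idl.span (gens N \<union> trans_k ` F) \<Longrightarrow> p \<in> idl.span (gens N \<union> F)"
    using span_trans_k[of "trans_k p" N "trans_k ` F"] by (simp add: trans_k_invol)
qed (rule span_trans_k)

lemma prime_trans_k:
  assumes "is_prime (idl.span (gens N \<union> F))"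
  shows "is_prime (idl.span (gens N \<union> trans_k ` F))"
proof -
  have "idl.span (gens N \<union> trans_k ` F) = trans_k -` idl.span (gens N \<union> F)"
    using span_trans_k_iff[of "trans_k _" N F] by (auto simp: trans_k_invol)
  then show ?thesis using trans_k.is_prime_vimage[OF assms] by simp
qed

lemma trans_k_minors_image: "trans_k ` minors C = minors ((\<lambda>(x, y). (trans_k x, trans_k y)) ` C)"
proof (intro equalityI subsetI)
  fix f assume "f \<in> trans_k ` minors C"
  then obtain x1 y1 x2 y2 where "f = trans_k (x1 * y2 - x2 * y1)" "(x1, y1) \<in> C" "(x2, y2) \<in> C"
    unfolding minors_def by blast
  then show "f \<in> minors ((\<lambda>(x, y). (trans_k x, trans_k y)) ` C)"
    unfolding minors_def trans_k.hom_diff trans_k.hom_mult by force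
next
  fix f assume "f \<in> minors ((\<lambda>(x, y). (trans_k x, trans_k y)) ` C)"
  then obtain x1 y1 x2 y2 where "f = trans_k x1 * trans_k y2 - trans_k x2 * trans_k y1"
    "(x1, y1) \<in> C" "(x2, y2) \<in> C"
    unfolding minors_def by auto
  then have "f = trans_k (x1 * y2 - x2 * y1)" "x1 * y2 - x2 * y1 \<in> minors C"
    unfolding minors_def trans_k.hom_diff trans_k.hom_mult by auto
  then show "f \<in> trans_k ` minors C" by (rule image_eqI)
qed

lemma trans_k_cols:
  assumes "S \<subseteq> {1..}"
  shows "(\<lambda>(x, y). (trans_k x, trans_k y)) ` colsP S = colsM S"
    "(\<lambda>(x, y). (trans_k x, trans_k y)) ` colsM S = colsP S"
proof -
  have S: "i \<ge> 1" if "i \<in> S" for i using assms that by auto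
  have *: "(\<lambda>(x, y). (trans_k x, trans_k y)) ` {(f i, g i) | i. i \<in> S}
    = {(trans_k (f i), trans_k (g i)) | i. i \<in> S}"
    for f g by auto
  have pair_eq: "{(trans_k (f i), trans_k (g i)) | i. i \<in> S} = {(f' i, g' i) | i. i \<in> S}"
    if "\<And>i. i \<in> S \<Longrightarrow> trans_k (f i) = f' i \<and> trans_k (g i) = g' i" for f g f' g'
    using that by (metis (no_types, lifting))
  show "(\<lambda>(x, y). (trans_k x, trans_k y)) ` colsP S = colsM S"
    unfolding colsP_def colsM_def image_Un *
    by (intro arg_cong2[of _ _ _ _ "(\<union>)"] pair_eq) (use S trans_k_entries in blast)+
  show "(\<lambda>(x, y). (trans_k x, trans_k y)) ` colsM S = colsP S"
    unfolding colsP_def colsM_def image_Un *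
    by (intro arg_cong2[of _ _ _ _ "(\<union>)"] pair_eq) (use S trans_k_entries in blast)+
qed

lemma trans_k_minors:
  assumes "S \<subseteq> {1..}"
  shows "trans_k ` minors (colsP S) = minors (colsM S)" "trans_k ` minors (colsM S) = minors (colsP S)"
  using assms by (simp_all add: trans_k_minors_image trans_k_cols)

lemma colsM_prime:
  assumes "N \<ge> 5" "i \<in> {1..N}" "j \<in> {1..N}" "i \<noteq> j"
  shows "is_prime (idl.span (gens N \<union> minors (colsM {i, j})))"
  using prime_trans_k[OF colsP_prime[OF assms]] assms by (simp add: trans_k_minors)

section \<open>Prime ideals with collinear spinors\<close>

lemma vanish_minors:
  assumes "rhom h" "f \<in> minors C"
    and "\<And>x y. (x, y) \<in> C \<Longrightarrow> \<exists>m. h x = A * m \<and> h y = B * m"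
  shows "h f = 0"
proof -
  interpret rhom h by fact
  obtain x1 y1 x2 y2 where f: "f = x1 * y2 - x2 * y1" "(x1, y1) \<in> C" "(x2, y2) \<in> C"
    using assms(2) unfolding minors_def by blast
  obtain m where m: "h x1 = A * m" "h y1 = B * m" using assms(3) f by blast
  obtain n where n: "h x2 = A * n" "h y2 = B * n" using assms(3) f by blast
  show ?thesis by (simp add: f hom_simps m n algebra_simps)
qed

lemma minors_intro: "(x1, y1) \<in> C \<Longrightarrow> (x2, y2) \<in> C \<Longrightarrow> x1 * y2 - x2 * y1 \<in> minors C"
  unfolding minors_def by blast

text \<open>Parametrises rank one for the infinite matrix (k_1 k_2 ...): rows 0 and 1 are the common
  \<lambda>, and each column of the matrix has its own vertex, so the graph is complete
  bipartite.\<close>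

definition plus_row :: "nat \<Rightarrow> nat" where
  "plus_row v = (v mod 4) div 2"

definition plus_col :: "nat \<Rightarrow> nat" where
  "plus_col v = 2 + (2 * (v div 4) + v mod 2)"

lemma plus_row_col_at:
  assumes "x < 4"
  shows "plus_row (4 * b + x) = x div 2" "plus_col (4 * b + x) = 2 + (2 * b + x mod 2)"
proof -
  have "(4 * b + x) div 4 = b" "(4 * b + x) mod 4 = x" using assms by simp_all
  moreover have "(4 * b + x) mod 2 = x mod 2" by presburger
  ultimately show "plus_row (4 * b + x) = x div 2" "plus_col (4 * b + x) = 2 + (2 * b + x mod 2)"
    by (simp_all only: plus_row_def plus_col_def)
qed

lemma two_digits: "2 * b + y mod 2 = 2 * b' + y' mod 2 \<Longrightarrow> b = b' \<and> y mod 2 = y' mod 2" for b y b' y' :: nat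
proof -
  have "2 * b + s = 2 * b' + t \<Longrightarrow> s < 2 \<Longrightarrow> t < 2 \<Longrightarrow> b = b' \<and> s = t" for s t :: nat by presburger
  then show "2 * b + y mod 2 = 2 * b' + y' mod 2 \<Longrightarrow> b = b' \<and> y mod 2 = y' mod 2" by simp
qed

lemma mod_4_form: obtains b x where "v = 4 * b + x" "x < (4 :: nat)"
  using mult_div_mod_eq[of 4 v] by (metis mod_less_divisor zero_less_numeral)

lemma plus_column:
  assumes "plus_row v = 0" "plus_row w = 1" "plus_col v = plus_col w"
  shows "(Var v, Var w) \<in> colsP {1..}"
proof -
  obtain b x where v: "v = 4 * b + x" "x < 4" by (rule mod_4_form)
  obtain b' x' where w: "w = 4 * b' + x'" "x' < 4" by (rule mod_4_form)
  have "x div 2 = 0" "x' div 2 = 1" "2 * b + x mod 2 = 2 * b' + x' mod 2"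
    using assms v w by (simp_all add: plus_row_col_at)
  moreover from this have "b' = b" "x mod 2 = x' mod 2" using two_digits by metis+
  ultimately have "x < 2" "x' = x + 2" "b' = b"
    using mult_div_mod_eq[of 2 x] mult_div_mod_eq[of 2 x'] by simp_all
  then show ?thesis
    unfolding colsP_iff v w by (intro bexI[of _ "b + 1"])
      (auto simp: va_def vb_def vc_def vd_def less_2_cases_iff numeral_3_eq_3)
qed

interpretation plus: toric plus_row plus_col "minors (colsP {1..})" "\<lambda>_. 0"
proof
  have row: "plus_row v = 0 \<or> plus_row v = 1" for v
  proof -
    have "plus_row v < 2" by (simp add: plus_row_def less_mult_imp_div_less)
    then show ?thesis by linarith
  qed
  show "plus_row v \<noteq> plus_col w" for v w
    using row[of v] by (auto simp: plus_col_def)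
  show inj: "v = w" if "plus_row v = plus_row w" "plus_col v = plus_col w" for v w
  proof -
    obtain b x where v: "v = 4 * b + x" "x < 4" by (rule mod_4_form)
    obtain b' x' where w: "w = 4 * b' + x'" "x' < 4" by (rule mod_4_form)
    have "x div 2 = x' div 2" "2 * b + x mod 2 = 2 * b' + x' mod 2"
      using that v w by (simp_all add: plus_row_col_at)
    then have "b = b'" "x mod 2 = x' mod 2" using two_digits by blast+
    moreover have "x = x'"
      using \<open>x div 2 = x' div 2\<close> \<open>x mod 2 = x' mod 2\<close> by (metis mult_div_mod_eq)
    ultimately show ?thesis using v w by simp
  qed
  show "\<exists>w. plus_row w = plus_row u \<and> plus_col w = plus_col v" for u v
  proof -
    obtain b x where v: "v = 4 * b + x" "x < 4" by (rule mod_4_form)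
    obtain b' x' where u: "u = 4 * b' + x'" "x' < 4" by (rule mod_4_form)
    have "x' div 2 < 2" "x mod 2 < 2" using u(2) by (simp_all add: less_mult_imp_div_less)
    then have "2 * (x' div 2) + x mod 2 < 4" by linarith
    moreover have "(2 * (x' div 2) + x mod 2) div 2 = x' div 2" "(2 * (x' div 2) + x mod 2) mod 2 = x mod 2"
      by simp_all
    ultimately show ?thesis
      by (intro exI[of _ "4 * b + (2 * (x' div 2) + x mod 2)"])
        (simp add: plus_row_col_at u v del: One_nat_def)
  qed
  fix v' v u w
  assume 1: "plus_row v' = plus_row v" "plus_col v' = plus_col u"
    "plus_row w = plus_row u" "plus_col w = plus_col v"
  consider "plus_row v = plus_row u" | "plus_row v = 0" "plus_row u = 1" | "plus_row v = 1" "plus_row u = 0"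
    using row[of v] row[of u] by metis
  then show "Var v * Var u - Var v' * Var w \<in> idl.span (minors (colsP {1..}))"
  proof cases
    case 1
    then have "v' = u" "w = v" using inj \<open>plus_row v' = _\<close> \<open>plus_col v' = _\<close> \<open>plus_row w = _\<close> \<open>plus_col w = _\<close>
      by metis+
    then show ?thesis by (simp add: mult.commute idl.span_zero)
  next
    case 2
    then show ?thesis using minors_intro[OF plus_column[of v w] plus_column[of v' u]] 1
      by (simp add: idl.span_base)
  next
    case 3
    have "Var u * Var v - Var w * Var v' \<in> minors (colsP {1..})"
      using minors_intro[OF plus_column[of u v'] plus_column[of w v]] 1 3 by simp
    then show ?thesis by (simp add: idl.span_base mult.commute)
  qed
qed

lemma dets_subset_minors: "dets \<subseteq> minors (colsP {1..})"
proof
  fix g assume "g \<in> dets"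
  then obtain i where i: "i \<ge> 1" "g = va i * vd i - vb i * vc i" by (auto simp: dets_def QJ_def)
  have "(va i, vc i) \<in> colsP {1..}" "(vb i, vd i) \<in> colsP {1..}" using i(1) unfolding colsP_iff by auto
  from minors_intro[OF this] show "g \<in> minors (colsP {1..})" by (simp add: i(2))
qed

lemma plus_psi_entries:
  assumes "i \<ge> 1"
  shows "plus.psi (va i) = Var 0 * Var (2 + 2 * (i - 1))" "plus.psi (vb i) = Var 0 * Var (3 + 2 * (i - 1))"
    "plus.psi (vc i) = Var 1 * Var (2 + 2 * (i - 1))" "plus.psi (vd i) = Var 1 * Var (3 + 2 * (i - 1))"
proof -
  have "plus_row (4 * b + 0) = 0" "plus_row (4 * b + 1) = 0" "plus_row (4 * b + 2) = 1"
    "plus_row (4 * b + 3) = 1"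
    "plus_col (4 * b + 0) = 2 + 2 * b" "plus_col (4 * b + 1) = 3 + 2 * b" "plus_col (4 * b + 2) = 2 + 2 * b"
    "plus_col (4 * b + 3) = 3 + 2 * b" for b
    by (subst plus_row_col_at; simp)+
  then show "plus.psi (va i) = Var 0 * Var (2 + 2 * (i - 1))" "plus.psi (vb i)
    = Var 0 * Var (3 + 2 * (i - 1))"
    "plus.psi (vc i) = Var 1 * Var (2 + 2 * (i - 1))" "plus.psi (vd i) = Var 1 * Var (3 + 2 * (i - 1))"
    unfolding va_def vb_def vc_def vd_def subst_Var by (metis add_0_right)+
qed

text \<open>Eliminating a momentum respects collinearity, since a sum of multiples of one column is
  again such a multiple. Hence no equation is left over and the ideal is the kernel of a
  homomorphism into a domain.\<close>

lemma all_plus_prime: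
  assumes N: "N \<ge> 1"
  shows "is_prime (idl.span (gens N \<union> minors (colsP {1..})))"
proof -
  define h where "h = (\<lambda>p. plus.psi (elim N N p))"
  interpret h: rhom h
    unfolding h_def by (intro rhom_comp[of plus.psi "elim N N"] subst.rhom_axioms elim.rhom_axioms)
  have e: "N \<in> {1..N}" using N by simp
  have van: "h f = 0" if f: "f \<in> minors (colsP {1..})" for f
    using h.rhom_axioms f
  proof (rule vanish_minors)
    fix x y assume "(x, y) \<in> colsP {1..}"
    then obtain i where i: "i \<ge> 1" "x = va i \<and> y = vc i \<or> x = vb i \<and> y = vd i"
      unfolding colsP_iff by auto
    have s: "plus.psi (\<Sum>i\<in>{1..N} - {N}. va i) = Var 0 * (\<Sum>i\<in>{1..N} - {N}. Var (2 + 2 * (i - 1)))"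
      "plus.psi (\<Sum>i\<in>{1..N} - {N}. vb i) = Var 0 * (\<Sum>i\<in>{1..N} - {N}. Var (3 + 2 * (i - 1)))"
      "plus.psi (\<Sum>i\<in>{1..N} - {N}. vc i) = Var 1 * (\<Sum>i\<in>{1..N} - {N}. Var (2 + 2 * (i - 1)))"
      "plus.psi (\<Sum>i\<in>{1..N} - {N}. vd i) = Var 1 * (\<Sum>i\<in>{1..N} - {N}. Var (3 + 2 * (i - 1)))"
      unfolding subst.hom_sum sum_distrib_left by (intro sum.cong refl plus_psi_entries; simp)+
    show "\<exists>m. h x = Var 0 * m \<and> h y = Var 1 * m"
    proof (cases "i = N")
      case True
      show ?thesis
        using i(2) unfolding True
      proof
        assume "x = va N \<and> y = vc N"
        then show ?thesis using N
          by (intro exI[of _ "- (\<Sum>i\<in>{1..N} - {N}. Var (2 + 2 * (i - 1)))"])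
            (simp only: h_def elim_entries if_True subst.hom_uminus s mult_minus_right simp_thms)
      next
        assume "x = vb N \<and> y = vd N"
        then show ?thesis using N
          by (intro exI[of _ "- (\<Sum>i\<in>{1..N} - {N}. Var (3 + 2 * (i - 1)))"])
            (simp only: h_def elim_entries if_True subst.hom_uminus s mult_minus_right simp_thms)
      qed
    next
      case False
      show ?thesis
        using i(2)
      proof
        assume "x = va i \<and> y = vc i"
        then show ?thesis using i(1) False
          by (intro exI[of _ "Var (2 + 2 * (i - 1))"])
            (simp only: h_def elim_entries if_False plus_psi_entries simp_thms)
      next
        assume "x = vb i \<and> y = vd i"
        then show ?thesis using i(1) False
          by (intro exI[of _ "Var (3 + 2 * (i - 1))"])
            (simp only: h_def elim_entries if_False plus_psi_entries simp_thms)
      qed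
    qed
  qed
  have "p \<in> idl.span (gens N \<union> minors (colsP {1..})) \<longleftrightarrow> h p = 0" for p
  proof
    assume "p \<in> idl.span (gens N \<union> minors (colsP {1..}))"
    then show "h p = 0"
    proof (rule h.span_vanish)
      fix g assume "g \<in> gens N \<union> minors (colsP {1..})"
      then consider "g \<in> msums N" | "g \<in> minors (colsP {1..})"
        using dets_subset_minors unfolding gens_def by blast
      then show "h g = 0"
        using van e by cases (simp_all add: h_def elim_msums subst.hom_zero)
    qed
  next
    assume "h p = 0"
    then have "elim N N p \<in> idl.span (minors (colsP {1..}))" unfolding h_def by (rule plus.kernel)
    then have "elim N N p \<in> idl.span (gens N \<union> minors (colsP {1..}))"
      using idl.span_mono[of "minors (colsP {1..})"] by blast
    moreover have "p - elim N N p \<in> idl.span (gens N \<union> minors (colsP {1..}))"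
      using elim_mod[OF e, of p] idl.span_mono[of "msums N" "gens N \<union> minors (colsP {1..})"]
      by (auto simp: gens_def)
    ultimately show "p \<in> idl.span (gens N \<union> minors (colsP {1..}))" using idl_span_diff_cong by blast
  qed
  then have "idl.span (gens N \<union> minors (colsP {1..})) = h -` {0}" by auto
  then show ?thesis using h.is_prime_vimage[OF is_prime_zero] by simp
qed

text \<open>Blocks 1, 2, 3 carry the matrices \<open>\<lambda> \<nu>\<^sup>T\<close>, \<open>\<lambda> \<mu>\<^sup>T\<close>, \<open>\<rho> \<mu>\<^sup>T\<close>; rows 0 and 1 are \<open>\<lambda>\<close>, rows 2 and 3
  are \<open>\<rho>\<close>, columns 4 and 5 are \<open>\<nu>\<close>, columns 6 and 7 are \<open>\<mu>\<close>.  Other variables are isolated edges.\<close>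
definition mix_row :: "nat \<Rightarrow> nat" where
  "mix_row v = (if v < 12 then [0, 0, 1, 1, 0, 0, 1, 1, 2, 2, 3, 3] ! v else 2 * v)"

definition mix_col :: "nat \<Rightarrow> nat" where
  "mix_col v = (if v < 12 then [4, 5, 4, 5, 6, 7, 6, 7, 6, 7, 6, 7] ! v else 2 * v + 1)"

lemma less_12_cases: "v < 12 \<longleftrightarrow> v \<in> {0, 1, 2, 3, 4, 5, 6, 7, 8, 9, 10, 11}" for v :: nat
  by (auto simp: less_Suc_eq numeral_eq_Suc)

lemma mix_values:
  "mix_row 0 = 0" "mix_row 1 = 0" "mix_row 2 = 1" "mix_row 3 = 1" "mix_row 4 = 0" "mix_row 5 = 0"
  "mix_row 6 = 1" "mix_row 7 = 1" "mix_row 8 = 2" "mix_row 9 = 2" "mix_row 10 = 3" "mix_row 11 = 3"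
  "mix_col 0 = 4" "mix_col 1 = 5" "mix_col 2 = 4" "mix_col 3 = 5" "mix_col 4 = 6" "mix_col 5 = 7"
  "mix_col 6 = 6" "mix_col 7 = 7" "mix_col 8 = 6" "mix_col 9 = 7" "mix_col 10 = 6" "mix_col 11 = 7"
  by (simp_all add: mix_row_def mix_col_def numeral_2_eq_2[symmetric])

lemma mix_range:
  assumes "v < 12"
  shows "mix_row v < 4" "4 \<le> mix_col v" "mix_col v < 8" "mix_col v < 6 \<Longrightarrow> mix_row v < 2"
  using assms unfolding less_12_cases by (elim insertE emptyE; simp only: mix_values; simp)+

lemma mix_large:
  assumes "\<not> v < 12"
  shows "mix_row v = 2 * v" "mix_col v = 2 * v + 1"
  using assms by (simp_all add: mix_row_def mix_col_def)

lemma mix_index: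
  assumes "v < 12"
  shows "v = (if mix_col v < 6 then 2 * mix_row v + mix_col v - 4 else 2 * mix_row v + mix_col v - 2)"
  using assms unfolding less_12_cases by (elim insertE emptyE) (simp_all only: mix_values, simp_all)

lemma mix_inj:
  assumes "mix_row v = mix_row w" "mix_col v = mix_col w"
  shows "v = w"
proof (cases "v < 12")
  case True
  have "w < 12"
    using mix_range(1)[OF True] assms(1) mix_large(1)[of w] by force
  then show ?thesis using mix_index[OF True] mix_index[of w] unfolding assms by metis
next
  case False
  have "\<not> w < 12"
    using mix_range(1)[of w] assms(1) mix_large(1)[OF False] False by force
  then show ?thesis using assms(1) mix_large(1)[OF False] mix_large(1)[of w] by simp
qed

lemma mix_exists:
  assumes "x < 4" "4 \<le> y" "y < 8" "y < 6 \<Longrightarrow> x < 2"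
  shows "\<exists>w. mix_row w = x \<and> mix_col w = y"
proof -
  have "x = 0 \<or> x = 1 \<or> x = 2 \<or> x = 3" "y = 4 \<or> y = 5 \<or> y = 6 \<or> y = 7"
    using assms(1-3) by linarith+
  moreover have "\<not> ((x = 2 \<or> x = 3) \<and> (y = 4 \<or> y = 5))" using assms(4) by auto
  ultimately consider "x = 0" "y = 4" | "x = 0" "y = 5" | "x = 1" "y = 4" | "x = 1" "y = 5" | "x = 0" "y = 6"
    | "x = 0" "y = 7" | "x = 1" "y = 6" | "x = 1" "y = 7" | "x = 2" "y = 6" | "x = 2" "y = 7"
    | "x = 3" "y = 6" | "x = 3" "y = 7" by argo
  then have "\<exists>w\<in>{0, 1, 2, 3, 4, 5, 6, 7, 8, 9, 10, 11}. mix_row w = x \<and> mix_col w = y"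
    by cases (simp_all only: bex_simps mix_values, simp_all)
  then show ?thesis by blast
qed

lemma mix_col_Vars:
  assumes "mix_row a = 0" "mix_row b = 1" "mix_col a = mix_col b"
  shows "(Var a, Var b) \<in> colsP {1, 2}"
proof -
  have "a < 12" "b < 12" using mix_large(1)[of a] mix_large(1)[of b] assms by force+
  then have "(a, b) \<in> {(0, 2), (1, 3), (4, 6), (5, 7)}"
    using assms unfolding less_12_cases by (elim insertE emptyE) (simp_all only: mix_values, simp_all)
  then show ?thesis
    unfolding colsP_iff by (auto simp: va_def vb_def vc_def vd_def numeral_2_eq_2[symmetric])
qed

lemma mix_row_Vars:
  assumes "mix_col a = 6" "mix_col b = 7" "mix_row a = mix_row b"
  shows "(Var a, Var b) \<in> colsM {2, 3}"
proof -
  have "a < 12" "b < 12" using mix_large(2)[of a] mix_large(2)[of b] assms by force+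
  then have "(a, b) \<in> {(4, 5), (6, 7), (8, 9), (10, 11)}"
    using assms unfolding less_12_cases by (elim insertE emptyE) (simp_all only: mix_values, simp_all)
  then show ?thesis
    unfolding colsM_iff by (auto simp: va_def vb_def vc_def vd_def numeral_2_eq_2[symmetric])
qed

definition mix_gens :: "mpoly set" where
  "mix_gens = minors (colsP {1, 2}) \<union> minors (colsM {2, 3})"

text \<open>Among the twelve matrix entries the missing edges join rows 2, 3 to columns 4, 5. If
  \<open>v\<close> has column 4 or 5 then its row has rank 1, so \<open>u\<close> cannot lie in row
  2 or 3 and the fourth corner exists. Columns 6 and 7 meet all four rows.\<close>

interpretation mix: toric mix_row mix_col mix_gens "\<lambda>x. if x = 2 \<or> x = 3 then 0 else 1"
proof
  show "mix_row v \<noteq> mix_col w" for v w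
  proof (cases "v < 12")
    case True
    then show ?thesis using mix_range(1)[OF True] mix_range(2)[of w] mix_large(2)[of w]
      by (cases "w < 12") auto
  next
    case False
    then show ?thesis using mix_large(1)[OF False] mix_range(3)[of w] mix_large(2)[of w]
      by (cases "w < 12") (auto, presburger)
  qed
  show "mix_row v = mix_row w \<Longrightarrow> mix_col v = mix_col w \<Longrightarrow> v = w" for v w by (rule mix_inj)
  fix v v' u
  assume 1: "mix_row v' = mix_row v" "mix_col v' = mix_col u"
  have large: "v' = v \<and> u = v" if "\<not> v < 12 \<or> \<not> u < 12"
  proof (cases "v < 12")
    case False
    then have "v' = v" using 1(1) mix_large(1)[OF False] mix_large(1)[of v'] mix_range(1)[of v']
      by (cases "v' < 12") auto
    moreover have "u = v"
      using 1(2) \<open>v' = v\<close> mix_large(2)[OF False] mix_large(2)[of u] mix_range(3)[of u] False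
      by (cases "u < 12") auto
    ultimately show ?thesis by simp
  next
    case True
    then have u: "\<not> u < 12" using that by simp
    then have "v' = u" using 1(2) mix_large(2)[OF u] mix_large(2)[of v'] mix_range(3)[of v']
      by (cases "v' < 12") auto
    then show ?thesis using 1(1) mix_range(1)[OF True] mix_large(1)[OF u] u by simp
  qed
  show "\<exists>w. mix_row w = mix_row u \<and> mix_col w = mix_col v"
    if rk: "(if mix_row v = 2 \<or> mix_row v = 3 then 0 else 1 :: nat) \<le> (if mix_row u = 2 \<or> mix_row u = 3
      then 0 else 1)"
  proof (cases "v < 12 \<and> u < 12")
    case False
    then show ?thesis using large by blast
  next
    case True
    have "mix_row u < 2" if "mix_col v < 6"
      using rk mix_range(4)[of v] mix_range(1)[of u] True that by (auto split: if_splits)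
    then show ?thesis using True mix_range[of u] mix_range[of v] by (intro mix_exists) auto
  qed
  fix w
  assume 2: "mix_row w = mix_row u" "mix_col w = mix_col v"
  show "Var v * Var u - Var v' * Var w \<in> idl.span mix_gens"
  proof (cases "(\<not> v < 12 \<or> \<not> u < 12) \<or> mix_row v = mix_row u \<or> mix_col v = mix_col u")
    case True
    then have "(v' = v \<and> w = u) \<or> (v' = u \<and> w = v)"
      using large 1 2 mix_inj by metis
    then show ?thesis by (auto simp: idl.span_zero mult.commute)
  next
    case False
    then have small: "v < 12" "u < 12" by auto
    have small': "v' < 12" "w < 12"
      using 1 2 small mix_range(1)[of v] mix_range(1)[of u] mix_large(1)[of v'] mix_large(1)[of w]
      by (cases "v' < 12"; cases "w < 12"; simp)+
    show ?thesis
    proof (cases "mix_col v < 6 \<or> mix_col u < 6")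
      case True
      then have "mix_row v < 2" "mix_row u < 2"
        using mix_range(4)[OF small(1)] mix_range(4)[OF small(2)] mix_range(4)[OF small'(1)]
          mix_range(4)[OF small'(2)] 1 2 by auto
      then consider "mix_row v = 0" "mix_row u = 1" | "mix_row v = 1" "mix_row u = 0"
        using False by linarith
      then have "Var v * Var u - Var v' * Var w \<in> minors (colsP {1, 2})"
      proof cases
        case 1
        then show ?thesis
          using minors_intro[OF mix_col_Vars[of v w] mix_col_Vars[of v' u]] \<open>mix_row v' = _\<close> \<open>mix_col v'
            = _\<close> 2
          by simp
      next
        case 2
        then have "Var u * Var v - Var w * Var v' \<in> minors (colsP {1, 2})"
          using minors_intro[OF mix_col_Vars[of u v'] mix_col_Vars[of w v]] 1 \<open>mix_row w = _\<close> \<open>mix_col w = _\<close>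
          by simp
        then show ?thesis by (simp add: mult.commute)
      qed
      then show ?thesis by (intro idl.span_base) (simp add: mix_gens_def)
    next
      case col: False
      then consider "mix_col v = 6" "mix_col u = 7" | "mix_col v = 7" "mix_col u = 6"
        using False mix_range(3)[OF small(1)] mix_range(3)[OF small(2)] by linarith
      then have "Var v * Var u - Var v' * Var w \<in> minors (colsM {2, 3})"
      proof cases
        case 1
        then have "Var v * Var u - Var w * Var v' \<in> minors (colsM {2, 3})"
          using minors_intro[OF mix_row_Vars[of v v'] mix_row_Vars[of w u]] \<open>mix_row v' = _\<close> \<open>mix_col v'
            = _\<close> 2
          by simp
        then show ?thesis by (simp add: mult.commute)
      next
        case 2
        then have "Var u * Var v - Var v' * Var w \<in> minors (colsM {2, 3})"
          using minors_intro[OF mix_row_Vars[of u w] mix_row_Vars[of v' v]] 1 \<open>mix_row w = _\<close> \<open>mix_col w = _\<close>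
          by simp
        then show ?thesis by (simp add: mult.commute)
      qed
      then show ?thesis by (intro idl.span_base) (simp add: mix_gens_def)
    qed
  qed
qed

text \<open>Minors are bilinear in their columns. This handles columns of K = k_i + k_j; the
  adjoined zero column covers single columns, and the factor \<open>s\<close> admits the sign in K =
  - (k_k + k_l).\<close>

lemma minors_of_sums_in_span:
  fixes X :: "mpoly set"
  assumes C: "minors C \<subseteq> idl.span X"
    and col: "\<And>x y. (x, y) \<in> D \<Longrightarrow> \<exists>u w u' w' s. (u, w) \<in> insert (0, 0) C \<and> (u', w') \<in> insert (0, 0) C
       \<and> x - s * (u + u') \<in> idl.span X \<and> y - s * (w + w') \<in> idl.span X"
    and f: "f \<in> minors D"
  shows "f \<in> idl.span X"
proof -
  obtain x1 y1 x2 y2 where f: "f = x1 * y2 - x2 * y1" "(x1, y1) \<in> D" "(x2, y2) \<in> D"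
    using f unfolding minors_def by blast
  obtain u1 w1 u1' w1' s1 where 1: "(u1, w1) \<in> insert (0, 0) C" "(u1', w1') \<in> insert (0, 0) C"
    "x1 - s1 * (u1 + u1') \<in> idl.span X" "y1 - s1 * (w1 + w1') \<in> idl.span X"
    using col[OF f(2)] by blast
  obtain u2 w2 u2' w2' s2 where 2: "(u2, w2) \<in> insert (0, 0) C" "(u2', w2') \<in> insert (0, 0) C"
    "x2 - s2 * (u2 + u2') \<in> idl.span X" "y2 - s2 * (w2 + w2') \<in> idl.span X"
    using col[OF f(3)] by blast
  have m: "u * w' - u' * w \<in> idl.span X" if "(u, w) \<in> insert (0, 0) C" "(u', w') \<in> insert (0, 0) C"
    for u w u' w'
    using that C minors_intro[of u w C u' w'] idl.span_zero[of X] by auto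
  have "f = y2 * (x1 - s1 * (u1 + u1')) + (s1 * (u1 + u1')) * (y2 - s2 * (w2 + w2'))
     - y1 * (x2 - s2 * (u2 + u2')) - (s2 * (u2 + u2')) * (y1 - s1 * (w1 + w1'))
     + (s1 * s2) * ((u1 * w2 - u2 * w1) + (u1 * w2' - u2' * w1) + (u1' * w2 - u2 * w1') + (u1' * w2' - u2' *
       w1'))"
    unfolding f(1) by (simp add: algebra_simps)
  then show ?thesis
    by (simp only:) (intro idl.span_add idl.span_diff idl.span_scale 1(3,4) 2(3,4) m 1(1,2) 2(1,2))
qed

lemma mix_psi_entries:
  "mix.psi (va 1) = Var 0 * Var 4" "mix.psi (vb 1) = Var 0 * Var 5"
  "mix.psi (vc 1) = Var 1 * Var 4" "mix.psi (vd 1) = Var 1 * Var 5"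
  "mix.psi (va 2) = Var 0 * Var 6" "mix.psi (vb 2) = Var 0 * Var 7"
  "mix.psi (vc 2) = Var 1 * Var 6" "mix.psi (vd 2) = Var 1 * Var 7"
  "mix.psi (va 3) = Var 2 * Var 6" "mix.psi (vb 3) = Var 2 * Var 7"
  "mix.psi (vc 3) = Var 3 * Var 6" "mix.psi (vd 3) = Var 3 * Var 7"
proof -
  have e: "va 1 = Var 0" "vb 1 = Var 1" "vc 1 = Var 2" "vd 1 = Var 3" "va 2 = Var 4" "vb 2 = Var 5"
    "vc 2 = Var 6" "vd 2 = Var 7" "va 3 = Var 8" "vb 3 = Var 9" "vc 3 = Var 10" "vd 3 = Var 11"
    by (simp_all add: va_def vb_def vc_def vd_def numeral_2_eq_2[symmetric])
  show "mix.psi (va 1) = Var 0 * Var 4" "mix.psi (vb 1) = Var 0 * Var 5"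
    "mix.psi (vc 1) = Var 1 * Var 4" "mix.psi (vd 1) = Var 1 * Var 5"
    "mix.psi (va 2) = Var 0 * Var 6" "mix.psi (vb 2) = Var 0 * Var 7"
    "mix.psi (vc 2) = Var 1 * Var 6" "mix.psi (vd 2) = Var 1 * Var 7"
    "mix.psi (va 3) = Var 2 * Var 6" "mix.psi (vb 3) = Var 2 * Var 7"
    "mix.psi (vc 3) = Var 3 * Var 6" "mix.psi (vd 3) = Var 3 * Var 7"
    by (simp_all only: e subst_Var mix_values)
qed

text \<open>Entries of momenta beyond the fourth. Adjoining them makes the mixed ideal the full
  kernel of a map that sends them to 0; \<open>retract 4\<close> removes them again.\<close>

definition outer_vars :: "mpoly set" where
  "outer_vars = {f m | f m. f \<in> {va, vb, vc, vd} \<and> m \<ge> 5}"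

lemma det_in_minors: "i \<in> S \<Longrightarrow> QJ {i} \<in> minors (colsP S)" "i \<in> S \<Longrightarrow> QJ {i} \<in> minors (colsM S)"
proof -
  assume "i \<in> S"
  then have P: "(va i, vc i) \<in> colsP S" "(vb i, vd i) \<in> colsP S"
    and M: "(va i, vb i) \<in> colsM S" "(vc i, vd i) \<in> colsM S"
    unfolding colsP_iff colsM_iff by blast+
  show "QJ {i} \<in> minors (colsP S)" using minors_intro[OF P] by (simp add: QJ_def)
  show "QJ {i} \<in> minors (colsM S)" using minors_intro[OF M] by (simp add: QJ_def mult.commute)
qed

text \<open>With \<open>K = k\<^sub>i + k\<^sub>j = - k\<^sub>k - k\<^sub>l\<close> the generators say that \<open>(k\<^sub>i K)\<close>
  and \<open>(K\<^sup>T k\<^sub>k\<^sup>T)\<close> have rank one; \<open>\<sigma>\<close> and \<open>\<tau>\<close>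
  pass to the coordinates \<open>k\<^sub>i, K, k\<^sub>k\<close> and back.\<close>
lemma mixed_prime:
  assumes ijkl: "{i, j, k, l} = {1..4}" "distinct [i, j, k, l]"
  shows "is_prime (idl.span (gens 4 \<union> (minors (colsP {i, j}) \<union> minors (colsM {k, l}) \<union> outer_vars)))"
proof -
  define F where "F = minors (colsP {i, j}) \<union> minors (colsM {k, l}) \<union> outer_vars"
  define X where "X = gens 4 \<union> F"
  define sg :: "(nat \<Rightarrow> mpoly) \<Rightarrow> nat \<Rightarrow> mpoly" where
    "sg = (\<lambda>f m. if m = i then f 1 else if m = j then f 2 - f 1 else if m = k then f 3
       else if m = l then - f 2 - f 3 else 0)"
  define tg :: "(nat \<Rightarrow> mpoly) \<Rightarrow> nat \<Rightarrow> mpoly" where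
    "tg = (\<lambda>f m. if m = 1 then f i else if m = 2 then f i + f j else if m = 3 then f k else 0)"
  define \<sigma> where "\<sigma> = subst (blk (sg va) (sg vb) (sg vc) (sg vd))"
  define \<tau> where "\<tau> = subst (blk (tg va) (tg vb) (tg vc) (tg vd))"
  define h where "h = (\<lambda>p. mix.psi (\<sigma> p))"
  interpret \<sigma>: rhom \<sigma> unfolding \<sigma>_def by (rule subst.rhom_axioms)
  interpret \<tau>: rhom \<tau> unfolding \<tau>_def by (rule subst.rhom_axioms)
  interpret h: rhom h unfolding h_def by (intro rhom_comp[of mix.psi \<sigma>] subst.rhom_axioms \<sigma>.rhom_axioms)
  have "i \<in> {1..4}" "j \<in> {1..4}" "k \<in> {1..4}" "l \<in> {1..4}" using ijkl(1) by blast+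
  then have ge1: "i \<ge> 1" "j \<ge> 1" "k \<ge> 1" "l \<ge> 1" and le4: "i < 5" "j < 5" "k < 5" "l < 5" by simp_all
  have cases4: "m = i \<or> m = j \<or> m = k \<or> m = l \<or> m \<ge> 5" if "m \<ge> 1" for m
  proof (rule ccontr)
    assume *: "\<not> ?thesis"
    then have "m \<in> {1..4}" using that by auto
    then show False using * unfolding ijkl(1)[symmetric] by blast
  qed
  have sum4: "(\<Sum>m\<in>{1..4}. f m) = f i + f j + f k + f l" for f :: "nat \<Rightarrow> mpoly"
    unfolding ijkl(1)[symmetric] using ijkl(2) by (simp add: add.assoc)
  have \<sigma>f: "\<sigma> (f m) = sg f m" if "f \<in> {va, vb, vc, vd}" "m \<ge> 1" for f m
    using that by (auto simp: \<sigma>_def subst_blk simp del: One_nat_def)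
  have \<tau>f: "\<tau> (f m) = tg f m" if "f \<in> {va, vb, vc, vd}" "m \<ge> 1" for f m
    using that by (auto simp: \<tau>_def subst_blk simp del: One_nat_def)
  have sgv: "sg f i = f 1" "sg f j = f 2 - f 1" "sg f k = f 3" "sg f l = - f 2 - f 3" for f
    using ijkl(2) by (auto simp: sg_def)
  have sg5: "sg f m = 0" if "m \<ge> 5" for f m
    using that le4 by (auto simp: sg_def)
  have hf: "h (f i) = mix.psi (f 1)" "h (f j) = mix.psi (f 2) - mix.psi (f 1)" "h (f k) = mix.psi (f 3)"
    "h (f l) = - mix.psi (f 2) - mix.psi (f 3)" if "f \<in> {va, vb, vc, vd}" for f
    using ge1 by (simp_all only: h_def \<sigma>f[OF that] sgv subst.hom_diff subst.hom_uminus)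
  note hfs = hf[of va, simplified insert_iff simp_thms, unfolded mix_psi_entries]
    hf[of vb, simplified insert_iff simp_thms, unfolded mix_psi_entries]
    hf[of vc, simplified insert_iff simp_thms, unfolded mix_psi_entries]
    hf[of vd, simplified insert_iff simp_thms, unfolded mix_psi_entries]
  have hP: "\<exists>m. h x = Var 0 * m \<and> h y = Var 1 * m" if xy: "(x, y) \<in> colsP {i, j}" for x y
  proof -
    have "(x = va i \<and> y = vc i \<or> x = vb i \<and> y = vd i) \<or> (x = va j \<and> y = vc j \<or> x = vb j \<and> y = vd j)"
      using xy unfolding colsP_iff by blast
    then show ?thesis
    proof (elim disjE conjE)
      assume "x = va i" "y = vc i" then show ?thesis
        using ge1 by (intro exI[of _ "Var 4"]) (simp add: hfs algebra_simps)
    next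
      assume "x = vb i" "y = vd i" then show ?thesis
        using ge1 by (intro exI[of _ "Var 5"]) (simp add: hfs algebra_simps)
    next
      assume "x = va j" "y = vc j" then show ?thesis using ge1
        by (intro exI[of _ "Var 6 - Var 4"])
          (simp add: hfs algebra_simps)
    next
      assume "x = vb j" "y = vd j" then show ?thesis using ge1
        by (intro exI[of _ "Var 7 - Var 5"])
          (simp add: hfs algebra_simps)
    qed
  qed
  have hM: "\<exists>m. h x = Var 6 * m \<and> h y = Var 7 * m" if xy: "(x, y) \<in> colsM {k, l}" for x y
  proof -
    have "(x = va k \<and> y = vb k \<or> x = vc k \<and> y = vd k) \<or> (x = va l \<and> y = vb l \<or> x = vc l \<and> y = vd l)"
      using xy unfolding colsM_iff by blast
    then show ?thesis
    proof (elim disjE conjE)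
      assume "x = va k" "y = vb k" then show ?thesis using ge1
        by (intro exI[of _ "Var 2"]) (simp add: hfs algebra_simps)
    next
      assume "x = vc k" "y = vd k" then show ?thesis using ge1
        by (intro exI[of _ "Var 3"]) (simp add: hfs algebra_simps)
    next
      assume "x = va l" "y = vb l" then show ?thesis using ge1
        by (intro exI[of _ "- Var 0 - Var 2"])
          (simp add: hfs algebra_simps)
    next
      assume "x = vc l" "y = vd l" then show ?thesis using ge1
        by (intro exI[of _ "- Var 1 - Var 3"])
          (simp add: hfs algebra_simps)
    qed
  qed
  have van: "h g = 0" if g: "g \<in> X" for g
  proof -
    have P: "h g = 0" if "g \<in> minors (colsP {i, j})" for g
      by (rule vanish_minors[OF h.rhom_axioms that hP])
    have M: "h g = 0" if "g \<in> minors (colsM {k, l})" for g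
      by (rule vanish_minors[OF h.rhom_axioms that hM])
    have O: "h (f m) = 0" if "f \<in> {va, vb, vc, vd}" "m \<ge> 5" for f m
      using that by (simp add: h_def \<sigma>f[OF that(1)] sg5 subst.hom_zero)
    have S: "h (\<Sum>m\<in>{1..4}. f m) = 0" if "f \<in> {va, vb, vc, vd}" for f
    proof -
      have "\<sigma> (\<Sum>m\<in>{1..4}. f m) = 0"
        unfolding sum4 \<sigma>.hom_add using ge1 by (simp add: \<sigma>f[OF that] sgv)
      then show ?thesis by (simp add: h_def subst.hom_zero)
    qed
    have D: "h (QJ {m}) = 0" if m1: "m \<ge> 1" for m
    proof -
      consider "m \<in> {i, j}" | "m \<in> {k, l}" | "m \<ge> 5" using cases4[OF m1] by blast
      then show ?thesis
      proof cases
        case 1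
        then show ?thesis by (intro P det_in_minors)
      next
        case 2
        then show ?thesis by (intro M det_in_minors)
      next
        case 3
        then show ?thesis by (simp add: QJ_def h.hom_simps O)
      qed
    qed
    show ?thesis
      using g unfolding X_def F_def gens_def msums_def dets_def outer_vars_def
      using P M O S D by blast
  qed
  define T where "T = idl.span X"
  have base: "g \<in> T" if "g \<in> X" for g using that by (simp add: T_def idl.span_base)
  have sumT: "f i + f j + f k + f l \<in> T" if "f \<in> {va, vb, vc, vd}" for f
    using that unfolding sum4[symmetric] by (intro base) (auto simp: X_def gens_def msums_def)
  have minP: "minors (colsP {i, j}) \<subseteq> idl.span X"
    using base by (auto simp: T_def X_def F_def)
  have minM: "minors (colsM {k, l}) \<subseteq> idl.span X"
    using base by (auto simp: T_def X_def F_def)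
  have \<tau>v: "\<tau> (f 1) = f i" "\<tau> (f 2) = f i + f j" "\<tau> (f 3) = f k" if "f \<in> {va, vb, vc, vd}" for f
    using that by (simp_all only: \<tau>f[OF that] tg_def) simp_all
  have z: "a - 1 * (a + 0) \<in> idl.span X" "(a + b) - 1 * (a + b) \<in> idl.span X" for a b :: mpoly
    by (simp_all add: idl.span_zero)
  \<comment> \<open>Modulo conservation K is also - (k_k + k_l), so its rows are those of k_k and
    k_l combined with \<open>s = - 1\<close>.\<close>
  have neg: "(a + b) - (- 1) * (c + d) \<in> idl.span X" if "a + b + c + d \<in> T" for a b c d
    using that by (simp add: T_def algebra_simps)
  have \<tau>gens: "\<tau> g \<in> T" if g: "g \<in> mix_gens" for g
  proof -
    let ?D = "\<lambda>C. (\<lambda>(x, y). (\<tau> x, \<tau> y)) ` C"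
    have img: "\<tau> g \<in> minors (?D C)" if gC: "g \<in> minors C" for C
    proof -
      obtain x1 y1 x2 y2 where "g = x1 * y2 - x2 * y1" "(x1, y1) \<in> C" "(x2, y2) \<in> C"
        using gC unfolding minors_def by blast
      then have "\<tau> g = \<tau> x1 * \<tau> y2 - \<tau> x2 * \<tau> y1" "(\<tau> x1, \<tau> y1) \<in> ?D C" "(\<tau> x2, \<tau> y2) \<in> ?D C"
        by (auto simp: \<tau>.hom_simps)
      then show ?thesis using minors_intro by metis
    qed
    from g consider "g \<in> minors (colsP {1, 2})" | "g \<in> minors (colsM {2, 3})"
      unfolding mix_gens_def by blast
    then show ?thesis
    proof cases
      case 1
      have "\<exists>u w u' w' s. (u, w) \<in> insert (0, 0) (colsP {i, j}) \<and> (u', w') \<in> insert (0, 0) (colsP {i, j})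
         \<and> x - s * (u + u') \<in> idl.span X \<and> y - s * (w + w') \<in> idl.span X"
        if xy: "(x, y) \<in> ?D (colsP {1, 2})" for x y
      proof -
        obtain x0 y0 where x0: "(x0, y0) \<in> colsP {1, 2}" "x = \<tau> x0" "y = \<tau> y0" using xy by auto
        obtain f g where fg: "(f, g) \<in> {(va, vc), (vb, vd)}" "x0 = f 1 \<and> y0 = g 1 \<or> x0 = f 2 \<and> y0 = g 2"
          using x0(1) unfolding colsP_iff by blast
        have fg': "f \<in> {va, vb, vc, vd}" "g \<in> {va, vb, vc, vd}" using fg(1) by auto
        have c: "(f i, g i) \<in> insert (0, 0) (colsP {i, j})" "(f j, g j) \<in> insert (0, 0) (colsP {i, j})"
          "(0, 0) \<in> insert (0, 0) (colsP {i, j})"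
          using fg(1) unfolding insert_iff colsP_iff by auto
        from fg(2) show ?thesis
        proof
          assume "x0 = f 1 \<and> y0 = g 1"
          then have "x = f i" "y = g i" using x0 \<tau>v fg' by auto
          then show ?thesis using c(1,3) z(1) by blast
        next
          assume "x0 = f 2 \<and> y0 = g 2"
          then have "x = f i + f j" "y = g i + g j" using x0 \<tau>v fg' by auto
          then show ?thesis using c(1,2) z(2) by blast
        qed
      qed
      then show ?thesis unfolding T_def by (rule minors_of_sums_in_span[OF minP _ img[OF 1]])
    next
      case 2
      have "\<exists>u w u' w' s. (u, w) \<in> insert (0, 0) (colsM {k, l}) \<and> (u', w') \<in> insert (0, 0) (colsM {k, l})
         \<and> x - s * (u + u') \<in> idl.span X \<and> y - s * (w + w') \<in> idl.span X"
        if xy: "(x, y) \<in> ?D (colsM {2, 3})" for x y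
      proof -
        obtain x0 y0 where x0: "(x0, y0) \<in> colsM {2, 3}" "x = \<tau> x0" "y = \<tau> y0" using xy by auto
        obtain f g where fg: "(f, g) \<in> {(va, vb), (vc, vd)}" "x0 = f 2 \<and> y0 = g 2 \<or> x0 = f 3 \<and> y0 = g 3"
          using x0(1) unfolding colsM_iff by blast
        have fg': "f \<in> {va, vb, vc, vd}" "g \<in> {va, vb, vc, vd}" using fg(1) by auto
        have c: "(f k, g k) \<in> insert (0, 0) (colsM {k, l})" "(f l, g l) \<in> insert (0, 0) (colsM {k, l})"
          "(0, 0) \<in> insert (0, 0) (colsM {k, l})"
          using fg(1) unfolding insert_iff colsM_iff by auto
        from fg(2) show ?thesis
        proof
          assume "x0 = f 2 \<and> y0 = g 2"
          then have "x = f i + f j" "y = g i + g j" using x0 \<tau>v fg' by auto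
          then show ?thesis using c(1,2) neg[OF sumT[OF fg'(1)]] neg[OF sumT[OF fg'(2)]] by blast
        next
          assume "x0 = f 3 \<and> y0 = g 3"
          then have "x = f k" "y = g k" using x0 \<tau>v fg' by auto
          then show ?thesis using c(1,3) z(1) by blast
        qed
      qed
      then show ?thesis unfolding T_def by (rule minors_of_sums_in_span[OF minM _ img[OF 2]])
    qed
  qed
  \<comment> \<open>Returning from the new coordinates is the identity modulo \<open>T\<close>.
    Therefore \<open>h p = 0\<close>, which puts \<open>\<sigma> p\<close> into the span of
    \<open>mix_gens\<close>, brings \<open>p\<close> itself into \<open>T\<close>.\<close>
  have roundtrip: "p - \<tau> (\<sigma> p) \<in> T" for p
    unfolding \<tau>_def \<sigma>_def subst_subst T_def
  proof (rule subst_cong_mod)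
    fix v
    have *: "f m - \<tau> (sg f m) \<in> T" if f: "f \<in> {va, vb, vc, vd}" and m: "m \<ge> 1" for f m
    proof -
      from cases4[OF m] show ?thesis
      proof (elim disjE)
        assume "m = i" then show ?thesis by (simp add: sgv \<tau>v(1)[OF f, simplified] T_def idl.span_zero)
      next
        assume "m = j" then show ?thesis
          by (simp add: sgv \<tau>.hom_diff \<tau>v[OF f] \<tau>v(1)[OF f, simplified] T_def idl.span_zero)
      next
        assume "m = k" then show ?thesis by (simp add: sgv \<tau>v(3)[OF f] T_def idl.span_zero)
      next
        assume "m = l" then show ?thesis using sumT[OF f]
          by (simp add: sgv \<tau>.hom_diff \<tau>.hom_uminus \<tau>v[OF f] algebra_simps)
      next
        assume "m \<ge> 5" then show ?thesis using f
          by (simp add: sg5 \<tau>.hom_zero) (intro base, auto simp: X_def F_def outer_vars_def)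
      qed
    qed
    show "Var v - subst (blk (tg va) (tg vb) (tg vc) (tg vd)) (blk (sg va) (sg vb) (sg vc) (sg vd) v) \<in>
      idl.span X"
      unfolding \<tau>_def[symmetric] T_def[symmetric]
      by (rule blk_cases[where P = "\<lambda>x y. x - \<tau> y \<in> T"]) (rule *; simp)+
  qed
  have "p \<in> T \<longleftrightarrow> h p = 0" for p
  proof
    show "h p = 0" if "p \<in> T" using that h.span_vanish[of p X] van unfolding T_def by blast
  next
    assume "h p = 0"
    then have "\<sigma> p \<in> idl.span mix_gens" unfolding h_def by (rule mix.kernel)
    then have "\<tau> (\<sigma> p) \<in> idl.span (\<tau> ` mix_gens)" by (rule \<tau>.span_image_subset)
    then have "\<tau> (\<sigma> p) \<in> T" unfolding T_def by (rule idl_span_trans) (use \<tau>gens T_def in auto)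
    then show "p \<in> T" using roundtrip[of p] idl_span_diff_cong unfolding T_def by blast
  qed
  then have "T = h -` {0}" by auto
  then show ?thesis
    using h.is_prime_vimage[OF is_prime_zero] unfolding T_def X_def F_def by simp
qed

section \<open>Ideals of the ring \<open>R\<^sub>N\<close>\<close>

lemma carrier_polyR: "p \<in> carrier (polyR N) \<longleftrightarrow> vars p \<subseteq> {..<4 * N}"
  by (auto simp: polyR_def vars_def)

lemma polyR_simps [simp]:
  "x \<otimes>\<^bsub>polyR N\<^esub> y = x * y" "\<one>\<^bsub>polyR N\<^esub> = 1" "\<zero>\<^bsub>polyR N\<^esub> = 0" "x \<oplus>\<^bsub>polyR N\<^esub> y = x + y"
  by (simp_all add: polyR_def)

lemma carrier_polyR_closed:
  "0 \<in> carrier (polyR N)" "1 \<in> carrier (polyR N)"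
  "p \<in> carrier (polyR N) \<Longrightarrow> - p \<in> carrier (polyR N)"
  "p \<in> carrier (polyR N) \<Longrightarrow> q \<in> carrier (polyR N) \<Longrightarrow> p + q \<in> carrier (polyR N)"
  "p \<in> carrier (polyR N) \<Longrightarrow> q \<in> carrier (polyR N) \<Longrightarrow> p - q \<in> carrier (polyR N)"
  "p \<in> carrier (polyR N) \<Longrightarrow> q \<in> carrier (polyR N) \<Longrightarrow> p * q \<in> carrier (polyR N)"
  "(\<And>i. i \<in> A \<Longrightarrow> f i \<in> carrier (polyR N)) \<Longrightarrow> sum f A \<in> carrier (polyR N)"
  unfolding carrier_polyR using vars_add[of p q] vars_diff[of p q] vars_mult[of p q] vars_sum[of f A]
  by (simp, simp, simp, blast, blast, blast, blast)

lemma entries_in_carrier: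
  assumes "i \<in> {1..N}"
  shows "va i \<in> carrier (polyR N)" "vb i \<in> carrier (polyR N)" "vc i \<in> carrier (polyR N)"
    "vd i \<in> carrier (polyR N)"
  using assms by (auto simp: carrier_polyR)

lemma cring_polyR: "cring (polyR N)"
proof (rule cringI)
  show "abelian_group (polyR N)"
  proof (rule abelian_groupI)
    fix x assume "x \<in> carrier (polyR N)"
    then show "\<exists>y\<in>carrier (polyR N). y \<oplus>\<^bsub>polyR N\<^esub> x = \<zero>\<^bsub>polyR N\<^esub>"
      by (intro bexI[of _ "- x"]) (simp_all add: carrier_polyR_closed)
  qed (simp_all add: carrier_polyR_closed ac_simps)
  show "comm_monoid (polyR N)"
    by (rule comm_monoidI) (simp_all add: carrier_polyR_closed ac_simps)
qed (simp add: distrib_right)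

interpretation polyR: cring "polyR N" for N
  by (rule cring_polyR)

text \<open>A ring retraction onto the carrier of \<open>polyR N\<close>; it links ideals of the
  whole type with ideals of the carrier.\<close>

definition retract :: "nat \<Rightarrow> mpoly \<Rightarrow> mpoly" where
  "retract N = subst (\<lambda>v. if v < 4 * N then Var v else 0)"

interpretation retract: rhom "retract N"
  unfolding retract_def by (rule subst.rhom_axioms)

lemma retract_carrier: "p \<in> carrier (polyR N) \<Longrightarrow> retract N p = p"
  unfolding retract_def carrier_polyR by (rule subst_vars_ident) auto

lemma retract_in_carrier: "retract N p \<in> carrier (polyR N)"
  unfolding retract_def carrier_polyR by (rule vars_subst) auto

lemma retract_entries:
  assumes "i > N"
  shows "retract N (va i) = 0" "retract N (vb i) = 0" "retract N (vc i) = 0" "retract N (vd i) = 0"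
  using assms by (simp_all add: retract_def va_def vb_def vc_def vd_def)

lemma ideal_span_carrier: "ideal (carrier (polyR N) \<inter> idl.span G) (polyR N)"
proof (rule idealI)
  show "ring (polyR N)" by (rule polyR.ring_axioms)
  show "subgroup (carrier (polyR N) \<inter> idl.span G) (add_monoid (polyR N))"
  proof (rule group.subgroupI)
    show "Group.group (add_monoid (polyR N))" by (rule polyR.a_group)
    show "carrier (polyR N) \<inter> idl.span G \<noteq> {}" using carrier_polyR_closed(1) idl.span_zero by blast
    fix a assume a: "a \<in> carrier (polyR N) \<inter> idl.span G"
    have "inv\<^bsub>add_monoid (polyR N)\<^esub> a = - a"
      using a unfolding a_inv_def[symmetric]
      by (intro polyR.minus_equality) (simp_all add: carrier_polyR_closed)
    then show "inv\<^bsub>add_monoid (polyR N)\<^esub> a \<in> carrier (polyR N) \<inter> idl.span G"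
      using a by (simp add: carrier_polyR_closed idl.span_neg)
  qed (auto simp: carrier_polyR_closed idl.span_add)
qed (auto simp: carrier_polyR_closed idl.span_scale idl_span_mult_right)

text \<open>The cofactors in a representation of \<open>p\<close> may contain surplus variables.
  Retraction fixes \<open>p\<close> and moves them into the carrier.\<close>

lemma span_in_ideal:
  assumes I: "ideal I (polyR N)" and G: "\<And>g. g \<in> G \<Longrightarrow> retract N g \<in> I"
    and p: "p \<in> carrier (polyR N)" "p \<in> idl.span G"
  shows "p \<in> I"
proof -
  interpret ideal I "polyR N" by fact
  have "retract N p \<in> I" using p(2)
  proof (induction rule: idl.span_induct_alt)
    case base
    then show ?case using zero_closed by (simp add: retract.hom_zero)
  next
    case (step c g y)
    have "retract N c * retract N g \<in> I"
      using I_l_closed[OF G[OF step(1)] retract_in_carrier[of N c]] by simp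
    then show ?case using a_closed step(2) by (simp add: retract.hom_simps)
  qed
  then show ?thesis using retract_carrier[OF p(1)] by simp
qed

lemma ideal_props:
  assumes "ideal I (polyR N)"
  shows "I \<subseteq> carrier (polyR N)" "a \<in> I \<Longrightarrow> b \<in> I \<Longrightarrow> a + b \<in> I"
    "a \<in> I \<Longrightarrow> x \<in> carrier (polyR N) \<Longrightarrow> x * a \<in> I" "0 \<in> I"
proof -
  interpret ideal I "polyR N" by fact
  show "I \<subseteq> carrier (polyR N)" by (rule a_subset)
  show "a \<in> I \<Longrightarrow> b \<in> I \<Longrightarrow> a + b \<in> I" using a_closed by simp
  show "a \<in> I \<Longrightarrow> x \<in> carrier (polyR N) \<Longrightarrow> x * a \<in> I" using I_l_closed by simp
  show "0 \<in> I" using zero_closed by simp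
qed

section \<open>Ideals of \<open>polyR N\<close> as traces of ideals of the whole ring\<close>

definition base_gens :: "nat \<Rightarrow> mpoly set" where
  "base_gens N = msums N \<union> {QJ {i} | i. i \<in> {1..N}}"

lemma QJ_in_carrier: "J \<subseteq> {1..N} \<Longrightarrow> QJ J \<in> carrier (polyR N)"
  unfolding QJ_def using entries_in_carrier by (intro carrier_polyR_closed) auto

lemma base_gens_carrier: "base_gens N \<subseteq> carrier (polyR N)"
proof -
  have "msums N \<subseteq> carrier (polyR N)"
    unfolding msums_def insert_subset using entries_in_carrier
    by (intro conjI carrier_polyR_closed(7) empty_subsetI) blast+
  then show ?thesis unfolding base_gens_def using QJ_in_carrier by auto
qed

lemma base_gens_subset: "base_gens N \<subseteq> gens N"
  by (auto simp: base_gens_def gens_def dets_def)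

lemma retract_gens: "g \<in> gens N \<Longrightarrow> retract N g \<in> insert 0 (base_gens N)"
proof -
  assume "g \<in> gens N"
  then consider "g \<in> base_gens N" | i where "g = QJ {i}" "i > N"
    unfolding gens_def dets_def base_gens_def by force
  then show ?thesis
  proof cases
    case 1
    then show ?thesis using retract_carrier base_gens_carrier by (metis insertCI subsetD)
  next
    case 2
    then show ?thesis by (simp add: QJ_def retract.hom_simps retract_entries)
  qed
qed

text \<open>For \<open>F\<close> in the carrier this is the ideal of \<open>polyR N\<close>
  generated by I_N and \<open>F\<close>, written as a trace so that homomorphisms and evaluations
  can test membership. Its image under \<open>cls N\<close> is the ideal of \<open>RN N\<close>
  generated by the classes of \<open>F\<close>.\<close>

definition genI :: "nat \<Rightarrow> mpoly set \<Rightarrow> mpoly set" where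
  "genI N F = carrier (polyR N) \<inter> idl.span (gens N \<union> F)"

lemma IN_eq_Idl: "IN N = Idl\<^bsub>polyR N\<^esub> (base_gens N)"
  by (simp only: IN_def base_gens_def msums_def)

lemma ideal_genI: "ideal (genI N F) (polyR N)"
  unfolding genI_def by (rule ideal_span_carrier)

lemma genI_minimal:
  assumes I: "ideal I (polyR N)" and "base_gens N \<subseteq> I" "F \<subseteq> I"
  shows "genI N F \<subseteq> I"
proof
  fix p assume p: "p \<in> genI N F"
  show "p \<in> I"
  proof (rule span_in_ideal[OF I, of "gens N \<union> F"])
    fix g assume "g \<in> gens N \<union> F"
    then show "retract N g \<in> I"
      using retract_gens[of g N] assms(2,3) ideal_props(4)[OF I] retract_carrier[of g N] ideal_props(1)[OF I]
      by (metis Un_iff insertE subsetD)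
  qed (use p in \<open>auto simp: genI_def\<close>)
qed

lemma base_gens_subset_genI: "base_gens N \<subseteq> genI N F"
  using base_gens_carrier base_gens_subset idl.span_superset[of "gens N \<union> F"] unfolding genI_def by blast

lemma subset_genI: "F \<subseteq> carrier (polyR N) \<Longrightarrow> F \<subseteq> genI N F"
  using idl.span_superset[of "gens N \<union> F"] unfolding genI_def by blast

lemma IN_eq: "IN N = genI N {}"
proof
  show "IN N \<subseteq> genI N {}"
    unfolding IN_eq_Idl by (intro polyR.genideal_minimal ideal_genI base_gens_subset_genI)
  show "genI N {} \<subseteq> IN N"
    unfolding IN_eq_Idl
    by (intro genI_minimal polyR.genideal_ideal polyR.genideal_self base_gens_carrier) auto
qed

lemma ideal_IN: "ideal (IN N) (polyR N)"
  unfolding IN_eq by (rule ideal_genI)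

lemma IN_subset_iff: "ideal I (polyR N) \<Longrightarrow> IN N \<subseteq> I \<longleftrightarrow> base_gens N \<subseteq> I"
  using genI_minimal[of I N "{}"] base_gens_subset_genI[of N "{}"] unfolding IN_eq by blast

section \<open>Passage to the quotient by I_N\<close>

lemma cring_RN: "cring (RN N)"
  unfolding RN_def using ideal.quotient_is_cring[OF ideal_IN cring_polyR] .

lemma carrier_RN: "carrier (RN N) = cls N ` carrier (polyR N)"
  unfolding RN_def cls_def FactRing_def by (auto simp: A_RCOSETS_def')

lemma cls_hom:
  assumes "p \<in> carrier (polyR N)" "q \<in> carrier (polyR N)"
  shows "cls N p \<otimes>\<^bsub>RN N\<^esub> cls N q = cls N (p * q)"
  using ring_hom_mult[OF ideal.rcos_ring_hom[OF ideal_IN] assms] unfolding RN_def cls_def by simp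

lemma cls_image_mem_iff:
  assumes "ideal J (polyR N)" "IN N \<subseteq> J" "p \<in> carrier (polyR N)"
  shows "cls N p \<in> cls N ` J \<longleftrightarrow> p \<in> J"
proof -
  have "J = \<Union> (cls N ` J)" using polyR.ideal_incl_iff[OF ideal_IN assms(1)] assms(2) unfolding cls_def
    by blast
  moreover have "cls N ` J \<subseteq> carrier (polyR N Quot IN N)"
    using ideal_props(1)[OF assms(1)] carrier_RN unfolding RN_def by auto
  ultimately show ?thesis
    using polyR.canonical_proj_vimage_mem_iff[OF ideal_IN _ assms(3)] unfolding cls_def by metis
qed

lemma ideal_cls_image: "ideal J (polyR N) \<Longrightarrow> ideal (cls N ` J) (RN N)"
  using polyR.ring_ideal_imp_quot_ideal[OF ideal_IN] unfolding RN_def cls_def by blast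

lemma ideal_RN_obtain:
  assumes "ideal P (RN N)"
  obtains J where "ideal J (polyR N)" "IN N \<subseteq> J" "P = cls N ` J"
proof -
  have "P \<in> {J. ideal J (polyR N Quot IN N)}" using assms by (simp add: RN_def)
  then have "P \<in> (\<lambda>J. (+>\<^bsub>polyR N\<^esub>) (IN N) ` J) ` {J. ideal J (polyR N) \<and> IN N \<subseteq> J}"
    unfolding bij_betw_imp_surj_on[OF polyR.quot_ideal_correspondence[OF ideal_IN]] .
  then show thesis using that unfolding cls_def by (elim imageE CollectE conjE) simp
qed

lemma Idl_RN:
  assumes "F \<subseteq> carrier (polyR N)"
  shows "Idl\<^bsub>RN N\<^esub> (cls N ` F) = cls N ` genI N F"
proof
  interpret R: cring "RN N" by (rule cring_RN)
  show "Idl\<^bsub>RN N\<^esub> (cls N ` F) \<subseteq> cls N ` genI N F"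
    using subset_genI[OF assms] by (intro R.genideal_minimal ideal_cls_image ideal_genI) auto
  have c: "cls N ` F \<subseteq> carrier (RN N)" using assms carrier_RN by auto
  obtain J where J: "ideal J (polyR N)" "IN N \<subseteq> J" "Idl\<^bsub>RN N\<^esub> (cls N ` F) = cls N ` J"
    using ideal_RN_obtain[OF R.genideal_ideal[OF c]] by blast
  have "F \<subseteq> J"
    using R.genideal_self[OF c] cls_image_mem_iff[OF J(1,2)] assms unfolding J(3) by blast
  moreover have "base_gens N \<subseteq> J" using IN_subset_iff[OF J(1)] J(2) by blast
  ultimately show "cls N ` genI N F \<subseteq> Idl\<^bsub>RN N\<^esub> (cls N ` F)"
    unfolding J(3) using genI_minimal[OF J(1)] by (intro image_mono)
qed

lemma cls_image_inj:
  assumes "ideal J (polyR N)" "IN N \<subseteq> J" "ideal J' (polyR N)" "IN N \<subseteq> J'"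
  shows "cls N ` J \<subseteq> cls N ` J' \<longleftrightarrow> J \<subseteq> J'"
  using cls_image_mem_iff[OF assms(3,4)] ideal_props(1)[OF assms(1)] by blast

lemma primeideal_cls_image:
  assumes "ideal J (polyR N)" "IN N \<subseteq> J"
  shows "primeideal (cls N ` J) (RN N) \<longleftrightarrow> primeideal J (polyR N)"
proof
  assume "primeideal (cls N ` J) (RN N)"
  then interpret P: primeideal "cls N ` J" "RN N" .
  show "primeideal J (polyR N)"
  proof (rule primeidealI[OF assms(1) cring_polyR])
    show "carrier (polyR N) \<noteq> J" using P.I_notcarr carrier_RN by metis
    fix a b assume ab: "a \<in> carrier (polyR N)" "b \<in> carrier (polyR N)" "a \<otimes>\<^bsub>polyR N\<^esub> b \<in> J"
    then have "cls N a \<otimes>\<^bsub>RN N\<^esub> cls N b \<in> cls N ` J" by (simp add: cls_hom)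
    then have "cls N a \<in> cls N ` J \<or> cls N b \<in> cls N ` J"
      using ab carrier_RN by (intro P.I_prime) auto
    then show "a \<in> J \<or> b \<in> J" using cls_image_mem_iff[OF assms] ab by blast
  qed
next
  assume "primeideal J (polyR N)"
  then interpret P: primeideal J "polyR N" .
  show "primeideal (cls N ` J) (RN N)"
  proof (rule primeidealI[OF ideal_cls_image[OF assms(1)] cring_RN])
    show "carrier (RN N) \<noteq> cls N ` J"
    proof
      assume *: "carrier (RN N) = cls N ` J"
      have "p \<in> J" if p: "p \<in> carrier (polyR N)" for p
        using imageI[OF p, of "cls N"] cls_image_mem_iff[OF assms p] unfolding carrier_RN[symmetric] *
          by blast
      then show False using P.I_notcarr P.a_subset by blast
    qed
    fix a b assume ab: "a \<in> carrier (RN N)" "b \<in> carrier (RN N)" "a \<otimes>\<^bsub>RN N\<^esub> b \<in> cls N ` J"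
    obtain p q where pq: "p \<in> carrier (polyR N)" "q \<in> carrier (polyR N)" "a = cls N p" "b = cls N q"
      using ab(1,2) unfolding carrier_RN by blast
    have "p * q \<in> J"
      using ab(3) cls_image_mem_iff[OF assms carrier_polyR_closed(6)[OF pq(1,2)]] by (simp add: pq cls_hom)
    then have "p \<in> J \<or> q \<in> J" using P.I_prime[OF pq(1,2)] by simp
    then show "a \<in> cls N ` J \<or> b \<in> cls N ` J" using pq by blast
  qed
qed

text \<open>\<open>F'\<close> may exceed \<open>F\<close> by elements with surplus variables, such
  as minors with columns beyond \<open>N\<close> or \<open>outer_vars\<close>. They retract to 0 or
  into \<open>F\<close>, so both sets give the same ideal of \<open>polyR N\<close>.\<close>

lemma primeideal_genI:
  assumes "is_prime (idl.span (gens N \<union> F'))" "F \<subseteq> F'"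
    and ret: "\<And>f. f \<in> F' \<Longrightarrow> retract N f \<in> insert 0 F" and F: "F \<subseteq> carrier (polyR N)"
  shows "primeideal (genI N F) (polyR N)"
proof -
  have eq: "genI N F = genI N F'"
  proof
    show "genI N F \<subseteq> genI N F'"
      unfolding genI_def using idl.span_mono[of "gens N \<union> F" "gens N \<union> F'"] assms(2) by blast
    show "genI N F' \<subseteq> genI N F"
    proof
      fix p assume p: "p \<in> genI N F'"
      show "p \<in> genI N F"
      proof (rule span_in_ideal[OF ideal_genI, of "gens N \<union> F'"])
        fix g assume "g \<in> gens N \<union> F'"
        then have "retract N g \<in> insert 0 (base_gens N \<union> F)" using retract_gens ret by blast
        then show "retract N g \<in> genI N F"
          using base_gens_subset_genI[of N F] subset_genI[OF F] ideal_props(4)[OF ideal_genI, of N F] by auto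
      qed (use p in \<open>auto simp: genI_def\<close>)
    qed
  qed
  show ?thesis
  proof (rule primeidealI[OF ideal_genI cring_polyR])
    have "1 \<notin> genI N F" using assms(1) unfolding eq unfolding genI_def is_prime_def by blast
    then show "carrier (polyR N) \<noteq> genI N F" using carrier_polyR_closed(2) by blast
    fix a b assume "a \<in> carrier (polyR N)" "b \<in> carrier (polyR N)" "a \<otimes>\<^bsub>polyR N\<^esub> b \<in> genI N F"
    then show "a \<in> genI N F \<or> b \<in> genI N F"
      using is_primeD[OF assms(1), of a b] unfolding eq unfolding genI_def by auto
  qed
qed

text \<open>A minimal prime contains a listed prime by \<open>cover\<close>, hence equals it.
  Conversely a prime below a listed one contains a listed prime in turn, and
  \<open>incomparable\<close> makes the three coincide.\<close>

lemma minimal_primes: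
  assumes F0: "F0 \<subseteq> carrier (polyR N)" "\<And>s. s \<in> S \<Longrightarrow> F0 \<subseteq> genI N (F s)"
    and F: "\<And>s. s \<in> S \<Longrightarrow> F s \<subseteq> carrier (polyR N)"
    and prime: "\<And>s. s \<in> S \<Longrightarrow> primeideal (genI N (F s)) (polyR N)"
    and incomparable: "\<And>s t. s \<in> S \<Longrightarrow> t \<in> S \<Longrightarrow> F s \<subseteq> genI N (F t) \<Longrightarrow> s = t"
    and cover: "\<And>X. primeideal X (polyR N) \<Longrightarrow> base_gens N \<subseteq> X \<Longrightarrow> F0 \<subseteq> X \<Longrightarrow> \<exists>s\<in>S. F s \<subseteq> X"
  shows "{P. minprime_over (RN N) (Idl\<^bsub>RN N\<^esub> (cls N ` F0)) P} = (\<lambda>s. Idl\<^bsub>RN N\<^esub> (cls N ` F s)) ` S"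
proof -
  have IN_genI: "IN N \<subseteq> genI N G" for G
    using IN_subset_iff[OF ideal_genI] base_gens_subset_genI by blast
  have Idl_F: "Idl\<^bsub>RN N\<^esub> (cls N ` F s) = cls N ` genI N (F s)" if "s \<in> S" for s
    using Idl_RN F that by blast
  have prime_RN: "primeideal (cls N ` genI N (F s)) (RN N)" if "s \<in> S" for s
    using primeideal_cls_image[OF ideal_genI IN_genI] prime that by blast
  have over: "Idl\<^bsub>RN N\<^esub> (cls N ` F0) \<subseteq> cls N ` genI N (F s)" if "s \<in> S" for s
    unfolding Idl_RN[OF F0(1)] using genI_minimal[OF ideal_genI base_gens_subset_genI F0(2)[OF that]] by blast
  have refine: "\<exists>s\<in>S. cls N ` genI N (F s) \<subseteq> P"
    if P: "primeideal P (RN N)" "Idl\<^bsub>RN N\<^esub> (cls N ` F0) \<subseteq> P" for P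
  proof -
    obtain J where J: "ideal J (polyR N)" "IN N \<subseteq> J" "P = cls N ` J"
      using ideal_RN_obtain[OF primeideal.axioms(1)[OF P(1)]] by blast
    have b: "base_gens N \<subseteq> J" using IN_subset_iff[OF J(1)] J(2) by blast
    have "genI N F0 \<subseteq> J"
      using P(2) unfolding J(3) Idl_RN[OF F0(1)] cls_image_inj[OF ideal_genI IN_genI J(1,2)] .
    then have "F0 \<subseteq> J" using subset_genI[OF F0(1)] by blast
    moreover have "primeideal J (polyR N)" using P(1) primeideal_cls_image[OF J(1,2)] unfolding J(3) by blast
    ultimately obtain s where s: "s \<in> S" "F s \<subseteq> J" using cover b by blast
    then have "genI N (F s) \<subseteq> J" using genI_minimal[OF J(1) b] by blast
    then show ?thesis using s(1) unfolding J(3) by blast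
  qed
  show ?thesis
  proof (intro equalityI subsetI)
    fix P assume "P \<in> {P. minprime_over (RN N) (Idl\<^bsub>RN N\<^esub> (cls N ` F0)) P}"
    then have P: "primeideal P (RN N)" "Idl\<^bsub>RN N\<^esub> (cls N ` F0) \<subseteq> P"
      "\<And>P'. primeideal P' (RN N) \<Longrightarrow> Idl\<^bsub>RN N\<^esub> (cls N ` F0) \<subseteq> P' \<Longrightarrow> P' \<subseteq> P \<Longrightarrow> P' = P"
      unfolding minprime_over_def by blast+
    obtain s where s: "s \<in> S" "cls N ` genI N (F s) \<subseteq> P" using refine[OF P(1,2)] by blast
    then show "P \<in> (\<lambda>s. Idl\<^bsub>RN N\<^esub> (cls N ` F s)) ` S"
      using P(3)[OF prime_RN[OF s(1)] over[OF s(1)] s(2)] Idl_F[OF s(1)]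
      by (intro image_eqI[OF _ s(1)]) (simp only:)
  next
    fix P assume "P \<in> (\<lambda>s. Idl\<^bsub>RN N\<^esub> (cls N ` F s)) ` S"
    then obtain s where s: "s \<in> S" "P = Idl\<^bsub>RN N\<^esub> (cls N ` F s)" by (elim imageE)
    note s = s(1) s(2)[unfolded Idl_F[OF s(1)]]
    have "P' = P" if P': "primeideal P' (RN N)" "Idl\<^bsub>RN N\<^esub> (cls N ` F0) \<subseteq> P'" "P' \<subseteq> P" for P'
    proof -
      obtain t where t: "t \<in> S" "cls N ` genI N (F t) \<subseteq> P'" using refine[OF P'(1,2)] by blast
      have "cls N ` genI N (F t) \<subseteq> cls N ` genI N (F s)" using t(2) P'(3) unfolding s(2)
        by (rule subset_trans)
      then have "genI N (F t) \<subseteq> genI N (F s)"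
        unfolding cls_image_inj[OF ideal_genI IN_genI ideal_genI IN_genI] .
      with subset_genI[OF F[OF t(1)]] have "F t \<subseteq> genI N (F s)" by (rule subset_trans)
      then have "t = s" by (rule incomparable[OF t(1) s(1)])
      then show ?thesis using t(2) P'(3) unfolding s(2) by (intro equalityI) simp_all
    qed
    then have "\<forall>P'. primeideal P' (RN N) \<and> Idl\<^bsub>RN N\<^esub> (cls N ` F0) \<subseteq> P' \<and> P' \<subseteq> P \<longrightarrow> P' = P"
      by (intro allI impI) (elim conjE)
    then show "P \<in> {P. minprime_over (RN N) (Idl\<^bsub>RN N\<^esub> (cls N ` F0)) P}"
      unfolding minprime_over_def mem_Collect_eq using prime_RN[OF s(1)] over[OF s(1)] unfolding s(2)
      by (intro conjI)
  qed
qed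

section \<open>Primes containing \<open>Q\<^sub>J\<close>\<close>

text \<open>The angle bracket \<langle>a b\<rangle> of two \<lambda>; \<open>brM\<close> is the
  square bracket [a b] of two \<mu>.\<close>

definition brP :: "nat \<Rightarrow> nat \<Rightarrow> mpoly" where
  "brP a b = va a * vb b - vb a * va b"

definition brM :: "nat \<Rightarrow> nat \<Rightarrow> mpoly" where
  "brM a b = vc a * vd b - vd a * vc b"

lemma br_simps: "brP a a = 0" "brM a a = 0" "brP b a = - brP a b" "brM b a = - brM a b"
  by (simp_all add: brP_def brM_def mult.commute)

lemma minors_colsP_obtain:
  assumes "f \<in> minors (colsP S)" "S \<subseteq> {1..}"
  obtains a b m where "a \<in> S" "b \<in> S" "spinor f = brP a b * m"
proof -
  obtain x1 y1 x2 y2 where f: "f = x1 * y2 - x2 * y1" "(x1, y1) \<in> colsP S" "(x2, y2) \<in> colsP S"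
    using assms(1) unfolding minors_def by blast
  have col: "\<exists>a\<in>S. \<exists>m. spinor x = va a * m \<and> spinor y = vb a * m" if xy: "(x, y) \<in> colsP S" for x y
  proof -
    obtain a where a: "a \<in> S" "x = va a \<and> y = vc a \<or> x = vb a \<and> y = vd a"
      using xy unfolding colsP_iff by blast
    have "a \<ge> 1" using a(1) assms(2) by auto
    then show ?thesis using a by (intro bexI[of _ a]) (auto simp: spinor_entries)
  qed
  obtain a m where am: "a \<in> S" "spinor x1 = va a * m" "spinor y1 = vb a * m" using col[OF f(2)] by blast
  obtain b n where bn: "b \<in> S" "spinor x2 = va b * n" "spinor y2 = vb b * n" using col[OF f(3)] by blast
  have "spinor f = brP a b * (m * n)"
    unfolding f(1) brP_def by (simp add: spinor.hom_simps am bn algebra_simps)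
  then show thesis using that am(1) bn(1) by blast
qed

lemma minors_colsM_obtain:
  assumes "f \<in> minors (colsM S)" "S \<subseteq> {1..}"
  obtains a b m where "a \<in> S" "b \<in> S" "spinor f = brM a b * m"
proof -
  obtain x1 y1 x2 y2 where f: "f = x1 * y2 - x2 * y1" "(x1, y1) \<in> colsM S" "(x2, y2) \<in> colsM S"
    using assms(1) unfolding minors_def by blast
  have col: "\<exists>a\<in>S. \<exists>m. spinor x = vc a * m \<and> spinor y = vd a * m" if xy: "(x, y) \<in> colsM S" for x y
  proof -
    obtain a where a: "a \<in> S" "x = va a \<and> y = vb a \<or> x = vc a \<and> y = vd a"
      using xy unfolding colsM_iff by blast
    have "a \<ge> 1" using a(1) assms(2) by auto
    then show ?thesis using a by (intro bexI[of _ a]) (auto simp: spinor_entries)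
  qed
  obtain a m where am: "a \<in> S" "spinor x1 = vc a * m" "spinor y1 = vd a * m" using col[OF f(2)] by blast
  obtain b n where bn: "b \<in> S" "spinor x2 = vc b * n" "spinor y2 = vd b * n" using col[OF f(3)] by blast
  have "spinor f = brM a b * (m * n)"
    unfolding f(1) brM_def by (simp add: spinor.hom_simps am bn algebra_simps)
  then show thesis using that am(1) bn(1) by blast
qed

lemma pair_minors:
  assumes "i \<ge> 1" "j \<ge> 1"
  shows "f \<in> minors (colsP {i, j}) \<Longrightarrow> \<exists>m. spinor f = brP i j * m"
    "g \<in> minors (colsM {i, j}) \<Longrightarrow> \<exists>m. spinor g = brM i j * m"
proof -
  have S: "{i, j} \<subseteq> {1..}" using assms by simp
  show "\<exists>m. spinor f = brP i j * m" if f: "f \<in> minors (colsP {i, j})"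
  proof -
    obtain a b m where ab: "a \<in> {i, j}" "b \<in> {i, j}" "spinor f = brP a b * m"
      using minors_colsP_obtain[OF f S] .
    have "\<exists>c. brP a b = brP i j * c"
    proof -
      consider "a = b" | "a = i" "b = j" | "a = j" "b = i" using ab(1,2) by blast
      then show ?thesis
      proof cases
        case 1
        then show ?thesis by (intro exI[of _ 0]) (simp add: br_simps(1,2))
      next
        case 2
        then show ?thesis by (intro exI[of _ 1]) simp
      next
        case 3
        then show ?thesis by (intro exI[of _ "- 1"]) (simp add: br_simps(3)[of i j])
      qed
    qed
    then obtain c where "brP a b = brP i j * c" by blast
    then show ?thesis using ab(3) by (intro exI[of _ "c * m"]) (simp add: mult.assoc)
  qed
  show "\<exists>m. spinor g = brM i j * m" if g: "g \<in> minors (colsM {i, j})"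
  proof -
    obtain a b m where ab: "a \<in> {i, j}" "b \<in> {i, j}" "spinor g = brM a b * m"
      using minors_colsM_obtain[OF g S] .
    have "\<exists>c. brM a b = brM i j * c"
    proof -
      consider "a = b" | "a = i" "b = j" | "a = j" "b = i" using ab(1,2) by blast
      then show ?thesis
      proof cases
        case 1
        then show ?thesis by (intro exI[of _ 0]) (simp add: br_simps(1,2))
      next
        case 2
        then show ?thesis by (intro exI[of _ 1]) simp
      next
        case 3
        then show ?thesis by (intro exI[of _ "- 1"]) (simp add: br_simps(4)[of i j])
      qed
    qed
    then obtain c where "brM a b = brM i j * c" by blast
    then show ?thesis using ab(3) by (intro exI[of _ "c * m"]) (simp add: mult.assoc)
  qed
qed

lemma sec_spinor_in_span:
  assumes "spinor.sec (spinor p) \<in> idl.span (dets \<union> G)"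
  shows "p \<in> idl.span (dets \<union> G)"
proof -
  have "spinor.sec (spinor p) - p \<in> idl.span (dets \<union> G)"
    using spinor.sec_psi[of p] idl.span_mono[of dets "dets \<union> G"] unfolding spinor_eq[symmetric] by blast
  then show ?thesis using assms idl_span_diff_cong by blast
qed

lemma sec_spinor_mult_in_span:
  assumes "q \<in> idl.span (dets \<union> G)"
  shows "spinor.sec (spinor q * w) \<in> idl.span (dets \<union> G)"
proof -
  have "spinor.sec (spinor q * w) - q * spinor.sec w \<in> idl.span (dets \<union> G)"
    using sec_spinor_mult[of q w] idl.span_mono[of dets "dets \<union> G"] by blast
  moreover have "q * spinor.sec w \<in> idl.span (dets \<union> G)" using assms by (rule idl_span_mult_right)
  ultimately show ?thesis using idl_span_diff_cong by blast
qed

text \<open>The product is a multiple of \<open>Q_ij\<close> in spinor coordinates, with a cofactor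
  \<open>m * n\<close> that is not known to be the image of a polynomial in momenta. Projecting by
  \<open>sec\<close> replaces it by one.\<close>

lemma minors_product:
  assumes ij: "i \<ge> 1" "j \<ge> 1" "i \<noteq> j"
    and f: "f \<in> minors (colsP {i, j})" and g: "g \<in> minors (colsM {i, j})"
  shows "f * g \<in> idl.span (dets \<union> {QJ {i, j}})"
proof (rule sec_spinor_in_span)
  obtain m n where mn: "spinor f = brP i j * m" "spinor g = brM i j * n"
    using pair_minors[OF ij(1,2)] f g by metis
  have "spinor (QJ {i, j}) = brP i j * brM i j"
    using ij by (simp add: QJ_def spinor.hom_simps spinor_entries brP_def brM_def algebra_simps)
  then have "spinor (f * g) = spinor (QJ {i, j}) * (m * n)"
    by (simp add: spinor.hom_mult mn ac_simps)
  then show "spinor.sec (spinor (f * g)) \<in> idl.span (dets \<union> {QJ {i, j}})"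
    using sec_spinor_mult_in_span[OF idl.span_base[of "QJ {i, j}" "dets \<union> {QJ {i, j}}"], of "m * n"] by simp
qed

text \<open>The determinant of k_i + k_j expands bilinearly into four minors, by columns or by
  rows.\<close>

lemma QJ_in_minors_span:
  assumes "i \<noteq> j"
  shows "QJ {i, j} \<in> idl.span (minors (colsP {i, j}))" "QJ {i, j} \<in> idl.span (minors (colsM {i, j}))"
proof -
  have P: "(va i, vc i) \<in> colsP {i, j}" "(vb i, vd i) \<in> colsP {i, j}" "(va j, vc j) \<in> colsP {i, j}"
    "(vb j, vd j) \<in> colsP {i, j}"
    and M: "(va i, vb i) \<in> colsM {i, j}" "(vc i, vd i) \<in> colsM {i, j}" "(va j, vb j) \<in> colsM {i, j}"
      "(vc j, vd j) \<in> colsM {i, j}"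
    unfolding colsP_iff colsM_iff by blast+
  have "QJ {i, j} = (va i * vd i - vb i * vc i) + (va j * vd j - vb j * vc j)
     + (va i * vd j - vb j * vc i) + (va j * vd i - vb i * vc j)"
    using assms by (simp add: QJ_def algebra_simps)
  then show "QJ {i, j} \<in> idl.span (minors (colsP {i, j}))"
    by (simp only:) (intro idl.span_add idl.span_base minors_intro P)
  have "QJ {i, j} = (va i * vd i - vc i * vb i) + (va j * vd j - vc j * vb j)
     + (va i * vd j - vc j * vb i) + (va j * vd i - vc i * vb j)"
    using assms by (simp add: QJ_def algebra_simps)
  then show "QJ {i, j} \<in> idl.span (minors (colsM {i, j}))"
    by (simp only:) (intro idl.span_add idl.span_base minors_intro M)
qed

text \<open>Momentum conservation contracted with \<open>\<lambda>\<^sub>k\<close> and \<open>\<mu>\<^sub>j\<close> reads \<open>\<langle>k i\<rangle>[i j] + \<langle>k l\<rangle>[l j] = 0\<close>.\<close>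
lemma cross_bracket:
  assumes ijkl: "{i, j, k, l} = {1..4}" "distinct [i, j, k, l]"
    and Y: "brP k l \<in> idl.span Y" "spinor ` msums 4 \<subseteq> idl.span Y"
  shows "brP i k * brM i j \<in> idl.span Y"
proof -
  have ge1: "m \<ge> 1" if "m \<in> {i, j, k, l}" for m using that unfolding ijkl(1) by simp
  have sum4: "(\<Sum>m\<in>{1..4}. f m) = f i + f j + f k + f l" for f :: "nat \<Rightarrow> mpoly"
    unfolding ijkl(1)[symmetric] using ijkl(2) by (simp add: add.assoc)
  have s: "spinor (\<Sum>m\<in>{1..4}. f m) \<in> idl.span Y" if "f \<in> {va, vb, vc, vd}" for f
    using Y(2) that by (auto simp: msums_def)
  have e: "spinor (\<Sum>m\<in>{1..4}. va m) = va i * vc i + va j * vc j + va k * vc k + va l * vc l"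
    "spinor (\<Sum>m\<in>{1..4}. vb m) = va i * vd i + va j * vd j + va k * vd k + va l * vd l"
    "spinor (\<Sum>m\<in>{1..4}. vc m) = vb i * vc i + vb j * vc j + vb k * vc k + vb l * vc l"
    "spinor (\<Sum>m\<in>{1..4}. vd m) = vb i * vd i + vb j * vd j + vb k * vd k + vb l * vd l"
    unfolding sum4 spinor.hom_add using ge1 by (simp_all add: spinor_entries)
  \<comment> \<open>The parenthesis is the sum over m of \<langle>k m\<rangle>[m j]; its terms for m
    = j and m = k vanish.\<close>
  have "brP i k * brM i j = brM l j * brP k l
     - ((va k * vd j) * spinor (\<Sum>m\<in>{1..4}. vc m) - (va k * vc j) * spinor (\<Sum>m\<in>{1..4}. vd m)
      - (vb k * vd j) * spinor (\<Sum>m\<in>{1..4}. va m) + (vb k * vc j) * spinor (\<Sum>m\<in>{1..4}. vb m))"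
    unfolding e brP_def brM_def by (simp add: algebra_simps)
  then show ?thesis
    by (simp only:) (intro idl.span_diff idl.span_add idl.span_scale s Y(1), simp_all)
qed

text \<open>No momentum is eliminated here. The conservation laws are invariant generators and come
  out of \<open>sec\<close> as factors, while the two brackets are handled by
  \<open>sec_bracket\<close>.\<close>

lemma span_of_brackets:
  assumes ij: "i \<ge> 1" "j \<ge> 1" "i \<noteq> j" "k \<ge> 1" "l \<ge> 1" "k \<noteq> l"
    and p: "spinor p \<in> idl.span (spinor ` msums N \<union> {brP i j, brP k l})"
  shows "p \<in> idl.span (gens N \<union> (minors (colsP {i, j}) \<union> minors (colsP {k, l})))"
proof -
  define G where "G = msums N \<union> (minors (colsP {i, j}) \<union> minors (colsP {k, l}))"
  have eq: "gens N \<union> (minors (colsP {i, j}) \<union> minors (colsP {k, l})) = dets \<union> G"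
    by (auto simp: gens_def G_def)
  have "spinor.sec x \<in> idl.span (dets \<union> G)" if "x \<in> idl.span (spinor ` msums N \<union> {brP i j, brP k l})" for x
    using that
  proof (induction rule: idl.span_induct_alt)
    case base
    then show ?case by (simp add: spinor.sec_0 idl.span_zero)
  next
    case (step c h y)
    have "spinor.sec (h * c) \<in> idl.span (dets \<union> G)"
    proof -
      consider s where "h = spinor s" "s \<in> msums N" | "h = brP i j" | "h = brP k l" using step(1) by blast
      then show ?thesis
      proof cases
        case 1
        then show ?thesis by (simp add: sec_spinor_mult_in_span idl.span_base G_def)
      next
        case 2
        have "dets \<union> minors (colsP {i, j}) \<subseteq> dets \<union> G" unfolding G_def by blast
        from idl.span_mono[OF this] show ?thesis
          using sec_bracket[OF ij(1-3), of c] unfolding \<open>h = _\<close> brP_def by (rule subsetD)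
      next
        case 3
        have "dets \<union> minors (colsP {k, l}) \<subseteq> dets \<union> G" unfolding G_def by blast
        from idl.span_mono[OF this] show ?thesis
          using sec_bracket[OF ij(4-6), of c] unfolding \<open>h = _\<close> brP_def by (rule subsetD)
      qed
    qed
    then show ?case using step(2) by (simp add: spinor.sec_add mult.commute[of c] idl.span_add)
  qed
  from this[OF p] show ?thesis unfolding eq by (rule sec_spinor_in_span)
qed

text \<open>Modulo conservation, \<langle>i j\<rangle> and \<langle>k l\<rangle>, the four brackets
  between the pairs vanish after multiplication by [i j], so [i j] annihilates all angle brackets. A
  prime with the plus minors of both pairs thus contains all plus minors or the minus minors of
  \<open>{i, j}\<close>.\<close>

lemma minors_product_cross:
  assumes ijkl: "{i, j, k, l} = {1..4}" "distinct [i, j, k, l]"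
    and f: "f \<in> minors (colsP {1..4})" and g: "g \<in> minors (colsM {i, j})"
  shows "f * g \<in> idl.span (gens 4 \<union> (minors (colsP {i, j}) \<union> minors (colsP {k, l})))"
proof (rule span_of_brackets)
  have ge1: "m \<ge> 1" if "m \<in> {i, j, k, l}" for m using that unfolding ijkl(1) by simp
  show "i \<ge> 1" "j \<ge> 1" "i \<noteq> j" "k \<ge> 1" "l \<ge> 1" "k \<noteq> l" using ge1 ijkl(2) by auto
  define Y where "Y = spinor ` msums 4 \<union> {brP i j, brP k l}"
  have "brP i j \<in> Y" "brP k l \<in> Y" unfolding Y_def by blast+
  note base = this[THEN idl.span_base]
  have rev: "brP b a \<in> idl.span Y" if "brP a b \<in> idl.span Y" for a b
    using idl.span_neg[OF that] by (simp add: br_simps(3)[of a b])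
  have Y2: "spinor ` msums 4 \<subseteq> idl.span Y" using idl.span_superset[of Y] unfolding Y_def by blast
  have c1: "brP a b * brM i j \<in> idl.span Y" if "a = i \<or> a = j" "b = k \<or> b = l" for a b
  proof -
    have 1: "brP i k * brM i j \<in> idl.span Y"
      by (rule cross_bracket[OF ijkl base(2) Y2])
    have 2: "brP i l * brM i j \<in> idl.span Y"
      by (rule cross_bracket[OF _ _ rev[OF base(2)] Y2]) (use ijkl in auto)
    have 3: "brP j k * brM j i \<in> idl.span Y"
      by (rule cross_bracket[OF _ _ base(2) Y2]) (use ijkl in auto)
    have 4: "brP j l * brM j i \<in> idl.span Y"
      by (rule cross_bracket[OF _ _ rev[OF base(2)] Y2]) (use ijkl in auto)
    show ?thesis
      using that 1 2 idl.span_neg[OF 3] idl.span_neg[OF 4] by (auto simp: br_simps(4)[of i j])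
  qed
  have c2: "brP b a * brM i j \<in> idl.span Y" if "a = i \<or> a = j" "b = k \<or> b = l" for a b
    using idl.span_neg[OF c1[OF that]] by (simp add: br_simps(3)[of a b])
  have c3: "brP a b * brM i j \<in> idl.span Y" if "brP a b \<in> idl.span Y" for a b
    using that by (rule idl_span_mult_right)
  obtain a b m where ab: "a \<in> {1..4}" "b \<in> {1..4}" "spinor f = brP a b * m"
    using minors_colsP_obtain[OF f] by auto
  obtain n where n: "spinor g = brM i j * n" using pair_minors(2)[OF ge1 ge1 g] by auto
  have "brP a b * brM i j \<in> idl.span Y"
  proof -
    consider "a = b" | "a = i" "b = j" | "a = j" "b = i" | "a = k" "b = l" | "a = l" "b = k"
      | "a = i \<or> a = j" "b = k \<or> b = l" | "b = i \<or> b = j" "a = k \<or> a = l"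
      using ab(1,2) unfolding ijkl(1)[symmetric] by blast
    then show ?thesis
    proof cases
      case 1 then show ?thesis by (simp add: br_simps(1) idl.span_zero)
    next
      case 2 then show ?thesis using c3 base(1) by blast
    next
      case 3 then show ?thesis using c3 rev[OF base(1)] by blast
    next
      case 4 then show ?thesis using c3 base(2) by blast
    next
      case 5 then show ?thesis using c3 rev[OF base(2)] by blast
    next
      case 6 then show ?thesis by (rule c1)
    next
      case 7 then show ?thesis by (rule c2)
    qed
  qed
  then have "brP a b * brM i j * (m * n) \<in> idl.span Y" by (rule idl_span_mult_right)
  moreover have "spinor (f * g) = brP a b * brM i j * (m * n)"
    by (simp add: spinor.hom_mult ab(3) n ac_simps)
  ultimately show "spinor (f * g) \<in> idl.span (spinor ` msums 4 \<union> {brP i j, brP k l})"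
    unfolding Y_def by simp
qed

lemma minors_product_cross_trans:
  assumes ijkl: "{i, j, k, l} = {1..4}" "distinct [i, j, k, l]"
    and f: "f \<in> minors (colsM {1..4})" and g: "g \<in> minors (colsP {i, j})"
  shows "f * g \<in> idl.span (gens 4 \<union> (minors (colsM {i, j}) \<union> minors (colsM {k, l})))"
proof -
  have S: "{1..4} \<subseteq> {1::nat..}" "{i, j} \<subseteq> {1..}" "{k, l} \<subseteq> {1..}"
    using ijkl(1) by auto
  have "trans_k f \<in> minors (colsP {1..4})" "trans_k g \<in> minors (colsM {i, j})"
    using f g trans_k_minors[OF S(1)] trans_k_minors[OF S(2)] by blast+
  from span_trans_k[OF minors_product_cross[OF ijkl this]] show ?thesis
    unfolding trans_k.hom_mult trans_k_invol image_Un trans_k_minors(1)[OF S(2)] trans_k_minors(1)[OF S(3)] .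
qed

section \<open>Generator sets forced into primes over \<open>Q_ij\<close>\<close>

lemma minors_carrier:
  assumes "S \<subseteq> {1..N}"
  shows "minors (colsP S) \<subseteq> carrier (polyR N)" "minors (colsM S) \<subseteq> carrier (polyR N)"
proof -
  have "x \<in> carrier (polyR N) \<and> y \<in> carrier (polyR N)" if "(x, y) \<in> colsP S" for x y
    using that assms entries_in_carrier unfolding colsP_iff by blast
  then show "minors (colsP S) \<subseteq> carrier (polyR N)"
    unfolding minors_def by (auto intro!: carrier_polyR_closed)
  have "x \<in> carrier (polyR N) \<and> y \<in> carrier (polyR N)" if "(x, y) \<in> colsM S" for x y
    using that assms entries_in_carrier unfolding colsM_iff by blast
  then show "minors (colsM S) \<subseteq> carrier (polyR N)"
    unfolding minors_def by (auto intro!: carrier_polyR_closed)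
qed

lemma prime_product_subset:
  assumes X: "primeideal X (polyR N)" "base_gens N \<subseteq> X" "G \<subseteq> X"
    and AB: "A \<subseteq> carrier (polyR N)" "B \<subseteq> carrier (polyR N)"
    and prod: "\<And>f g. f \<in> A \<Longrightarrow> g \<in> B \<Longrightarrow> f * g \<in> idl.span (gens N \<union> G)"
  shows "A \<subseteq> X \<or> B \<subseteq> X"
proof (rule ccontr)
  assume "\<not> ?thesis"
  then obtain f g where fg: "f \<in> A" "g \<in> B" "f \<notin> X" "g \<notin> X" by blast
  have c: "f \<in> carrier (polyR N)" "g \<in> carrier (polyR N)" using fg AB by blast+
  have "f * g \<in> genI N G" unfolding genI_def using prod[OF fg(1,2)] c carrier_polyR_closed(6) by blast
  then have "f * g \<in> X" using genI_minimal[OF primeideal.axioms(1)[OF X(1)] X(2,3)] by blast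
  then show False using primeideal.I_prime[OF X(1) c] fg(3,4) by simp
qed

lemma prime_over_pair:
  assumes X: "primeideal X (polyR N)" "base_gens N \<subseteq> X" "QJ {i, j} \<in> X"
    and ij: "i \<in> {1..N}" "j \<in> {1..N}" "i \<noteq> j"
  shows "minors (colsP {i, j}) \<subseteq> X \<or> minors (colsM {i, j}) \<subseteq> X"
proof (rule prime_product_subset[OF X(1,2), of "{QJ {i, j}}"])
  fix f g assume "f \<in> minors (colsP {i, j})" "g \<in> minors (colsM {i, j})"
  then have "f * g \<in> idl.span (dets \<union> {QJ {i, j}})" using ij by (intro minors_product) auto
  then show "f * g \<in> idl.span (gens N \<union> {QJ {i, j}})"
    using idl.span_mono[of "dets \<union> {QJ {i, j}}" "gens N \<union> {QJ {i, j}}"] unfolding gens_def by blast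
qed (use X(3) ij minors_carrier[of "{i, j}" N] in auto)

lemma QJ_compl_genI:
  assumes "J \<subseteq> {1..N}"
  shows "QJ J - QJ ({1..N} - J) \<in> genI N F"
proof -
  have "QJ J - QJ ({1..N} - J) \<in> carrier (polyR N)"
    using assms by (intro carrier_polyR_closed QJ_in_carrier) auto
  moreover have "QJ J - QJ ({1..N} - J) \<in> idl.span (gens N \<union> F)"
    using QJ_compl_mod[OF assms] idl.span_mono[of "msums N" "gens N \<union> F"] unfolding gens_def by blast
  ultimately show ?thesis unfolding genI_def by blast
qed

definition mix_minors :: "nat set \<times> nat set \<Rightarrow> mpoly set" where
  "mix_minors = (\<lambda>(S, T). minors (colsP S) \<union> minors (colsM T))"

lemma minors_empty: "minors (colsP {}) = {}" "minors (colsM {}) = {}"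
  by (auto simp: minors_def colsP_def colsM_def)

lemma pmix_eq: "pmix N S T = Idl\<^bsub>RN N\<^esub> (cls N ` mix_minors (S, T))"
  by (simp add: pmix_def mix_minors_def)

lemma QI_eq: "QI N J = Idl\<^bsub>RN N\<^esub> (cls N ` {QJ J})"
  by (simp add: QI_def)

text \<open>\<open>Q_ij\<close> and \<open>Q_kl\<close> agree modulo conservation, so each pair
  acquires a sign. Opposite signs give a mixed ideal. Two plus signs give ++++ or force minus on
  \<open>{i, j}\<close> as well, which together with plus on \<open>{k, l}\<close> is a mixed ideal
  again; two minus signs are dual.\<close>

lemma prime_over_four:
  assumes X: "primeideal X (polyR 4)" "base_gens 4 \<subseteq> X" "QJ {i, j} \<in> X"
    and ijkl: "{i, j, k, l} = {1..4}" "distinct [i, j, k, l]"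
  shows "\<exists>s\<in>{({1..4}, {}), ({}, {1..4}), ({i, j}, {k, l}), ({k, l}, {i, j})}. mix_minors s \<subseteq> X"
proof -
  have idl: "ideal X (polyR 4)" using X(1) by (rule primeideal.axioms(1))
  have in4: "i \<in> {1..4}" "j \<in> {1..4}" "k \<in> {1..4}" "l \<in> {1..4}" using ijkl(1) by blast+
  have sub: "{i, j} \<subseteq> {1..4}" "{k, l} \<subseteq> {1..4}" "{1..4} \<subseteq> {1..4::nat}" using in4 by auto
  have "{1..4} - {k, l} = {i, j}" using ijkl by auto
  then have "QJ {k, l} - QJ {i, j} \<in> genI 4 {}" using QJ_compl_genI[OF sub(2), of "{}"] by simp
  then have "QJ {k, l} - QJ {i, j} \<in> X" using genI_minimal[OF idl X(2), of "{}"] by blast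
  then have "QJ {k, l} - QJ {i, j} + QJ {i, j} \<in> X" using ideal_props(2)[OF idl] X(3) by blast
  then have kl: "QJ {k, l} \<in> X" by simp
  have P: "minors (colsP {1..4}) \<subseteq> X \<or> minors (colsM {i, j}) \<subseteq> X"
    if "minors (colsP {i, j}) \<subseteq> X" "minors (colsP {k, l}) \<subseteq> X"
    by (rule prime_product_subset[OF X(1,2) Un_least[OF that]])
      (intro minors_carrier sub minors_product_cross[OF ijkl]; assumption)+
  have M: "minors (colsM {1..4}) \<subseteq> X \<or> minors (colsP {i, j}) \<subseteq> X"
    if "minors (colsM {i, j}) \<subseteq> X" "minors (colsM {k, l}) \<subseteq> X"
    by (rule prime_product_subset[OF X(1,2) Un_least[OF that]])
      (intro minors_carrier sub minors_product_cross_trans[OF ijkl]; assumption)+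
  have "minors (colsP {i, j}) \<subseteq> X \<or> minors (colsM {i, j}) \<subseteq> X"
    using prime_over_pair[OF X] in4 ijkl(2) by simp
  moreover have "minors (colsP {k, l}) \<subseteq> X \<or> minors (colsM {k, l}) \<subseteq> X"
    using prime_over_pair[OF X(1,2) kl] in4 ijkl(2) by simp
  ultimately have "mix_minors ({1..4}, {}) \<subseteq> X \<or> mix_minors ({}, {1..4}) \<subseteq> X
      \<or> mix_minors ({i, j}, {k, l}) \<subseteq> X \<or> mix_minors ({k, l}, {i, j}) \<subseteq> X"
    using P M unfolding mix_minors_def by (simp only: prod.case minors_empty Un_subset_iff empty_subsetI)
      blast
  then show ?thesis by blast
qed

section \<open>Kinematic configurations\<close>

definition delta :: "nat \<Rightarrow> nat \<Rightarrow> complex" where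
  "delta a m = (if m = a then 1 else 0)"

lemma sum_delta: "finite J \<Longrightarrow> (\<Sum>m\<in>J. delta a m) = (if a \<in> J then 1 else 0)"
  by (simp add: delta_def)

text \<open>Only four momenta are nonzero here, with \<open>\<lambda>\<^sub>w = \<lambda>\<^sub>x\<close> and \<open>\<mu>\<^sub>y = \<mu>\<^sub>z\<close>.\<close>
definition four_point :: "nat \<Rightarrow> nat \<Rightarrow> nat \<Rightarrow> nat \<Rightarrow> nat \<Rightarrow> complex" where
  "four_point w x y z = blk (\<lambda>m. delta x m - delta z m) (\<lambda>m. delta w m - delta x m)
     (\<lambda>m. delta y m - delta z m) (\<lambda>m. 0)"

lemma ev_four_point:
  assumes "m \<ge> 1"
  shows "ev (four_point w x y z) (va m) = delta x m - delta z m"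
    "ev (four_point w x y z) (vb m) = delta w m - delta x m"
    "ev (four_point w x y z) (vc m) = delta y m - delta z m"
    "ev (four_point w x y z) (vd m) = 0"
  using assms by (simp_all add: four_point_def ev_blk)

text \<open>All entries d are 0, so the determinant is minus the product of the summed entries b and
  c. It is nonzero exactly when \<open>J\<close> separates \<open>w\<close> from \<open>x\<close>
  and \<open>y\<close> from \<open>z\<close>.\<close>

lemma ev_four_point_QJ:
  assumes "J \<subseteq> {1..N}"
  shows "ev (four_point w x y z) (QJ J) = - (((if w \<in> J then 1 else 0) - (if x \<in> J then 1 else 0))
     * ((if y \<in> J then 1 else 0) - (if z \<in> J then 1 else 0)))"
proof -
  have fin: "finite J" using assms finite_subset by blast
  have J: "m \<ge> 1" if "m \<in> J" for m using assms that by auto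
  let ?z = "four_point w x y z"
  have "(\<Sum>m\<in>J. ev ?z (vb m)) = (\<Sum>m\<in>J. delta w m - delta x m)"
    "(\<Sum>m\<in>J. ev ?z (vc m)) = (\<Sum>m\<in>J. delta y m - delta z m)"
    "(\<Sum>m\<in>J. ev ?z (vd m)) = 0"
    by (intro sum.cong refl ev_four_point J sum.neutral ballI; assumption)+
  then show ?thesis
    unfolding QJ_def ev.hom_diff ev.hom_mult ev.hom_sum by (simp only: sum_subtractf sum_delta[OF fin]) simp
qed

lemma ev_four_point_gens:
  assumes wxyz: "{w, x, y, z} \<subseteq> {1..N}" "distinct [w, x, y, z]" and g: "g \<in> gens N"
  shows "ev (four_point w x y z) g = 0"
proof -
  let ?z = "four_point w x y z"
  have "ev ?z (\<Sum>m\<in>{1..N}. va m) = (\<Sum>m\<in>{1..N}. delta x m - delta z m)"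
    "ev ?z (\<Sum>m\<in>{1..N}. vb m) = (\<Sum>m\<in>{1..N}. delta w m - delta x m)"
    "ev ?z (\<Sum>m\<in>{1..N}. vc m) = (\<Sum>m\<in>{1..N}. delta y m - delta z m)"
    "ev ?z (\<Sum>m\<in>{1..N}. vd m) = 0"
    unfolding ev.hom_sum by (intro sum.cong refl ev_four_point sum.neutral ballI; simp)+
  moreover have "a \<in> {1..N}" if "a \<in> {w, x, y, z}" for a using wxyz(1) that by blast
  ultimately have "ev ?z s = 0" if "s \<in> msums N" for s
    using that unfolding msums_def sum_subtractf sum_delta[OF finite_atLeastAtMost] by auto
  moreover have "ev ?z (QJ {m}) = 0" if "m \<ge> 1" for m
    using ev_four_point_QJ[of "{m}" m w x y z] wxyz(2) that by auto
  ultimately show ?thesis using g unfolding gens_def dets_def by auto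
qed

lemma ev_minors_zero:
  assumes "f \<in> minors C" "\<And>x y. (x, y) \<in> C \<Longrightarrow> \<exists>m. ev z x = A * m \<and> ev z y = B * m"
  shows "ev z f = 0"
  using vanish_minors[OF ev.rhom_axioms assms(1)] assms(2) by blast

lemma ev_four_point_colsP:
  assumes "f \<in> minors (colsP {w, x})" "w \<ge> 1" "x \<ge> 1" "distinct [w, x, y, z]"
  shows "ev (four_point w x y z) f = 0"
proof (rule ev_minors_zero[OF assms(1), where A = 1 and B = 0])
  fix p q assume "(p, q) \<in> colsP {w, x}"
  then obtain a where a: "a \<in> {w, x}" "p = va a \<and> q = vc a \<or> p = vb a \<and> q = vd a" unfolding colsP_iff by blast
  then have "a \<ge> 1" "a \<noteq> y" "a \<noteq> z" using assms by auto
  then have "ev (four_point w x y z) q = 0" using a(2) by (auto simp: ev_four_point delta_def)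
  then show "\<exists>m. ev (four_point w x y z) p = 1 * m \<and> ev (four_point w x y z) q = 0 * m" by simp
qed

lemma ev_four_point_colsM:
  assumes "f \<in> minors (colsM {y, z})" "y \<ge> 1" "z \<ge> 1" "distinct [w, x, y, z]"
  shows "ev (four_point w x y z) f = 0"
proof (rule ev_minors_zero[OF assms(1), where A = 1 and B = 0])
  fix p q assume "(p, q) \<in> colsM {y, z}"
  then obtain a where a: "a \<in> {y, z}" "p = va a \<and> q = vb a \<or> p = vc a \<and> q = vd a" unfolding colsM_iff by blast
  then have "a \<ge> 1" "a \<noteq> w" "a \<noteq> x" using assms by auto
  then have "ev (four_point w x y z) q = 0" using a(2) by (auto simp: ev_four_point delta_def)
  then show "\<exists>m. ev (four_point w x y z) p = 1 * m \<and> ev (four_point w x y z) q = 0 * m" by simp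
qed

text \<open>The momentum of \<open>j\<close> is zero, and that of \<open>i\<close>, which is neither
  \<open>w\<close> nor \<open>x\<close>, has zero second column.\<close>

lemma ev_four_point_single:
  assumes "f \<in> minors (colsP {i, j})" "i \<ge> 1" "j \<ge> 1" "j \<notin> {w, x, y, z}" "i \<notin> {w, x}"
  shows "ev (four_point w x y z) f = 0"
proof (rule ev_minors_zero[OF assms(1), where A = "- delta z i" and B = "delta y i - delta z i"])
  fix p q assume "(p, q) \<in> colsP {i, j}"
  then obtain a where a: "a \<in> {i, j}" "p = va a \<and> q = vc a \<or> p = vb a \<and> q = vd a" unfolding colsP_iff by blast
  let ?z = "four_point w x y z"
  have zero: "\<exists>m. ev ?z p = - delta z i * m \<and> ev ?z q = (delta y i - delta z i) * m"
    if "ev ?z p = 0" "ev ?z q = 0"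
    using that by (intro exI[of _ 0]) simp
  show "\<exists>m. ev ?z p = - delta z i * m \<and> ev ?z q = (delta y i - delta z i) * m"
  proof (cases "a = j")
    case True
    then show ?thesis using a(2) assms(3,4) by (intro zero) (auto simp: ev_four_point delta_def)
  next
    case False
    then have i: "a = i" using a(1) by blast
    from a(2) show ?thesis
    proof
      assume "p = va a \<and> q = vc a"
      then show ?thesis using i assms(2,5) by (intro exI[of _ 1]) (auto simp: ev_four_point delta_def)
    next
      assume "p = vb a \<and> q = vd a"
      then show ?thesis using i assms(2,5) by (intro zero) (auto simp: ev_four_point delta_def)
    qed
  qed
qed

lemma ev_notin_genI:
  assumes "\<And>g. g \<in> gens N \<Longrightarrow> ev z g = 0" "\<And>g. g \<in> F \<Longrightarrow> ev z g = 0" "ev z f \<noteq> 0"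
  shows "f \<notin> genI N F"
  using ev_notin_span[of z f "gens N \<union> F"] assms unfolding genI_def by blast

text \<open>\<open>J'\<close> separates both couples, so \<open>Q_J'\<close> is nonzero at the
  four-point configuration, while \<open>w\<close> and \<open>x\<close> lie on the same side of
  \<open>J\<close>, so \<open>Q_J\<close> is zero. The extra clause keeps \<open>y\<close> and
  \<open>z\<close> from both lying in \<open>J\<close>, which is needed when \<open>J\<close> is a
  pair and its minors have to vanish.\<close>

lemma split_obtain:
  assumes J: "J \<subseteq> {1..N}" and J': "internal N J'" "J' \<noteq> J" "J' \<noteq> {1..N} - J"
  obtains w x y z where "{w, x, y, z} \<subseteq> {1..N}" "distinct [w, x, y, z]" "w \<in> J'" "x \<notin> J'" "y \<in> J'" "z \<notin> J'"
    "(w \<in> J \<and> x \<in> J) \<or> (w \<notin> J \<and> x \<notin> J \<and> (J \<subseteq> J' \<or> J \<inter> J' = {}))"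
proof -
  have J'sub: "J' \<subseteq> {1..N}" and card: "2 \<le> card J'" "card J' \<le> N - 2"
    using J'(1) unfolding internal_def by auto
  have "card ({1..N} - J') = N - card J'" using J'sub by (simp add: card_Diff_subset finite_subset)
  then have card': "2 \<le> card ({1..N} - J')" using card by linarith
  have pick: "\<exists>b\<in>A. b \<noteq> a" if "2 \<le> card A" for A :: "nat set" and a
  proof (rule ccontr)
    assume "\<not> ?thesis"
    then have "A \<subseteq> {a}" by blast
    then have "card A \<le> 1" using card_mono[of "{a}" A] by simp
    then show False using that by simp
  qed
  obtain w x where wx: "w \<in> J'" "x \<in> {1..N} - J'"
    "(w \<in> J \<and> x \<in> J) \<or> (w \<notin> J \<and> x \<notin> J \<and> (J \<subseteq> J' \<or> J \<inter> J' = {}))"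
  proof (cases "J \<subseteq> J' \<or> J \<inter> J' = {}")
    case False
    then obtain w x where "w \<in> J" "w \<in> J'" "x \<in> J" "x \<notin> J'" by blast
    then show thesis using that[of w x] J by blast
  next
    case True
    have "\<exists>w x. w \<in> J' - J \<and> x \<in> {1..N} - J' - J"
    proof (cases "J \<subseteq> J'")
      case sub: True
      then obtain w where "w \<in> J' - J" using J'(2) by blast
      moreover obtain x where "x \<in> {1..N} - J'" using pick[OF card'] by blast
      ultimately show ?thesis using sub by blast
    next
      case False
      then have dis: "J \<inter> J' = {}" using True by blast
      obtain w where "w \<in> J'" using pick[OF card(1)] by blast
      moreover obtain x where "x \<in> {1..N} - J - J'" using J'(3) J'sub dis by blast
      ultimately show ?thesis using dis by blast
    qed
    then show thesis using that True by blast
  qed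
  obtain y where y: "y \<in> J'" "y \<noteq> w" using pick[OF card(1)] by blast
  obtain z where z: "z \<in> {1..N} - J'" "z \<noteq> x" using pick[OF card'] by blast
  have "{w, x, y, z} \<subseteq> {1..N}" using wx y z J'sub by blast
  moreover have "distinct [w, x, y, z]" using wx y z by auto
  ultimately show thesis using that wx y z by blast
qed

lemma ev_trans_k: "ev (\<lambda>v. ev z (trans_k (Var v))) p = ev z (trans_k p)"
  unfolding trans_k_def by (simp add: ev_subst)

lemma trans_k_genI_notin:
  assumes "\<And>g. g \<in> gens N \<Longrightarrow> ev z g = 0" "\<And>g. g \<in> F \<Longrightarrow> ev z (trans_k g) = 0" "ev z (trans_k f) \<noteq> 0"
  shows "f \<notin> genI N F"
  by (rule ev_notin_genI[where z = "\<lambda>v. ev z (trans_k (Var v))"])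
    (use assms trans_k_gens in \<open>auto simp: ev_trans_k\<close>)

lemma QJ_notin:
  assumes J: "J \<subseteq> {1..N}" and J': "internal N J'" "J' \<noteq> J" "J' \<noteq> {1..N} - J"
  shows "QJ J' \<notin> genI N {QJ J}"
    "J = {i, j} \<Longrightarrow> i \<noteq> j \<Longrightarrow> QJ J' \<notin> genI N (minors (colsP J))"
    "J = {i, j} \<Longrightarrow> i \<noteq> j \<Longrightarrow> QJ J' \<notin> genI N (minors (colsM J))"
proof -
  obtain w x y z where wxyz: "{w, x, y, z} \<subseteq> {1..N}" "distinct [w, x, y, z]"
    and mem: "w \<in> J'" "x \<notin> J'" "y \<in> J'" "z \<notin> J'"
    and side: "(w \<in> J \<and> x \<in> J) \<or> (w \<notin> J \<and> x \<notin> J \<and> (J \<subseteq> J' \<or> J \<inter> J' = {}))"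
    using split_obtain[OF assms] .
  let ?z = "four_point w x y z"
  have J'sub: "J' \<subseteq> {1..N}" using J'(1) unfolding internal_def by blast
  have nz: "ev ?z (QJ J') \<noteq> 0" using mem by (simp add: ev_four_point_QJ[OF J'sub])
  have zero: "ev ?z (QJ J) = 0" using side by (auto simp: ev_four_point_QJ[OF J])
  show "QJ J' \<notin> genI N {QJ J}"
    by (rule ev_notin_genI[where z = ?z]) (use ev_four_point_gens[OF wxyz] nz zero in auto)
  have minors_zero: "ev ?z f = 0" if ij: "J = {i, j}" "i \<noteq> j" and f: "f \<in> minors (colsP J)" for f
  proof -
    have ge: "i \<ge> 1" "j \<ge> 1" "w \<ge> 1" "x \<ge> 1" using J ij wxyz(1) by auto
    from side show ?thesis
    proof
      assume "w \<in> J \<and> x \<in> J"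
      then have "J = {w, x}" using ij wxyz(2) by auto
      then show ?thesis using ev_four_point_colsP f ge wxyz(2) by blast
    next
      assume out: "w \<notin> J \<and> x \<notin> J \<and> (J \<subseteq> J' \<or> J \<inter> J' = {})"
      \<comment> \<open>\<open>y\<close> lies in \<open>J'\<close> and \<open>z\<close> does not, so
        neither alternative allows both in \<open>J\<close>. One particle of the pair therefore has
        zero momentum.\<close>
      then have "\<not> (y \<in> J \<and> z \<in> J)" using mem by blast
      then have "j \<notin> {w, x, y, z} \<or> i \<notin> {w, x, y, z}" using out wxyz(2) ij by auto
      moreover have "i \<notin> {w, x}" "j \<notin> {w, x}" using out ij by auto
      moreover have "f \<in> minors (colsP {i, j})" "f \<in> minors (colsP {j, i})" using f ij by
        (auto simp: insert_commute)
      ultimately show ?thesis using ev_four_point_single ge(1,2) by blast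
    qed
  qed
  show "QJ J' \<notin> genI N (minors (colsP J))" if "J = {i, j}" "i \<noteq> j"
    by (rule ev_notin_genI[where z = ?z]) (use ev_four_point_gens[OF wxyz] nz minors_zero[OF that] in auto)
  have S: "J \<subseteq> {1..}" "J' \<subseteq> {1..}" using J J'sub by auto
  show "QJ J' \<notin> genI N (minors (colsM J))" if "J = {i, j}" "i \<noteq> j"
  proof (rule trans_k_genI_notin[where z = ?z])
    show "ev ?z (trans_k g) = 0" if "g \<in> minors (colsM J)" for g
      using that trans_k_minors(2)[OF S(1)] minors_zero[OF \<open>J = {i, j}\<close> \<open>i \<noteq> j\<close>] by blast
    show "ev ?z (trans_k (QJ J')) \<noteq> 0" using nz trans_k_QJ[OF S(2)] by simp
  qed (rule ev_four_point_gens[OF wxyz])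
qed

text \<open>At \<open>four_point i j k l\<close> the vectors \<lambda>_i and \<lambda>_j are
  parallel but \<mu>_i and \<mu>_j are not. The transposed point gives the other direction.\<close>

lemma pair_incomparable:
  assumes N: "N \<ge> 4" and ij: "i \<in> {1..N}" "j \<in> {1..N}" "i \<noteq> j"
  shows "\<not> minors (colsM {i, j}) \<subseteq> genI N (minors (colsP {i, j}))"
    "\<not> minors (colsP {i, j}) \<subseteq> genI N (minors (colsM {i, j}))"
proof -
  have "card ({1..N} - {i, j}) = N - 2" using ij by (subst card_Diff_subset) auto
  then have "2 \<le> card ({1..N} - {i, j})" using N by simp
  from obtain_subset_with_card_n[OF this] obtain B where B: "B \<subseteq> {1..N} - {i, j}" "card B = 2" by metis
  then obtain k l where "B = {k, l}" "k \<noteq> l" unfolding card_2_iff by blast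
  then have kl: "{i, j, k, l} \<subseteq> {1..N}" "distinct [i, j, k, l]" using B(1) ij by auto
  have ge: "i \<ge> 1" "j \<ge> 1" using ij by auto
  let ?z = "four_point i j k l"
  define f where "f = va i * vb j - va j * vb i"
  have f: "f \<in> minors (colsM {i, j})"
    unfolding f_def by (rule minors_intro) (auto simp: colsM_iff)
  have nz: "ev ?z f \<noteq> 0"
    unfolding f_def using ge kl(2) by (simp add: ev.hom_simps ev_four_point delta_def)
  have P: "ev ?z g = 0" if "g \<in> minors (colsP {i, j})" for g
    using ev_four_point_colsP[OF that ge kl(2)] .
  have "f \<notin> genI N (minors (colsP {i, j}))"
    by (rule ev_notin_genI[where z = ?z]) (use ev_four_point_gens[OF kl] nz P in auto)
  then show "\<not> minors (colsM {i, j}) \<subseteq> genI N (minors (colsP {i, j}))" using f by blast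
  have S: "{i, j} \<subseteq> {1..}" using ge by simp
  have "trans_k f \<notin> genI N (minors (colsM {i, j}))"
  proof (rule trans_k_genI_notin[where z = ?z])
    show "ev ?z (trans_k g) = 0" if "g \<in> minors (colsM {i, j})" for g
      using that trans_k_minors(2)[OF S] P by blast
    show "ev ?z (trans_k (trans_k f)) \<noteq> 0" using nz unfolding trans_k_invol .
  qed (rule ev_four_point_gens[OF kl])
  moreover have "trans_k f \<in> minors (colsP {i, j})" using f trans_k_minors(2)[OF S] by blast
  ultimately show "\<not> minors (colsP {i, j}) \<subseteq> genI N (minors (colsM {i, j}))" by blast
qed

section \<open>At least five particles\<close>

lemma QI_compl:
  assumes "J \<subseteq> {1..N}"
  shows "QI N J = QI N ({1..N} - J)"
proof -
  have c: "QJ J \<in> carrier (polyR N)" "QJ ({1..N} - J) \<in> carrier (polyR N)"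
    using assms by (intro QJ_in_carrier; auto)+
  have sub: "genI N {QJ A} \<subseteq> genI N {QJ B}"
    if "QJ A - QJ B \<in> genI N {QJ B}" "QJ A \<in> carrier (polyR N)" "QJ B \<in> carrier (polyR N)" for A B
  proof -
    have "QJ B \<in> genI N {QJ B}" using subset_genI[of "{QJ B}" N] that(3) by simp
    from ideal_props(2)[OF ideal_genI that(1) this] have "QJ A \<in> genI N {QJ B}" by simp
    then show ?thesis by (intro genI_minimal ideal_genI base_gens_subset_genI) simp
  qed
  have dd: "{1..N} - ({1..N} - J) = J" using assms by blast
  have "genI N {QJ J} = genI N {QJ ({1..N} - J)}"
    using sub[OF QJ_compl_genI[OF assms] c] sub[OF _ c(2,1)] QJ_compl_genI[of "{1..N} - J" N "{QJ J}"]
    unfolding dd by blast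
  then show ?thesis unfolding QI_eq using Idl_RN[of "{QJ J}" N] Idl_RN[of "{QJ ({1..N} - J)}" N] c by simp
qed

lemma primeideal_genI_carrier:
  assumes "is_prime (idl.span (gens N \<union> F))" "F \<subseteq> carrier (polyR N)"
  shows "primeideal (genI N F) (polyR N)"
  by (rule primeideal_genI[OF assms(1) subset_refl _ assms(2)]) (use retract_carrier assms(2) in auto)

lemma QI_prime:
  assumes "J \<subseteq> {1..N}" "3 \<le> card J" "3 \<le> card ({1..N} - J)"
  shows "primeideal (QI N J) (RN N)" "primeideal (genI N {QJ J}) (polyR N)"
    "QI N J = cls N ` genI N {QJ J}"
proof -
  have c: "{QJ J} \<subseteq> carrier (polyR N)" using assms(1) QJ_in_carrier by blast
  show p: "primeideal (genI N {QJ J}) (polyR N)"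
    by (rule primeideal_genI_carrier[OF QJ_prime[OF assms] c])
  show e: "QI N J = cls N ` genI N {QJ J}" unfolding QI_eq by (rule Idl_RN[OF c])
  have "IN N \<subseteq> genI N {QJ J}" using IN_subset_iff[OF ideal_genI] base_gens_subset_genI by blast
  then show "primeideal (QI N J) (RN N)"
    unfolding e using primeideal_cls_image[OF ideal_genI] p by blast
qed

lemma pair_minimal_primes:
  assumes N: "N \<ge> 5" and ij: "i \<in> {1..N}" "j \<in> {1..N}" "i \<noteq> j"
  shows "{P. minprime_over (RN N) (QI N {i, j}) P} = {pPlus N {i, j}, pMinus N {i, j}}"
    "pPlus N {i, j} \<noteq> pMinus N {i, j}"
proof -
  define F where "F = (\<lambda>b. if b then minors (colsP {i, j}) else minors (colsM {i, j}))"
  have sub: "{i, j} \<subseteq> {1..N}" using ij by blast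
  have c: "F b \<subseteq> carrier (polyR N)" for b unfolding F_def using minors_carrier[OF sub] by auto
  have Qc: "QJ {i, j} \<in> carrier (polyR N)" using sub by (rule QJ_in_carrier)
  have prime: "primeideal (genI N (F b)) (polyR N)" for b
    unfolding F_def using primeideal_genI_carrier[OF colsP_prime[OF N ij] minors_carrier(1)[OF sub]]
      primeideal_genI_carrier[OF colsM_prime[OF N ij] minors_carrier(2)[OF sub]] by (cases b) simp_all
  have inc: "s = t" if "F s \<subseteq> genI N (F t)" for s t
    using that pair_incomparable[OF _ ij] N unfolding F_def by (cases s; cases t) auto
  have Q: "{QJ {i, j}} \<subseteq> genI N (F b)" for b
  proof -
    have "QJ {i, j} \<in> idl.span (F b)" unfolding F_def using QJ_in_minors_span[OF ij(3)] by auto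
    then show ?thesis unfolding genI_def using Qc idl.span_mono[of "F b" "gens N \<union> F b"] by blast
  qed
  have "{P. minprime_over (RN N) (Idl\<^bsub>RN N\<^esub> (cls N ` {QJ {i, j}})) P}
    = (\<lambda>b. Idl\<^bsub>RN N\<^esub> (cls N ` F b)) ` {True, False}"
  proof (rule minimal_primes)
    fix X assume "primeideal X (polyR N)" "base_gens N \<subseteq> X" "{QJ {i, j}} \<subseteq> X"
    then have "minors (colsP {i, j}) \<subseteq> X \<or> minors (colsM {i, j}) \<subseteq> X"
      by (intro prime_over_pair[OF _ _ _ ij]) simp_all
    then show "\<exists>s\<in>{True, False}. F s \<subseteq> X" unfolding F_def by auto
  next
    show "{QJ {i, j}} \<subseteq> carrier (polyR N)" using Qc by simp
  qed (rule c prime Q inc; assumption)+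
  moreover have pm: "pPlus N {i, j} = Idl\<^bsub>RN N\<^esub> (cls N ` F True)" "pMinus N {i, j}
    = Idl\<^bsub>RN N\<^esub> (cls N ` F False)"
    unfolding pmix_eq mix_minors_def F_def by (simp_all add: minors_empty)
  ultimately show "{P. minprime_over (RN N) (QI N {i, j}) P} = {pPlus N {i, j}, pMinus N {i, j}}"
    unfolding QI_eq by simp
  show "pPlus N {i, j} \<noteq> pMinus N {i, j}"
  proof
    assume "pPlus N {i, j} = pMinus N {i, j}"
    then have "cls N ` genI N (F True) \<subseteq> cls N ` genI N (F False)" unfolding pm Idl_RN[OF c] by simp
    moreover have "IN N \<subseteq> genI N (F b)" for b using IN_subset_iff[OF ideal_genI] base_gens_subset_genI
      by blast
    ultimately have "genI N (F True) \<subseteq> genI N (F False)" by (simp only: cls_image_inj ideal_genI)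
    then have "F True \<subseteq> genI N (F False)" using subset_genI[OF c] by blast
    then show False using inc by blast
  qed
qed

text \<open>Containment of \<open>Q_J'\<close> in \<open>P\<close> is already contradictory. Up to
  replacing \<open>J\<close> by its complement, \<open>P\<close> is generated by \<open>Q_J\<close>
  or by the plus or minus minors of a pair, and \<open>QJ_notin\<close> gives a configuration on
  which these vanish and \<open>Q_J'\<close> does not.\<close>

lemma unique_QJ:
  assumes N: "N \<ge> 5" and J: "internal N J" and J': "internal N J'"
    and P: "minprime_over (RN N) (QI N J) P" "QI N J' \<subseteq> P"
  shows "J' = J \<or> J' = {1..N} - J"
proof (rule ccontr)
  assume ne: "\<not> ?thesis"
  have sub: "J \<subseteq> {1..N}" "J' \<subseteq> {1..N}" and card: "2 \<le> card J" "card J \<le> N - 2"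
    using J J' unfolding internal_def by auto
  have cardc: "card ({1..N} - J) = N - card J" using sub(1) by (simp add: card_Diff_subset finite_subset)
  have contradiction: False if "P = cls N ` genI N F" "QJ J' \<notin> genI N F" for F
  proof -
    have c: "QJ J' \<in> carrier (polyR N)" using sub(2) by (rule QJ_in_carrier)
    have "cls N (QJ J') \<in> QI N J'"
      unfolding QI_eq using Idl_RN[of "{QJ J'}" N] subset_genI[of "{QJ J'}" N] c by auto
    then have "cls N (QJ J') \<in> cls N ` genI N F" using P(2) that(1) by blast
    moreover have "IN N \<subseteq> genI N F" using IN_subset_iff[OF ideal_genI] base_gens_subset_genI by blast
    ultimately show False using cls_image_mem_iff[OF ideal_genI _ c] that(2) by blast
  qed
  have pair: False if K: "K \<subseteq> {1..N}" "card K = 2" "J' \<noteq> K" "J' \<noteq> {1..N} - K"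
    "minprime_over (RN N) (QI N K) P" for K
  proof -
    obtain i j where ij: "K = {i, j}" "i \<noteq> j" using K(2) unfolding card_2_iff by blast
    then have "i \<in> {1..N}" "j \<in> {1..N}" using K(1) by auto
    then have "P = pPlus N K \<or> P = pMinus N K"
      using pair_minimal_primes(1)[OF N _ _ ij(2)] K(5) unfolding ij(1) by blast
    then have "P = cls N ` genI N (minors (colsP K)) \<or> P = cls N ` genI N (minors (colsM K))"
      unfolding pmix_eq mix_minors_def using Idl_RN minors_carrier[OF K(1)] by (simp add: minors_empty)
    then show False
      using contradiction QJ_notin(2,3)[OF K(1) J' K(3,4) ij] by blast
  qed
  consider "card J = 2" | "card ({1..N} - J) = 2" | "3 \<le> card J" "3 \<le> card ({1..N} - J)"
    using card cardc N by linarith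
  then show False
  proof cases
    case 1
    then show ?thesis using pair[OF sub(1)] ne P(1) by blast
  next
    case 2
    have "{1..N} - ({1..N} - J) = J" using sub(1) by blast
    then show ?thesis using pair[of "{1..N} - J"] 2 ne P(1) QI_compl[OF sub(1)] by auto
  next
    case 3
    note Q = QI_prime[OF sub(1) 3]
    have "QI N J = P" using P(1) Q(1) unfolding minprime_over_def by blast
    then show ?thesis using contradiction[of "{QJ J}"] Q(3) QJ_notin(1)[OF sub(1) J'] ne by blast
  qed
qed

section \<open>Four particles\<close>

text \<open>The sign patterns with an even number of minus signs: particles in the first component
  carry +, those in the second carry -.\<close>

definition four_index :: "(nat set \<times> nat set) set" where
  "four_index = {({1..4}, {}), ({}, {1..4})} \<union> {(S, {1..4} - S) | S. S \<subseteq> {1..4} \<and> card S = 2}"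

lemma pair_in_four_index: "S \<subseteq> {1..4} \<Longrightarrow> card S = 2 \<Longrightarrow> (S, {1..4} - S) \<in> four_index"
  unfolding four_index_def by blast

lemma split_pair_obtain:
  assumes "S \<subseteq> {1..4::nat}" "card S = 2"
  obtains i j k l where "S = {i, j}" "{1..4} - S = {k, l}" "{i, j, k, l} = {1..4}" "distinct [i, j, k, l]"
proof -
  obtain i j where ij: "S = {i, j}" "i \<noteq> j" using assms(2) unfolding card_2_iff by blast
  have "card ({1..4} - S) = 2" using assms by (simp add: card_Diff_subset finite_subset)
  then obtain k l where kl: "{1..4} - S = {k, l}" "k \<noteq> l" unfolding card_2_iff by blast
  have "k \<notin> S" "l \<notin> S" using kl(1) by blast+
  then have "distinct [i, j, k, l]" using ij kl(2) by auto
  moreover have "{i, j, k, l} = {1..4}" using assms(1) ij(1) kl(1) by blast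
  ultimately show thesis using that ij(1) kl(1) by blast
qed

lemma retract_minors:
  assumes "S \<subseteq> {1..}"
  shows "f \<in> minors (colsP S) \<Longrightarrow> retract N f \<in> insert 0 (minors (colsP (S \<inter> {1..N})))"
    "f \<in> minors (colsM S) \<Longrightarrow> retract N f \<in> insert 0 (minors (colsM (S \<inter> {1..N})))"
proof -
  have aux: "retract N f \<in> insert 0 (minors C')"
    if f: "f \<in> minors C" and C: "\<And>x y. (x, y) \<in> C \<Longrightarrow> (retract N x, retract N y) \<in> insert (0, 0) C'" for C C'
  proof -
    obtain x1 y1 x2 y2 where f: "f = x1 * y2 - x2 * y1" "(x1, y1) \<in> C" "(x2, y2) \<in> C"
      using f unfolding minors_def by blast
    show ?thesis
      using C[OF f(2)] C[OF f(3)] minors_intro[of "retract N x1" "retract N y1" C' "retract N x2"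
        "retract N y2"]
      unfolding f(1) by (auto simp: retract.hom_simps)
  qed
  have e: "retract N (g a) = (if a \<le> N then g a else 0)" if "a \<in> S" "g \<in> {va, vb, vc, vd}" for a g
  proof (cases "a \<le> N")
    case True
    then have "a \<in> {1..N}" using that(1) assms by auto
    from entries_in_carrier[OF this] show ?thesis using True that(2) retract_carrier by auto
  next
    case False
    then show ?thesis using that(2) retract_entries[of N a] by auto
  qed
  show "retract N f \<in> insert 0 (minors (colsP (S \<inter> {1..N})))" if f: "f \<in> minors (colsP S)"
  proof (rule aux[OF f])
    fix x y assume "(x, y) \<in> colsP S"
    then obtain a where a: "a \<in> S" "x = va a \<and> y = vc a \<or> x = vb a \<and> y = vd a" unfolding colsP_iff by blast
    then have "a \<ge> 1" using assms by auto
    then show "(retract N x, retract N y) \<in> insert (0, 0) (colsP (S \<inter> {1..N}))"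
      using a by (cases "a \<le> N") (auto simp: e colsP_iff)
  qed
  show "retract N f \<in> insert 0 (minors (colsM (S \<inter> {1..N})))" if f: "f \<in> minors (colsM S)"
  proof (rule aux[OF f])
    fix x y assume "(x, y) \<in> colsM S"
    then obtain a where a: "a \<in> S" "x = va a \<and> y = vb a \<or> x = vc a \<and> y = vd a" unfolding colsM_iff by blast
    then have "a \<ge> 1" using assms by auto
    then show "(retract N x, retract N y) \<in> insert (0, 0) (colsM (S \<inter> {1..N}))"
      using a by (cases "a \<le> N") (auto simp: e colsM_iff)
  qed
qed

lemma mix_minors_carrier: "s \<in> four_index \<Longrightarrow> mix_minors s \<subseteq> carrier (polyR 4)"
proof -
  assume s: "s \<in> four_index"
  obtain S T where sST: "s = (S, T)" by (cases s)
  then have "S \<subseteq> {1..4}" "T \<subseteq> {1..4}" using s unfolding four_index_def by auto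
  then show ?thesis using minors_carrier unfolding sST mix_minors_def by simp
qed

lemma minors_colsP_mono: "S \<subseteq> T \<Longrightarrow> minors (colsP S) \<subseteq> minors (colsP T)"
  unfolding minors_def colsP_def by blast

lemma minors_colsM_mono: "S \<subseteq> T \<Longrightarrow> minors (colsM S) \<subseteq> minors (colsM T)"
  unfolding minors_def colsM_def by blast

lemma four_prime:
  assumes "s \<in> four_index"
  shows "primeideal (genI 4 (mix_minors s)) (polyR 4)"
proof -
  have c: "mix_minors s \<subseteq> carrier (polyR 4)" using mix_minors_carrier assms .
  have int: "{1..} \<inter> {1..4} = {1..4::nat}" by auto
  consider "s = ({1..4}, {})" | "s = ({}, {1..4})" | S where "S \<subseteq> {1..4}" "card S = 2" "s = (S, {1..4} - S)"
    using assms unfolding four_index_def by blast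
  then show ?thesis
  proof cases
    case 1
    then have s: "mix_minors s = minors (colsP {1..4})" by (simp add: mix_minors_def minors_empty)
    have "is_prime (idl.span (gens 4 \<union> minors (colsP {1..})))" by (rule all_plus_prime) simp
    then show ?thesis
      by (rule primeideal_genI[OF _ _ _ c])
        (use s minors_colsP_mono[of "{1..4}" "{1..}"] retract_minors(1)[of "{1..}" _ 4] int in auto)
  next
    case 2
    then have s: "mix_minors s = minors (colsM {1..4})" by (simp add: mix_minors_def minors_empty)
    have "is_prime (idl.span (gens 4 \<union> trans_k ` minors (colsP {1..})))"
      by (intro prime_trans_k all_plus_prime) simp
    then have "is_prime (idl.span (gens 4 \<union> minors (colsM {1..})))"
      unfolding trans_k_minors(1)[OF subset_refl] .
    then show ?thesis
      by (rule primeideal_genI[OF _ _ _ c])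
        (use s minors_colsM_mono[of "{1..4}" "{1..}"] retract_minors(2)[of "{1..}" _ 4] int in auto)
  next
    case 3
    obtain i j k l where ijkl: "S = {i, j}" "{1..4} - S = {k, l}" "{i, j, k, l} = {1..4}"
      "distinct [i, j, k, l]"
      using split_pair_obtain[OF 3(1,2)] .
    have s: "mix_minors s = minors (colsP {i, j}) \<union> minors (colsM {k, l})"
      using 3(3) ijkl(1,2) by (simp add: mix_minors_def)
    from mixed_prime[OF ijkl(3,4)] show ?thesis
    proof (rule primeideal_genI[OF _ _ _ c])
      show "mix_minors s \<subseteq> minors (colsP {i, j}) \<union> minors (colsM {k, l}) \<union> outer_vars" unfolding s by blast
      fix f assume "f \<in> minors (colsP {i, j}) \<union> minors (colsM {k, l}) \<union> outer_vars"
      then consider "f \<in> mix_minors s" | "f \<in> outer_vars" unfolding s by blast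
      then show "retract 4 f \<in> insert 0 (mix_minors s)"
      proof cases
        case 1
        then show ?thesis using c retract_carrier[of f 4] by auto
      next
        case 2
        then show ?thesis unfolding outer_vars_def using retract_entries[of 4] by auto
      qed
    qed
  qed
qed

text \<open>All \<lambda> equal (1, 0), so every plus minor vanishes. The \<mu> are (1, 0), (0, 1),
  (1, 2), (-2, -3): they sum to zero and any two are independent, so no pair satisfies its minus
  condition.\<close>

definition plus_point :: "nat \<Rightarrow> complex" where
  "plus_point = blk (\<lambda>m. if m = 1 then 1 else if m = 3 then 1 else if m = 4 then - 2 else 0)
     (\<lambda>m. if m = 2 then 1 else if m = 3 then 2 else if m = 4 then - 3 else 0) (\<lambda>m. 0) (\<lambda>m. 0)"

lemma ev_plus_point:
  assumes "m \<ge> 1"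
  shows "ev plus_point (va m) = (if m = 1 then 1 else if m = 3 then 1 else if m = 4 then - 2 else 0)"
    "ev plus_point (vb m) = (if m = 2 then 1 else if m = 3 then 2 else if m = 4 then - 3 else 0)"
    "ev plus_point (vc m) = 0" "ev plus_point (vd m) = 0"
  using assms by (simp_all add: plus_point_def ev_blk)

lemma ev_plus_point_gens: "g \<in> gens 4 \<Longrightarrow> ev plus_point g = 0"
proof -
  assume g: "g \<in> gens 4"
  have "{1..4} = {1, 2, 3, 4 :: nat}" by auto
  then have "ev plus_point s = 0" if "s \<in> msums 4" for s
    using that unfolding msums_def by (auto simp: ev.hom_simps ev_plus_point)
  moreover have "ev plus_point (QJ {m}) = 0" if "m \<ge> 1" for m
    using that by (simp add: QJ_def ev.hom_simps ev_plus_point)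
  ultimately show ?thesis using g unfolding gens_def dets_def by auto
qed

lemma ev_plus_point_colsP:
  assumes "f \<in> minors (colsP {1..4})"
  shows "ev plus_point f = 0"
proof (rule ev_minors_zero[OF assms, where A = 1 and B = 0])
  fix p q assume "(p, q) \<in> colsP {1..4}"
  then obtain a where a: "a \<in> {1..4}" "p = va a \<and> q = vc a \<or> p = vb a \<and> q = vd a" unfolding colsP_iff by blast
  then have "a \<ge> 1" by simp
  then have "ev plus_point q = 0" using a(2) by (auto simp: ev_plus_point)
  then show "\<exists>m. ev plus_point p = 1 * m \<and> ev plus_point q = 0 * m" by simp
qed

lemma ev_plus_point_nonzero:
  assumes "a \<in> {1..4}" "b \<in> {1..4}" "a \<noteq> b"
  shows "ev plus_point (va a * vb b - va b * vb a) \<noteq> 0"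
proof -
  have "a \<in> {1, 2, 3, 4}" "b \<in> {1, 2, 3, 4}" using assms by auto
  then show ?thesis using assms(3)
    by (elim insertE emptyE) (simp_all add: ev.hom_simps ev_plus_point)
qed

lemma two_elements:
  assumes "2 \<le> card A"
  obtains a b where "a \<in> A" "b \<in> A" "a \<noteq> b"
proof -
  obtain B where "B \<subseteq> A" "card B = 2" by (rule obtain_subset_with_card_n[OF assms])
  then obtain a b where "B = {a, b}" "a \<noteq> b" unfolding card_2_iff by blast
  then show thesis using that[of a b] \<open>B \<subseteq> A\<close> by blast
qed

text \<open>Each prime of the list has a configuration on it that avoids the generators of the
  others. For ++++ it is \<open>plus_point\<close>, for ---- its transpose, and for a mixed pattern
  the four-point configuration adapted to the two pairs.\<close>

lemma four_incomparable:
  assumes s: "s \<in> four_index" and t: "t \<in> four_index" and sub: "mix_minors s \<subseteq> genI 4 (mix_minors t)"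
  shows "s = t"
proof (rule ccontr)
  assume ne: "s \<noteq> t"
  obtain S T where sST: "s = (S, T)" by (cases s)
  have ST: "S \<subseteq> {1..4}" "T \<subseteq> {1..4}" using s unfolding sST four_index_def by auto
  have cases_s: "(S = {1..4} \<and> T = {}) \<or> (S = {} \<and> T = {1..4}) \<or> (card S = 2 \<and> T = {1..4} - S)"
    using s unfolding sST four_index_def by auto
  have two: "card T = 2" if "card S = 2" "T = {1..4} - S"
    using that ST(1) by (simp add: card_Diff_subset finite_subset)
  have notin: "f \<in> genI 4 (mix_minors t)" if "f \<in> minors (colsP S) \<or> f \<in> minors (colsM T)" for f
    using sub that unfolding sST mix_minors_def by auto
  have P: "va a * vc b - va b * vc a \<in> minors (colsP S)" "vb a * vc b - va b * vd a \<in> minors (colsP S)"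
    if "a \<in> S" "b \<in> S" for a b
    using that by (intro minors_intro; auto simp: colsP_iff)+
  have M: "va a * vb b - va b * vb a \<in> minors (colsM T)" "va a * vd b - vc b * vb a \<in> minors (colsM T)"
    if "a \<in> T" "b \<in> T" for a b
    using that by (intro minors_intro; auto simp: colsM_iff)+
  have S1: "{1..4::nat} \<subseteq> {1..}" by auto
  consider "t = ({1..4}, {})" | "t = ({}, {1..4})" | K where "K \<subseteq> {1..4}" "card K = 2" "t = (K, {1..4} - K)"
    using t unfolding four_index_def by blast
  then show False
  proof cases
    case 1
    then have "2 \<le> card T" using cases_s two ne sST by auto
    then obtain a b where ab: "a \<in> T" "b \<in> T" "a \<noteq> b" by (rule two_elements)
    have ab4: "a \<in> {1..4}" "b \<in> {1..4}" using ab ST(2) by blast+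
    have "va a * vb b - va b * vb a \<notin> genI 4 (mix_minors t)"
      by (rule ev_notin_genI[OF ev_plus_point_gens _ ev_plus_point_nonzero[OF ab4 ab(3)]])
        (use 1 ev_plus_point_colsP in \<open>simp_all add: mix_minors_def minors_empty\<close>)
    then show False using notin M(1)[OF ab(1,2)] by blast
  next
    case 2
    then have "2 \<le> card S" using cases_s ne sST by auto
    then obtain a b where ab: "a \<in> S" "b \<in> S" "a \<noteq> b" by (rule two_elements)
    have ab1: "a \<ge> 1" "b \<ge> 1" "a \<in> {1..4}" "b \<in> {1..4}" using ab ST by auto
    have "trans_k (va a * vc b - va b * vc a) = va a * vb b - va b * vb a"
      using ab1 by (simp add: trans_k.hom_simps trans_k_entries)
    then have nz: "ev plus_point (trans_k (va a * vc b - va b * vc a)) \<noteq> 0"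
      using ev_plus_point_nonzero[OF ab1(3,4) ab(3)] by simp
    have "va a * vc b - va b * vc a \<notin> genI 4 (mix_minors t)"
    proof (rule trans_k_genI_notin[where z = plus_point])
      show "ev plus_point (trans_k g) = 0" if "g \<in> mix_minors t" for g
      proof -
        have "g \<in> minors (colsM {1..4})" using that 2 by (simp add: mix_minors_def minors_empty)
        then have "trans_k g \<in> minors (colsP {1..4})" using trans_k_minors(2)[OF S1] by blast
        then show ?thesis by (rule ev_plus_point_colsP)
      qed
    qed (use nz ev_plus_point_gens in auto)
    then show False using notin P(1)[OF ab(1,2)] by blast
  next
    case 3
    obtain i j k l where K: "K = {i, j}" "{1..4} - K = {k, l}" "{i, j, k, l} = {1..4}" and dist:
      "distinct [i, j, k, l]"
      using split_pair_obtain[OF 3(1,2)] .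
    have ge1: "m \<ge> 1" if "m \<in> {i, j, k, l}" for m using that unfolding K(3) by simp
    let ?z = "four_point i j k l"
    have vanish: "f \<notin> genI 4 (mix_minors t)" if nz: "ev ?z f \<noteq> 0" for f
    proof (rule ev_notin_genI[OF _ _ nz])
      show "ev ?z g = 0" if "g \<in> gens 4" for g
        using ev_four_point_gens[OF _ dist that] K(3) by simp
      show "ev ?z g = 0" if "g \<in> mix_minors t" for g
      proof -
        have "g \<in> minors (colsP {i, j}) \<or> g \<in> minors (colsM {k, l})"
          using that 3(3) K(1,2) by (auto simp: mix_minors_def)
        then show ?thesis
          using ev_four_point_colsP[OF _ ge1 ge1 dist] ev_four_point_colsM[OF _ ge1 ge1 dist] by blast
      qed
    qed
    have d: "delta a a = 1" "a \<noteq> b \<Longrightarrow> delta a b = 0" for a b by (simp_all add: delta_def)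
    have neq: "i \<noteq> j" "i \<noteq> k" "i \<noteq> l" "j \<noteq> k" "j \<noteq> l" "k \<noteq> l" "j \<noteq> i" "k \<noteq> i" "l \<noteq> i" "k \<noteq> j" "l \<noteq> j" "l \<noteq> k"
      using dist by auto
    have g: "i \<ge> 1" "j \<ge> 1" "k \<ge> 1" "l \<ge> 1" using ge1 by blast+
    note evs = ev_four_point[OF g(1)] ev_four_point[OF g(2)] ev_four_point[OF g(3)] ev_four_point[OF g(4)]
    \<comment> \<open>For \<open>a\<close> in \<open>{i, j}\<close> and \<open>b\<close> in
      \<open>{k, l}\<close> the minor of the second column of k_a and the first column of k_b is 1
      or -1, because \<open>vb a\<close> and \<open>vc b\<close> are and all \<open>vd\<close> are
      0. So \<open>S\<close> cannot meet both pairs.\<close>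
    have PP: "\<not> (a \<in> S \<and> b \<in> S)" if "a \<in> {i, j}" "b \<in> {k, l}" for a b
    proof
      assume ab: "a \<in> S \<and> b \<in> S"
      have "ev ?z (vb a * vc b - va b * vd a) \<noteq> 0"
        using that by (elim insertE emptyE) (simp_all add: ev.hom_diff ev.hom_mult evs d neq)
      then show False using vanish notin P(2) ab by blast
    qed
    have "\<not> (k \<in> S \<and> l \<in> S)"
    proof
      assume kl: "k \<in> S \<and> l \<in> S"
      have "ev ?z (va k * vc l - va l * vc k) \<noteq> 0"
        by (simp add: ev.hom_diff ev.hom_mult evs d neq)
      then show False using vanish notin P(1) kl by blast
    qed
    moreover have "\<not> (i \<in> T \<and> k \<in> T)"
    proof
      assume ik: "i \<in> T \<and> k \<in> T"
      have "ev ?z (va i * vd k - vc k * vb i) \<noteq> 0"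
        by (simp add: ev.hom_diff ev.hom_mult evs d neq)
      then show False using vanish notin M(2) ik by blast
    qed
    ultimately have no: "\<not> (k \<in> S \<and> l \<in> S)" "T \<noteq> {1..4}" "S \<noteq> {1..4}"
      using PP[of i k] unfolding K(3)[symmetric] by blast+
    then have S2: "card S = 2" "T = {1..4} - S" using cases_s by blast+
    then obtain a b where ab: "S = {a, b}" "a \<noteq> b" unfolding card_2_iff by blast
    then have "a \<in> {i, j, k, l}" "b \<in> {i, j, k, l}" using ST(1) unfolding K(3) by blast+
    then have "S = {i, j}" using no(1) PP ab by blast
    then show False using ne S2(2) K(1) 3(3) sST by simp
  qed
qed

lemma four_minimal_primes:
  assumes S: "S \<subseteq> {1..4}" "card S = 2"
  shows "{P. minprime_over (RN 4) (QI 4 S) P}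
    = {pPlus 4 {1..4}, pMinus 4 {1..4}, pmix 4 S ({1..4} - S), pmix 4 ({1..4} - S) S}"
proof -
  obtain i j k l where ijkl: "S = {i, j}" "{1..4} - S = {k, l}" "{i, j, k, l} = {1..4}"
    "distinct [i, j, k, l]"
    using split_pair_obtain[OF S] .
  define I where "I = {({1..4}, {}), ({}, {1..4}), ({i, j}, {k, l}), ({k, l}, {i, j})}"
  have Sc: "{1..4} - {k, l} = {i, j}" "card {k, l} = 2" "{k, l} \<subseteq> {1..4}"
    unfolding ijkl(3)[symmetric] using ijkl(4) by auto
  have I: "I \<subseteq> four_index"
  proof -
    have "({i, j}, {k, l}) \<in> four_index" using pair_in_four_index[OF S] unfolding ijkl(2) unfolding ijkl(1) .
    moreover have "({k, l}, {i, j}) \<in> four_index" using pair_in_four_index[OF Sc(3,2)] unfolding Sc(1) .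
    moreover have "({1..4}, {}) \<in> four_index" "({}, {1..4}) \<in> four_index" by (simp_all add: four_index_def)
    ultimately show ?thesis unfolding I_def by blast
  qed
  have Qc: "QJ {i, j} \<in> carrier (polyR 4)" using S(1) ijkl(1) QJ_in_carrier by blast
  have "{P. minprime_over (RN 4) (Idl\<^bsub>RN 4\<^esub> (cls 4 ` {QJ {i, j}})) P}
    = (\<lambda>s. Idl\<^bsub>RN 4\<^esub> (cls 4 ` mix_minors s)) ` I"
  proof (rule minimal_primes)
    show "{QJ {i, j}} \<subseteq> carrier (polyR 4)" using Qc by simp
    fix s assume s: "s \<in> I"
    then show "mix_minors s \<subseteq> carrier (polyR 4)" "primeideal (genI 4 (mix_minors s)) (polyR 4)"
      using I mix_minors_carrier four_prime by blast+
    show "s = t" if "t \<in> I" "mix_minors s \<subseteq> genI 4 (mix_minors t)" for t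
      using that s I four_incomparable by blast
    have sub: "{i, j} \<subseteq> {1..4}" using S(1) ijkl(1) by blast
    have "minors (colsP {i, j}) \<subseteq> mix_minors s \<or> minors (colsM {i, j}) \<subseteq> mix_minors s"
      using s minors_colsP_mono[OF sub] minors_colsM_mono[OF sub] unfolding I_def by
        (auto simp: mix_minors_def)
    then have "QJ {i, j} \<in> idl.span (mix_minors s)"
      using QJ_in_minors_span[of i j] ijkl(4) idl.span_mono[of "minors (colsP {i, j})" "mix_minors s"]
        idl.span_mono[of "minors (colsM {i, j})" "mix_minors s"] by auto
    then show "{QJ {i, j}} \<subseteq> genI 4 (mix_minors s)"
      unfolding genI_def using Qc idl.span_mono[of "mix_minors s" "gens 4 \<union> mix_minors s"] by blast
  next
    fix X assume "primeideal X (polyR 4)" "base_gens 4 \<subseteq> X" "{QJ {i, j}} \<subseteq> X"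
    then show "\<exists>s\<in>I. mix_minors s \<subseteq> X"
      unfolding I_def using prime_over_four[OF _ _ _ ijkl(3,4), of X] by simp
  qed
  then show ?thesis unfolding QI_eq pmix_eq ijkl(1) ijkl(2)[unfolded ijkl(1)] I_def by simp
qed

lemma PrimesN_4_image: "PrimesN 4 = (\<lambda>(S, T). pmix 4 S T) ` four_index"
proof -
  have internal: "internal 4 J \<longleftrightarrow> J \<subseteq> {1..4} \<and> card J = 2" for J
    unfolding internal_def by auto
  have "PrimesN 4 = (\<Union>J\<in>{J. J \<subseteq> {1..4} \<and> card J = 2}. {P. minprime_over (RN 4) (QI 4 J) P})"
    unfolding PrimesN_def internal by blast
  also have "\<dots> = (\<Union>J\<in>{J. J \<subseteq> {1..4} \<and> card J = 2}.
    {pPlus 4 {1..4}, pMinus 4 {1..4}, pmix 4 J ({1..4} - J), pmix 4 ({1..4} - J) J})"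
    using four_minimal_primes by simp
  also have "\<dots> = (\<lambda>(S, T). pmix 4 S T) ` four_index"
  proof (intro equalityI subsetI)
    fix P assume "P \<in> (\<Union>J\<in>{J. J \<subseteq> {1..4} \<and> card J = 2}.
      {pPlus 4 {1..4}, pMinus 4 {1..4}, pmix 4 J ({1..4} - J), pmix 4 ({1..4} - J) J})"
    then obtain J where J: "J \<subseteq> {1..4}" "card J = 2"
      "P \<in> {pPlus 4 {1..4}, pMinus 4 {1..4}, pmix 4 J ({1..4} - J), pmix 4 ({1..4} - J) J}" by blast
    have "{1..4} - ({1..4} - J) = J" using J(1) by blast
    moreover have "card ({1..4} - J) = 2" using J(1,2) by (simp add: card_Diff_subset finite_subset)
    ultimately have "({1..4} - J, J) \<in> four_index" unfolding four_index_def by force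
    moreover have "(J, {1..4} - J) \<in> four_index" "({1..4}, {}) \<in> four_index" "({}, {1..4}) \<in> four_index"
      using J(1,2) unfolding four_index_def by blast+
    ultimately show "P \<in> (\<lambda>(S, T). pmix 4 S T) ` four_index" using J(3) by force
  next
    fix P assume "P \<in> (\<lambda>(S, T). pmix 4 S T) ` four_index"
    then obtain S T where ST: "(S, T) \<in> four_index" "P = pmix 4 S T" by auto
    \<comment> \<open>The patterns ++++ and ---- occur over every pair; one pair is enough to
      witness them.\<close>
    have "{1, 2} \<subseteq> {1..4::nat}" "card {1, 2 :: nat} = 2" by auto
    then have ex: "{1, 2 :: nat} \<in> {J. J \<subseteq> {1..4} \<and> card J = 2}" by blast
    consider "S = {1..4} \<and> T = {} \<or> S = {} \<and> T = {1..4}" | "S \<subseteq> {1..4}" "card S = 2" "T = {1..4} - S"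
      using ST(1) unfolding four_index_def by blast
    then show "P \<in> (\<Union>J\<in>{J. J \<subseteq> {1..4} \<and> card J = 2}.
      {pPlus 4 {1..4}, pMinus 4 {1..4}, pmix 4 J ({1..4} - J), pmix 4 ({1..4} - J) J})"
      by cases (use ST(2) ex in blast)+
  qed
  finally show ?thesis .
qed

lemma inj_on_pmix_four: "inj_on (\<lambda>(S, T). pmix 4 S T) four_index"
proof (rule inj_onI)
  fix s t assume st: "s \<in> four_index" "t \<in> four_index" "(\<lambda>(S, T). pmix 4 S T) s = (\<lambda>(S, T). pmix 4 S T) t"
  then have "Idl\<^bsub>RN 4\<^esub> (cls 4 ` mix_minors s) = Idl\<^bsub>RN 4\<^esub> (cls 4 ` mix_minors t)"
    by (cases s; cases t) (simp only: prod.case pmix_eq)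
  then have "cls 4 ` genI 4 (mix_minors s) \<subseteq> cls 4 ` genI 4 (mix_minors t)"
    using Idl_RN[OF mix_minors_carrier[OF st(1)]] Idl_RN[OF mix_minors_carrier[OF st(2)]] by simp
  moreover have "IN 4 \<subseteq> genI 4 F" for F using IN_subset_iff[OF ideal_genI] base_gens_subset_genI by blast
  ultimately have "genI 4 (mix_minors s) \<subseteq> genI 4 (mix_minors t)" by (simp only: cls_image_inj ideal_genI)
  then have "mix_minors s \<subseteq> genI 4 (mix_minors t)"
    using subset_genI[OF mix_minors_carrier[OF st(1)]] by blast
  then show "s = t" using four_incomparable st(1,2) by blast
qed

lemma card_four_index: "card four_index = 8"
proof -
  define A where "A = {S. S \<subseteq> {1..4::nat} \<and> card S = 2}"
  have "card A = card {1..4::nat} choose 2" unfolding A_def by (rule n_subsets) simp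
  then have A: "card A = 6" "finite A" by (simp_all add: choose_two A_def)
  define B where "B = (\<lambda>S. (S, {1..4} - S)) ` A"
  have B: "card B = 6" "finite B" unfolding B_def using A by (simp_all add: card_image inj_on_def)
  have new: "({}, {1..4}) \<notin> B" "({1..4}, {}) \<notin> insert ({}, {1..4}) B" unfolding B_def A_def by auto
  have "four_index = insert ({1..4}, {}) (insert ({}, {1..4}) B)"
    unfolding four_index_def B_def A_def by auto
  then have "card four_index = Suc (card (insert ({}, {1..4}) B))"
    using card_insert_disjoint[OF _ new(2)] B(2) by (simp only: finite_insert)
  also have "\<dots> = Suc (Suc 6)" using card_insert_disjoint[OF B(2) new(1)] B(1) by (simp only:)
  finally show ?thesis by simp
qed

theorem mainTheorem15:
  shows
   "PrimesN 4 = {pPlus 4 {1..4}, pMinus 4 {1..4}}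
                \<union> {pmix 4 S ({1..4} - S) | S. S \<subseteq> {1..4} \<and> card S = 2}
    \<and> card (PrimesN 4) = 8
    \<and> (\<forall>J \<in> {{1,2},{1,3},{1,4}}.
          minprime_over (RN 4) (QI 4 J) (pPlus 4 {1..4})
        \<and> minprime_over (RN 4) (QI 4 J) (pMinus 4 {1..4}))
    \<and> (\<forall>S. S \<subseteq> {1..4} \<and> card S = 2 \<longrightarrow>
          QI 4 S = QI 4 ({1..4} - S)
        \<and> minprime_over (RN 4) (QI 4 S) (pmix 4 S ({1..4} - S)))
    \<and> (\<forall>N\<ge>5.
          (\<forall>P\<in>PrimesN N. \<forall>J J'. internal N J \<and> internal N J'
              \<and> minprime_over (RN N) (QI N J) P \<and> minprime_over (RN N) (QI N J') P
              \<longrightarrow> J' = J \<or> J' = {1..N} - J)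
        \<and> (\<forall>J. internal N J \<and> 3 \<le> card J \<and> 3 \<le> card ({1..N} - J)
              \<longrightarrow> primeideal (QI N J) (RN N))
        \<and> (\<forall>i j. i \<in> {1..N} \<and> j \<in> {1..N} \<and> i \<noteq> j \<longrightarrow>
              {P. minprime_over (RN N) (QI N {i,j}) P} = {pPlus N {i,j}, pMinus N {i,j}}
            \<and> pPlus N {i,j} \<noteq> pMinus N {i,j}))"
proof (intro conjI allI ballI impI)
  show "PrimesN 4 = {pPlus 4 {1..4}, pMinus 4 {1..4}}
      \<union> {pmix 4 S ({1..4} - S) | S. S \<subseteq> {1..4} \<and> card S = 2}"
    unfolding PrimesN_4_image four_index_def by auto
  show "card (PrimesN 4) = 8"
    unfolding PrimesN_4_image card_image[OF inj_on_pmix_four] by (rule card_four_index)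
next
  fix J :: "nat set" assume "J \<in> {{1,2},{1,3},{1,4}}"
  then have "J \<subseteq> {1..4}" "card J = 2" by auto
  from four_minimal_primes[OF this]
  show "minprime_over (RN 4) (QI 4 J) (pPlus 4 {1..4})" "minprime_over (RN 4) (QI 4 J) (pMinus 4 {1..4})"
    by blast+
next
  fix S :: "nat set" assume S: "S \<subseteq> {1..4} \<and> card S = 2"
  then show "QI 4 S = QI 4 ({1..4} - S)" by (intro QI_compl) blast
  show "minprime_over (RN 4) (QI 4 S) (pmix 4 S ({1..4} - S))"
    using four_minimal_primes[of S] S by blast
next
  fix N :: nat and P J J'
  assume "N \<ge> 5" "internal N J \<and> internal N J' \<and> minprime_over (RN N) (QI N J) P
    \<and> minprime_over (RN N) (QI N J') P"
  then show "J' = J \<or> J' = {1..N} - J"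
    using unique_QJ[of N J J' P] unfolding minprime_over_def[of _ "QI N J'"] by blast
next
  fix N :: nat and J
  assume "internal N J \<and> 3 \<le> card J \<and> 3 \<le> card ({1..N} - J)"
  then show "primeideal (QI N J) (RN N)"
    unfolding internal_def by (intro QI_prime(1)) simp_all
next
  fix N i j :: nat
  assume "N \<ge> 5" "i \<in> {1..N} \<and> j \<in> {1..N} \<and> i \<noteq> j"
  then show "{P. minprime_over (RN N) (QI N {i,j}) P} = {pPlus N {i,j}, pMinus N {i,j}}"
    "pPlus N {i,j} \<noteq> pMinus N {i,j}"
    using pair_minimal_primes[of N i j] by blast+
qed

end
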